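(* Let $\mathcal{L}:M_n(\mathbb{C})\to[0,\infty)$ be a symmetric Lagrangian which is nondegenerate, let $b>0$, and let $\mathcal{S}(\alpha)=\int_0^b\mathcal{L}(\dot\alpha(t))\,dt$. Let $Z$ be a Hermitian $n\times n$ matrix with $\|Z\|<\pi$, let $U\in\mathcal{U}(n)$ and $V=Ue^{iZ}$. If $\alpha:[0,b]\to\mathcal{U}(n)$ is a piecewise $C^1$ curve with $\alpha(0)=U$ and $\alpha(b)=V$ that minimizes $\mathcal{S}$ among all piecewise $C^1$ curves $[0,b]\to\mathcal{U}(n)$ joining $U$ to $V$, then $\alpha$ is a reparametrization of the geodesic segment $\gamma:[0,b]\to\mathcal{U}(n)$, $\gamma(t)=Ue^{itZ/b}$.
   Context: $M_n(\mathbb{C})$ is the algebra of complex $n\times n$ matrices, $\mathcal{H}(n)$ the real space of Hermitian matrices, $\mathcal{U}(n)$ the group of unitary matrices, $\|\cdot\|$ the spectral (operator) norm. A symmetric Lagrangian is a convex function $\mathcal{L}:M_n(\mathbb{C})\to[0,\infty)$ with $\mathcal{L}(0)=0$ and $\mathcal{L}(UAV)=\mathcal{L}(A)$ for all $A\in M_n(\mathbb{C})$ and all $U,V\in\mathcal{U}(n)$. $\mathcal{L}$ is nondegenerate if, for $A,B\in\mathcal{H}(n)$, the equality $\mathcal{L}(\lambda A+(1-\lambda)B)=\lambda\mathcal{L}(A)+(1-\lambda)\mathcal{L}(B)$ for some $\lambda\in(0,1)$ implies that $A=sB$ or $B=sA$ for some real $s\ge0$. A curve is piecewise $C^1$ if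 it is continuous and there is a finite partition of $[0,b]$ such that it is $C^1$ on each closed subinterval. A reparametrization of $\gamma$ is a curve $\gamma\circ\tau$ with $\tau:[0,b]\to[0,b]$ continuous, nondecreasing and surjective. *)

theory Defs
  imports "HOL-Analysis.Analysis"
begin

definition conj_transpose :: "complex^'n^'m \<Rightarrow> complex^'m^'n" where
  "conj_transpose A = map_matrix cnj (transpose A)"

definition hermitian :: "(complex^'n^'n) set" where
  "hermitian = {A. conj_transpose A = A}"

definition unitary :: "(complex^'n^'n) set" where
  "unitary = {U. conj_transpose U ** U = mat 1 \<and> U ** conj_transpose U = mat 1}"

text \<open>The library norm on \<^typ>\<open>complex^'n\<close> is the Hermitian \<open>l2\<close>-norm, so the operator
  norm below is the spectral norm. The norm that the library puts on \<^typ>\<open>complex^'n^'n\<close>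
  is the Frobenius norm; it is used here only through the topology it induces.\<close>

definition spectral_norm :: "complex^'n^'n \<Rightarrow> real" where
  "spectral_norm A = onorm (\<lambda>x. A *v x)"

text \<open>\<^const>\<open>exp\<close> and \<open>^\<close> are not usable on \<^typ>\<open>complex^'n^'n\<close>, where \<open>*\<close> is the
  entrywise product; hence the power series is written with \<open>**\<close>.\<close>

definition mat_exp :: "complex^'n^'n \<Rightarrow> complex^'n^'n" where
  "mat_exp A = (\<Sum>k. (1 / fact k) *\<^sub>R (((**) A ^^ k) (mat 1)))"

definition symmetric_lagrangian :: "(complex^'n^'n \<Rightarrow> real) \<Rightarrow> bool" where
  "symmetric_lagrangian L \<longleftrightarrow>
     (\<forall>A. 0 \<le> L A) \<and> convex_on UNIV L \<and> L 0 = 0 \<and>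
     (\<forall>A. \<forall>U\<in>unitary. \<forall>V\<in>unitary. L (U ** A ** V) = L A)"

definition nondegenerate_lagrangian :: "(complex^'n^'n \<Rightarrow> real) \<Rightarrow> bool" where
  "nondegenerate_lagrangian L \<longleftrightarrow>
     (\<forall>A\<in>hermitian. \<forall>B\<in>hermitian.
        (\<exists>l. 0 < l \<and> l < 1 \<and> L (l *\<^sub>R A + (1 - l) *\<^sub>R B) = l * L A + (1 - l) * L B) \<longrightarrow>
        (\<exists>s\<ge>0. A = s *\<^sub>R B \<or> B = s *\<^sub>R A))"

definition C1_on_interval :: "real \<Rightarrow> real \<Rightarrow> (real \<Rightarrow> 'a::real_normed_vector) \<Rightarrow> bool" where
  "C1_on_interval c d f \<longleftrightarrow>
     (\<exists>f'. continuous_on {c..d} f' \<and>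
           (\<forall>t\<in>{c..d}. (f has_vector_derivative f' t) (at t within {c..d})))"

text \<open>Stricter than the library's \<open>piecewise_C1_differentiable_on\<close>, which puts no condition
  on the derivative near the break points: here it has one-sided limits there.\<close>

definition piecewise_C1 :: "real \<Rightarrow> (real \<Rightarrow> 'a::real_normed_vector) \<Rightarrow> bool" where
  "piecewise_C1 b f \<longleftrightarrow>
     continuous_on {0..b} f \<and>
     (\<exists>(m::nat) p. p 0 = 0 \<and> p m = b \<and>
        (\<forall>i<m. p i < p (Suc i) \<and> C1_on_interval (p i) (p (Suc i)) f))"

text \<open>Curves are total functions on \<^typ>\<open>real\<close>; only their values on \<open>{0..b}\<close> matter.\<close>

definition joining_curve ::
  "real \<Rightarrow> complex^'n^'n \<Rightarrow> complex^'n^'n \<Rightarrow> (real \<Rightarrow> complex^'n^'n) \<Rightarrow> bool" where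
  "joining_curve b U V f \<longleftrightarrow>
     piecewise_C1 b f \<and> (\<forall>t\<in>{0..b}. f t \<in> unitary) \<and> f 0 = U \<and> f b = V"

text \<open>At the finitely many break points of a piecewise \<open>C1\<close> curve the integrand may have
  an arbitrary value, which does not affect the integral.\<close>

definition action :: "(complex^'n^'n \<Rightarrow> real) \<Rightarrow> real \<Rightarrow> (real \<Rightarrow> complex^'n^'n) \<Rightarrow> real" where
  "action L b f = integral {0..b} (\<lambda>t. L (vector_derivative f (at t within {0..b})))"

definition reparametrization :: "real \<Rightarrow> (real \<Rightarrow> 'a) \<Rightarrow> (real \<Rightarrow> 'a) \<Rightarrow> bool" where
  "reparametrization b g f \<longleftrightarrow>
     (\<exists>\<tau>. continuous_on {0..b} \<tau> \<and> mono_on {0..b} \<tau> \<and> \<tau> ` {0..b} = {0..b} \<and>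
          (\<forall>t\<in>{0..b}. f t = g (\<tau> t)))"

end

theory Submission
  imports Defs
begin

text \<open>
  Let \<open>W\<close> be a Hermitian subgradient of \<open>L\<close> at \<open>Z/b\<close> and \<open>N\<close> the unitarily invariant seminorm
  \<open>N(A) = sup Re tr(W* P A Q)\<close> over unitary \<open>P\<close>, \<open>Q\<close>. Then \<open>L(X) \<ge> L(Z/b) + N(X) - N(Z)/b\<close> for
  Hermitian \<open>X\<close>, so the action is bounded below by means of the \<open>N\<close>-length of the curve.
  The \<open>N\<close>-length is at least \<open>N(Z)\<close>, because \<open>G \<mapsto> N(log G)\<close>, with the spectrum of \<open>log G\<close> in
  \<open>[-i pi, i pi]\<close>, grows along a curve at most as fast as its \<open>N\<close>-length. As the geodesic attains
  the bound, a minimizer has equality at almost every time; nondegeneracy then makes the singular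
  values of its velocity proportional to those of \<open>Z\<close>, and so its Frobenius length is that of \<open>Z\<close>.
  Finally, for every eigenvector \<open>v\<close> of \<open>Z\<close> the curve \<open>\<alpha>(t) v\<close> lies on a unit sphere and joins two
  points that are not antipodal; comparing spherical angles with the Frobenius length forces
  all these curves onto great circle arcs with a common parameter.
\<close>

text \<open>The support inequality rests on invariance: \<open>L X = L (P ** X ** Q)\<close>, so the
  subgradient inequality at \<open>Z/b\<close> may be applied to every Hermitian matrix in the
  two-sided orbit of \<open>X\<close>, and one of these attains \<open>N X\<close>. For
  \<open>X = Z/b\<close> the same argument shows that \<open>W\<close> pairs with \<open>Z/b\<close>
  to exactly \<open>N (Z/b)\<close>. \<open>N\<close> is in general not strictly convex, so many
  curves can share the minimal \<open>N\<close>-length, and knowing that length does not determine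
  the curve. This is the reason for passing to the Frobenius norm, whose unit ball is round: once
  velocities are known to be proportional to \<open>Z\<close> in both \<open>N\<close> and Frobenius
  norm, the sharp \<open>N\<close>-length becomes a sharp Frobenius length. A competitor may run
  through points where the logarithm is not smooth. The function that is compared with length must
  therefore be defined on the whole unitary group, and only a one-sided first-order estimate is
  available for it, hence Dini derivatives in place of derivatives.\<close>

section \<open>Complex matrices\<close>

abbreviation ct :: "complex^'n^'m \<Rightarrow> complex^'m^'n" where
  "ct \<equiv> conj_transpose"

definition dg :: "('n \<Rightarrow> complex) \<Rightarrow> complex^'n^'n" where
  "dg d = (\<chi> i j. if i = j then d i else 0)"

lemma ct_nth [simp]: "ct A $ i $ j = cnj (A $ j $ i)"
  by (simp add: conj_transpose_def transpose_def map_matrix_def)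

lemma dg_nth: "dg d $ i $ j = (if i = j then d i else 0)"
  by (simp add: dg_def)

lemma matrix_eqI: "(\<And>i j. A $ i $ j = B $ i $ j) \<Longrightarrow> A = (B :: 'a^'n^'m)"
  by (simp add: vec_eq_iff)

lemma matrix_mult_nth: "(A ** B) $ i $ j = (\<Sum>k\<in>UNIV. A $ i $ k * B $ k $ j)"
  by (simp add: matrix_matrix_mult_def)

lemma ct_ct [simp]: "ct (ct A) = A"
  by (rule matrix_eqI) simp

lemma ct_mult: "ct (A ** B) = ct B ** ct A"
  by (rule matrix_eqI) (simp add: matrix_mult_nth mult.commute)

lemma ct_mat1 [simp]: "ct (mat 1) = mat 1"
  by (rule matrix_eqI) (simp add: mat_def)

lemma ct_add: "ct (A + B) = ct A + ct B"
  by (rule matrix_eqI) simp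

lemma ct_scaleR: "ct (r *\<^sub>R A) = r *\<^sub>R ct A"
  by (rule matrix_eqI) simp

lemma ct_dg: "ct (dg d) = dg (\<lambda>i. cnj (d i))"
  by (rule matrix_eqI) (simp add: dg_nth)

lemma mat1_dg: "mat 1 = dg (\<lambda>i. 1)"
  by (rule matrix_eqI) (simp add: mat_def dg_nth)

lemma dg_mult_nth [simp]: "(dg d ** A) $ i $ j = d i * A $ i $ j"
  by (simp add: matrix_mult_nth dg_nth if_distrib [where f = "\<lambda>x. x * _"] cong: if_cong)

lemma mult_dg_nth [simp]: "(A ** dg d) $ i $ j = A $ i $ j * d j"
  by (simp add: matrix_mult_nth dg_nth if_distrib [where f = "\<lambda>x. _ * x"] cong: if_cong)

lemma dg_mult: "dg c ** dg d = dg (\<lambda>i. c i * d i)"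
  by (rule matrix_eqI) (simp add: dg_nth)

lemma matrix_mult_scaleR_left: "(r *\<^sub>R A) ** B = r *\<^sub>R (A ** (B :: complex^'n^'m))"
  by (rule matrix_eqI) (simp add: matrix_mult_nth scaleR_sum_right)

lemma matrix_mult_scaleR_right: "A ** (r *\<^sub>R B) = r *\<^sub>R (A ** (B :: complex^'n^'m))"
  by (rule matrix_eqI) (simp add: matrix_mult_nth scaleR_sum_right)

lemma matrix_mult_add_left: "(A + B) ** C = A ** C + B ** (C :: complex^'n^'m)"
  by (rule matrix_eqI) (simp add: matrix_mult_nth sum.distrib algebra_simps)

lemma matrix_mult_diff_left: "(A - B) ** C = A ** C - B ** (C :: complex^'n^'m)"
  by (rule matrix_eqI) (simp add: matrix_mult_nth sum_subtractf algebra_simps)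

lemma matrix_mult_diff_right: "A ** (B - C) = A ** B - A ** (C :: complex^'n^'m)"
  by (rule matrix_eqI) (simp add: matrix_mult_nth sum_subtractf algebra_simps)

lemma unitary_iff: "U \<in> unitary \<longleftrightarrow> ct U ** U = mat 1 \<and> U ** ct U = mat 1"
  by (simp add: unitary_def)

lemma unitary_mat1 [simp]: "mat 1 \<in> unitary"
  by (simp add: unitary_def)

lemma unitary_ct: "U \<in> unitary \<Longrightarrow> ct U \<in> unitary"
  by (simp add: unitary_def)

lemma unitary_ct_mult [simp]: "U \<in> unitary \<Longrightarrow> ct U ** U = mat 1"
  and unitary_mult_ct [simp]: "U \<in> unitary \<Longrightarrow> U ** ct U = mat 1"
  by (simp_all add: unitary_def)

lemma unitary_cancel [simp]:
  assumes "U \<in> unitary"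
  shows "ct U ** (U ** A) = A" "U ** (ct U ** A) = A"
  unfolding matrix_mul_assoc by (simp_all only: assms unitary_ct_mult unitary_mult_ct matrix_mul_lid)

lemma unitary_mult:
  assumes "U \<in> unitary" "V \<in> unitary" shows "U ** V \<in> unitary"
proof -
  have "ct (U ** V) ** (U ** V) = ct V ** (ct U ** (U ** V))"
    "(U ** V) ** ct (U ** V) = U ** (V ** (ct V ** ct U))"
    by (simp_all only: ct_mult matrix_mul_assoc)
  then show ?thesis using assms unfolding unitary_iff [of "U ** V"] by simp
qed

lemma unitary_dg: "dg (d :: 'n::finite \<Rightarrow> complex) \<in> unitary \<longleftrightarrow> (\<forall>i. cmod (d i) = 1)"
proof -
  have *: "cnj z * z = 1 \<longleftrightarrow> cmod z = 1" "z * cnj z = 1 \<longleftrightarrow> cmod z = 1" for z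
  proof -
    have "z * cnj z = of_real ((cmod z)\<^sup>2)" by (simp only: complex_norm_square)
    moreover have "of_real ((cmod z)\<^sup>2) = (1::complex) \<longleftrightarrow> (cmod z)\<^sup>2 = 1"
      by (metis of_real_1 of_real_eq_iff)
    moreover have "(cmod z)\<^sup>2 = 1 \<longleftrightarrow> cmod z = 1"
      by (smt (verit) norm_ge_zero power2_eq_1_iff)
    ultimately show "cnj z * z = 1 \<longleftrightarrow> cmod z = 1" "z * cnj z = 1 \<longleftrightarrow> cmod z = 1"
      by (simp_all add: mult.commute)
  qed
  have "dg c = mat 1 \<longleftrightarrow> (\<forall>i. c i = 1)" for c :: "'n \<Rightarrow> complex"
    by (auto simp: mat1_dg vec_eq_iff dg_nth)
  then show ?thesis
    unfolding unitary_iff by (simp only: ct_dg dg_mult *) simp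
qed

lemma inner_matrix: "A \<bullet> B = Re (trace (ct A ** (B :: complex^'n^'m)))"
  unfolding trace_def matrix_mult_nth inner_vec_def
  by (simp add: inner_complex_def) (rule sum.swap)

lemma inner_mult_left: "A \<bullet> (P ** B) = (ct P ** A) \<bullet> (B :: complex^'n^'m)"
  by (simp add: inner_matrix ct_mult matrix_mul_assoc)

lemma inner_mult_right: "A \<bullet> (B ** Q) = (A ** ct Q) \<bullet> (B :: complex^'n^'m)"
  unfolding inner_matrix ct_mult ct_ct by (metis matrix_mul_assoc trace_mul_sym)

lemma inner_ct: "ct A \<bullet> ct B = A \<bullet> (B :: complex^'n^'m)"
  by (simp add: inner_vec_def inner_complex_def) (rule sum.swap)

lemma norm_unitary_left [simp]: "P \<in> unitary \<Longrightarrow> norm (P ** A) = norm (A :: complex^'n^'m)"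
  by (simp add: norm_eq_sqrt_inner inner_mult_left)

lemma norm_unitary_right [simp]: "Q \<in> unitary \<Longrightarrow> norm (A ** Q) = norm (A :: complex^'n^'m)"
  by (simp add: norm_eq_sqrt_inner inner_mult_right flip: matrix_mul_assoc)

lemma norm_matrix_sq: "(norm (A :: complex^'n^'m))\<^sup>2 = (\<Sum>i\<in>UNIV. \<Sum>j\<in>UNIV. (cmod (A $ i $ j))\<^sup>2)"
  by (simp add: power2_norm_eq_inner inner_vec_def)

lemma bounded_linear_ct: "bounded_linear (ct :: complex^'n^'m \<Rightarrow> _)"
  by (rule linear_conv_bounded_linear [THEN iffD1]) (simp add: linear_iff ct_add ct_scaleR)

lemma bounded_bilinear_matrix_mult: "bounded_bilinear ((**) :: complex^'n^'m \<Rightarrow> complex^'k^'n \<Rightarrow> _)"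
  by (rule bilinear_conv_bounded_bilinear [THEN iffD1])
     (simp add: bilinear_def linear_iff matrix_add_ldistrib matrix_mult_add_left
        matrix_mult_scaleR_left matrix_mult_scaleR_right)

lemma unitary_row_sum:
  assumes "U \<in> unitary" shows "(\<Sum>k\<in>UNIV. (cmod (U $ j $ k))\<^sup>2) = 1"
proof -
  have "of_real (\<Sum>k\<in>UNIV. (cmod (U $ j $ k))\<^sup>2) = (U ** ct U) $ j $ j"
    by (simp only: matrix_mult_nth of_real_sum complex_norm_square ct_nth)
  also have "\<dots> = of_real 1" using assms by (simp add: mat_def)
  finally show ?thesis by (simp only: of_real_eq_iff)
qed

lemma unitary_col_sum:
  assumes "U \<in> unitary" shows "(\<Sum>k\<in>UNIV. (cmod (U $ k $ j))\<^sup>2) = 1"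
  using unitary_row_sum [OF unitary_ct [OF assms], of j] by simp

text \<open>The quadratic form of \<open>H\<close> attains its maximum on the compact unit sphere of
  \<open>S\<close>, and the first variation at a maximizer in the direction of the residue
  \<open>H x - m x\<close> can vanish only if the residue does.\<close>

lemma selfadjoint_eigenvector_in_subspace:
  fixes H :: "'a::euclidean_space \<Rightarrow> 'a"
  assumes "linear H" and adj: "\<And>x y. H x \<bullet> y = x \<bullet> H y"
    and S: "subspace S" and inv: "\<And>x. x \<in> S \<Longrightarrow> H x \<in> S" and ne: "\<exists>x\<in>S. x \<noteq> 0"
  shows "\<exists>x\<in>S. \<exists>m. norm x = 1 \<and> H x = m *\<^sub>R x"
proof -
  interpret H: linear H by fact
  have "compact (S \<inter> sphere 0 1)"
    by (intro closed_Int_compact closed_subspace S compact_sphere)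
  moreover have "S \<inter> sphere 0 1 \<noteq> {}"
  proof -
    from ne obtain x where "x \<in> S" "x \<noteq> 0" by blast
    then have "(1 / norm x) *\<^sub>R x \<in> S \<inter> sphere 0 1" using S by (simp add: subspace_scale)
    then show ?thesis by blast
  qed
  moreover have "continuous_on (S \<inter> sphere 0 1) (\<lambda>x. x \<bullet> H x)"
    by (intro continuous_intros linear_continuous_on linear_conv_bounded_linear[THEN iffD1] assms(1))
  ultimately obtain x where "x \<in> S \<inter> sphere 0 1"
    and "\<forall>y \<in> S \<inter> sphere 0 1. y \<bullet> H y \<le> x \<bullet> H x"
    using continuous_attains_sup by blast
  then have x: "x \<in> S" "norm x = 1"
    and max: "\<And>y. y \<in> S \<Longrightarrow> norm y = 1 \<Longrightarrow> y \<bullet> H y \<le> x \<bullet> H x"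
    by auto
  define m where "m = x \<bullet> H x"
  have le: "y \<bullet> H y \<le> m * (y \<bullet> y)" if "y \<in> S" for y
  proof (cases "y = 0")
    case False
    have "((1 / norm y) *\<^sub>R y) \<bullet> H ((1 / norm y) *\<^sub>R y) \<le> m"
      unfolding m_def using False that S by (intro max) (auto simp: subspace_scale)
    then show ?thesis using False
      by (simp add: H.scale field_simps power2_norm_eq_inner [symmetric] power2_eq_square)
  qed (simp add: H.zero)
  define y where "y = H x - m *\<^sub>R x"
  have y: "y \<in> S" unfolding y_def using x S inv by (simp add: subspace_diff subspace_scale)
  define c where "c = y \<bullet> H y - m * (y \<bullet> y)"
  have q: "2 * t * (y \<bullet> y) + t\<^sup>2 * c \<le> 0" for t
  proof -
    have "(x + t *\<^sub>R y) \<bullet> H (x + t *\<^sub>R y) \<le> m * ((x + t *\<^sub>R y) \<bullet> (x + t *\<^sub>R y))"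
      using x y S by (intro le) (simp add: subspace_add subspace_scale)
    then have "m + 2 * t * (y \<bullet> H x) + t\<^sup>2 * (y \<bullet> H y) \<le> m * (1 + 2 * t * (y \<bullet> x) + t\<^sup>2 * (y \<bullet> y))"
      using x(2) adj[of x y]
      by (simp add: H.add H.scale inner_add_left inner_add_right algebra_simps power2_eq_square
          m_def[symmetric] inner_commute norm_eq_1)
    moreover have "y \<bullet> H x = y \<bullet> y + m * (y \<bullet> x)"
      by (simp add: y_def inner_diff_left inner_diff_right algebra_simps inner_commute)
    ultimately show ?thesis by (simp add: c_def algebra_simps)
  qed
  have "y = 0"
  proof (rule ccontr)
    assume "y \<noteq> 0"
    then have p: "y \<bullet> y > 0" by simp
    \<comment> \<open>Small enough for the quadratic term \<open>t^2 c\<close> to be outweighed by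
      the linear term.\<close>
    define t where "t = (y \<bullet> y) / (\<bar>c\<bar> + 1)"
    have t: "t > 0" unfolding t_def using p by simp
    have "t * \<bar>c\<bar> \<le> y \<bullet> y" unfolding t_def using p by (simp add: field_simps)
    then have "t * (t * \<bar>c\<bar>) \<le> t * (y \<bullet> y)" using t by (intro mult_left_mono) auto
    moreover have "- (t * (t * \<bar>c\<bar>)) \<le> t\<^sup>2 * c"
    proof -
      have "t * (t * (- \<bar>c\<bar>)) \<le> t * (t * c)"
        using t by (intro mult_left_mono) auto
      then show ?thesis by (simp add: power2_eq_square mult.assoc)
    qed
    moreover have "t * (y \<bullet> y) > 0" using t p by simp
    ultimately show False using q[of t] by linarith
  qed
  then show ?thesis using x by (auto simp: y_def)
qed

section \<open>Diagonalization of normal matrices\<close>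

lemma inner_matrix_vector: "(A *v x) \<bullet> y = x \<bullet> (ct A *v (y :: complex^'n))"
proof -
  have "(A *v x) \<bullet> y = (\<Sum>i\<in>UNIV. \<Sum>j\<in>UNIV. (A $ i $ j * x $ j) \<bullet> y $ i)"
    by (simp add: inner_vec_def matrix_vector_mult_def inner_sum_left)
  also have "\<dots> = (\<Sum>i\<in>UNIV. \<Sum>j\<in>UNIV. x $ j \<bullet> (cnj (A $ i $ j) * y $ i))"
    by (intro sum.cong refl) (simp add: inner_complex_def algebra_simps)
  also have "\<dots> = x \<bullet> (ct A *v y)"
    by (subst sum.swap) (simp add: inner_vec_def matrix_vector_mult_def inner_sum_right)
  finally show ?thesis .
qed

lemma linear_matrix_vector: "linear (\<lambda>x. (A :: complex^'n^'m) *v x)"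
  by simp

text \<open>An eigenvector of \<open>i(A* - A)\<close> inside an eigenspace of \<open>A + A*\<close> is a joint eigenvector
  of \<open>A\<close> and \<open>A*\<close>.\<close>

lemma normal_eigenvector_in_subspace:
  fixes A :: "complex^'n^'n"
  assumes normal: "A ** ct A = ct A ** A"
    and S: "subspace S" and ne: "\<exists>x\<in>S. x \<noteq> 0"
    and sc: "\<And>x c. x \<in> S \<Longrightarrow> c *s x \<in> S"
    and inv: "\<And>x. x \<in> S \<Longrightarrow> A *v x \<in> S" and inv': "\<And>x. x \<in> S \<Longrightarrow> ct A *v x \<in> S"
  shows "\<exists>x\<in>S. \<exists>d. norm x = 1 \<and> A *v x = d *s x \<and> ct A *v x = cnj d *s x"
proof -
  define H where "H = A + ct A"
  \<comment> \<open>Real scaling does not provide multiplication by i, hence the scalar diagonal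
    matrix.\<close>
  define K where "K = dg (\<lambda>_. \<i>) ** (ct A - A)"
  have ctH: "ct H = H" unfolding H_def by (rule matrix_eqI) simp
  have ctK: "ct K = K" unfolding K_def by (rule matrix_eqI) (simp add: algebra_simps)
  have dgi: "dg (\<lambda>_. \<i>) ** B = B ** dg (\<lambda>_. \<i>)" for B :: "complex^'n^'n"
    by (rule matrix_eqI) simp
  have "(A + ct A) ** (ct A - A) = (ct A - A) ** (A + ct A)"
    using normal
    by (simp add: matrix_mult_add_left matrix_mult_diff_left matrix_add_ldistrib matrix_mult_diff_right)
  then have HK: "H ** K = K ** H"
    unfolding H_def K_def by (metis dgi matrix_mul_assoc)
  have Kv: "K *v x = \<i> *s (ct A *v x - A *v x)" for x
    by (simp add: K_def vec_eq_iff matrix_vector_mult_def sum_subtractf sum_distrib_left algebra_simps)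
  have Hv: "H *v x = A *v x + ct A *v x" for x
    by (simp add: H_def matrix_vector_mult_add_rdistrib)
  have "\<exists>x\<in>S. \<exists>m. norm x = 1 \<and> H *v x = m *\<^sub>R x"
  proof (rule selfadjoint_eigenvector_in_subspace [OF linear_matrix_vector _ S _ ne])
    show "H *v x \<in> S" if "x \<in> S" for x
      using that S inv inv' by (simp add: Hv subspace_add)
  qed (simp add: inner_matrix_vector ctH)
  then obtain x0 a where x0: "x0 \<in> S" "norm x0 = 1" "H *v x0 = a *\<^sub>R x0" by blast
  define E where "E = {x\<in>S. H *v x = a *\<^sub>R x}"
  have E: "subspace E"
    using S unfolding E_def subspace_def
    by (auto simp: matrix_vector_right_distrib scaleR_add_right
        linear_scale [OF linear_matrix_vector])
  have KE: "K *v x \<in> E" if "x \<in> E" for x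
  proof -
    have "H *v (K *v x) = K *v (H *v x)"
      by (simp add: matrix_vector_mul_assoc HK)
    then have "H *v (K *v x) = a *\<^sub>R (K *v x)"
      using that by (simp add: E_def linear_scale [OF linear_matrix_vector])
    moreover have "K *v x \<in> S"
      using that S sc inv inv' by (simp add: E_def Kv subspace_diff)
    ultimately show ?thesis by (simp add: E_def)
  qed
  have "\<exists>x\<in>E. \<exists>m. norm x = 1 \<and> K *v x = m *\<^sub>R x"
  proof (intro selfadjoint_eigenvector_in_subspace E)
    show "\<exists>x\<in>E. x \<noteq> 0" using x0 by (auto simp: E_def)
  qed (auto simp: inner_matrix_vector ctK KE)
  then obtain x m where x: "x \<in> E" "norm x = 1" "K *v x = m *\<^sub>R x" by blast
  have sum: "A *v x + ct A *v x = a *\<^sub>R x" using x(1) Hv[of x] by (simp add: E_def)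
  have diff: "\<i> *s (ct A *v x - A *v x) = m *\<^sub>R x" using x(3) Kv[of x] by simp
  \<comment> \<open>From \<open>A = (H + i K) / 2\<close>.\<close>
  define d where "d = Complex (a / 2) (m / 2)"
  have 1: "(A *v x) $ i = d * x $ i \<and> (ct A *v x) $ i = cnj d * x $ i" for i
  proof -
    let ?p = "(A *v x) $ i" and ?q = "(ct A *v x) $ i"
    have "?p + ?q = of_real a * x $ i"
      using arg_cong [OF sum, of "\<lambda>v. v $ i"] by (simp add: scaleR_conv_of_real [where 'a = complex])
    moreover have iqp: "\<i> * (?q - ?p) = of_real m * x $ i"
      using arg_cong [OF diff, of "\<lambda>v. v $ i"]
      by (simp add: scaleR_conv_of_real [where 'a = complex] algebra_simps)
    then have "?p - ?q = \<i> * of_real m * x $ i"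
      by (metis (no_types, lifting) iqp minus_diff_eq mult.assoc mult_minus1 i_squared
          power2_eq_square)
    moreover have "?p = ((?p + ?q) + (?p - ?q)) / 2" "?q = ((?p + ?q) - (?p - ?q)) / 2" by simp_all
    moreover have "d = (of_real a + \<i> * of_real m) / 2" "cnj d = (of_real a - \<i> * of_real m) / 2"
      by (simp_all add: d_def complex_eq_iff)
    ultimately show ?thesis by (simp only: distrib_right left_diff_distrib times_divide_eq_left)
  qed
  then have "A *v x = d *s x" "ct A *v x = cnj d *s x" by (simp_all add: vec_eq_iff)
  then show ?thesis using x by (auto simp: E_def)
qed

text \<open>Vanishing of the complex pairing with \<open>q i\<close> amounts to real orthogonality
  to \<open>q i\<close> and to its product with the imaginary unit. That is at most
  \<open>2 * card J\<close> real conditions in a space of real dimension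
  \<open>2 * CARD('n)\<close>.\<close>

lemma exists_orthogonal_vector:
  fixes q :: "'n::finite \<Rightarrow> complex^'n"
  assumes "J \<noteq> UNIV"
  shows "\<exists>x. x \<noteq> 0 \<and> (\<forall>i\<in>J. (\<Sum>k\<in>UNIV. cnj (q i $ k) * x $ k) = 0)"
proof -
  let ?T = "q ` J \<union> (\<lambda>i. \<i> *s q i) ` J"
  have "card ?T \<le> card J + card J"
    by (rule order_trans [OF card_Un_le]) (intro add_mono card_image_le finite)
  moreover have "card J < CARD('n)"
    using assms by (intro psubset_card_mono) auto
  ultimately have "dim ?T < DIM(complex^'n)"
    using dim_le_card'[of ?T] by simp
  then obtain x where x: "x \<noteq> 0" "\<And>y. y \<in> span ?T \<Longrightarrow> orthogonal x y"
    using orthogonal_to_subspace_exists by blast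
  have "(\<Sum>k\<in>UNIV. cnj (q i $ k) * x $ k) = 0" if "i \<in> J" for i
  proof -
    have "x \<bullet> q i = 0" "x \<bullet> (\<i> *s q i) = 0"
      using x(2)[of "q i"] x(2)[of "\<i> *s q i"] that
      by (auto simp: orthogonal_def intro: span_base)
    then show ?thesis
      by (simp add: complex_eq_iff inner_vec_def inner_complex_def algebra_simps
          sum.distrib sum_subtractf sum_negf)
  qed
  then show ?thesis using x(1) by blast
qed

text \<open>Joint eigenvectors of \<open>A\<close> and its adjoint are collected one index at a
  time. Carrying the adjoint along keeps the orthogonal complement of those already found invariant
  under both matrices.\<close>

theorem normal_diagonalization:
  fixes A :: "complex^'n^'n"
  assumes normal: "A ** ct A = ct A ** A"
  obtains Q d where "Q \<in> unitary" "A = Q ** dg d ** ct Q"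
proof -
  let ?c = "\<lambda>x y :: complex^'n. \<Sum>k\<in>UNIV. cnj (x $ k) * y $ k"
  have adj: "?c x (B *v y) = ?c (ct B *v x) y" for x y and B :: "complex^'n^'n"
  proof -
    have "?c x (B *v y) = (\<Sum>k\<in>UNIV. \<Sum>l\<in>UNIV. cnj (x $ k) * (B $ k $ l * y $ l))"
      by (simp add: matrix_vector_mult_def sum_distrib_left)
    also have "\<dots> = ?c (ct B *v x) y"
      by (subst sum.swap) (simp add: matrix_vector_mult_def sum_distrib_left sum_distrib_right mult_ac)
    finally show ?thesis .
  qed
  have "\<exists>q d. (\<forall>i\<in>J. \<forall>k\<in>J. ?c (q i) (q k) = (if i = k then 1 else 0)) \<and>
     (\<forall>i\<in>J. A *v q i = d i *s q i \<and> ct A *v q i = cnj (d i) *s q i)" if "finite J" for J :: "'n set"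
    using that
  proof (induction J rule: finite_induct)
    case (insert j J)
    then obtain q d where on: "\<And>i k. i \<in> J \<Longrightarrow> k \<in> J \<Longrightarrow> ?c (q i) (q k) = (if i = k then 1 else 0)"
      and ev: "\<And>i. i \<in> J \<Longrightarrow> A *v q i = d i *s q i" "\<And>i. i \<in> J \<Longrightarrow> ct A *v q i = cnj (d i) *s q i"
      by blast
    define S where "S = {x. \<forall>i\<in>J. ?c (q i) x = 0}"
    have cscale: "?c (a *s x) y = cnj a * ?c x y" for a x y
      by (simp add: sum_distrib_left mult_ac)
    have "\<exists>x\<in>S. \<exists>d. norm x = 1 \<and> A *v x = d *s x \<and> ct A *v x = cnj d *s x"
    proof (rule normal_eigenvector_in_subspace [OF normal])
      show "subspace S"
        by (auto simp: subspace_def S_def algebra_simps sum.distrib scaleR_conv_of_real [where 'a = complex]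
            simp flip: sum_distrib_left)
      show "\<exists>x\<in>S. x \<noteq> 0"
        using exists_orthogonal_vector [of J q] insert.hyps unfolding S_def by blast
      show "c *s x \<in> S" if "x \<in> S" for x c
      proof -
        have "?c (q i) (c *s x) = c * ?c (q i) x" for i by (simp add: sum_distrib_left mult_ac)
        then show ?thesis using that by (simp add: S_def)
      qed
      show "A *v x \<in> S" "ct A *v x \<in> S" if "x \<in> S" for x
        using that by (auto simp: S_def adj ev cscale simp del: vector_smult_component)
    qed
    then obtain x e where x: "x \<in> S" "norm x = 1" "A *v x = e *s x" "ct A *v x = cnj e *s x" by blast
    have "?c x x = of_real (x \<bullet> x)"
      by (simp only: inner_vec_def of_real_sum complex_norm_square mult.commute
          flip: power2_norm_eq_inner)
    then have xx: "?c x x = 1" using x(2) by (simp add: norm_eq_1)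
    have xq: "?c (q i) x = 0" "?c x (q i) = 0" if "i \<in> J" for i
    proof -
      show 0: "?c (q i) x = 0" using x(1) that by (simp add: S_def)
      have "?c x (q i) = cnj (?c (q i) x)" by (simp add: mult.commute)
      then show "?c x (q i) = 0" using 0 by simp
    qed
    show ?case
      by (rule exI [of _ "q(j := x)"], rule exI [of _ "d(j := e)"])
         (use on ev x(3,4) xx xq insert.hyps(2) in \<open>auto\<close>)
  qed auto
  from this [OF finite, of UNIV] obtain q :: "'n \<Rightarrow> complex^'n" and d :: "'n \<Rightarrow> complex" where
    *: "\<forall>i\<in>UNIV. \<forall>k\<in>UNIV. ?c (q i) (q k) = (if i = k then 1 else 0)"
      "\<forall>i\<in>UNIV. A *v q i = d i *s q i \<and> ct A *v q i = cnj (d i) *s q i"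
    by (elim exE conjE)
  have on: "?c (q i) (q k) = (if i = k then 1 else 0)" and ev: "A *v q i = d i *s q i" for i k
    using * by simp_all
  define Q :: "complex^'n^'n" where "Q = (\<chi> r k. q k $ r)"
  have "ct Q ** Q = mat 1"
    by (rule matrix_eqI) (simp add: matrix_mult_nth Q_def on mat_def)
  then have Q: "Q \<in> unitary"
    unfolding unitary_iff using matrix_left_right_inverse by blast
  have "A ** Q = Q ** dg d"
  proof (rule matrix_eqI)
    fix i j
    show "(A ** Q) $ i $ j = (Q ** dg d) $ i $ j"
      using arg_cong [OF ev[of j], of "\<lambda>v. v $ i"]
      unfolding mult_dg_nth by (simp add: matrix_mult_nth matrix_vector_mult_def Q_def mult.commute)
  qed
  then have "Q ** dg d ** ct Q = A ** (Q ** ct Q)"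
    by (simp only: matrix_mul_assoc)
  then have "A = Q ** dg d ** ct Q" using Q by simp
  then show thesis using that Q by blast
qed


lemma unitary_conj_inverse:
  assumes "Q \<in> unitary" "A = Q ** B ** ct Q" shows "ct Q ** A ** Q = B"
proof -
  have "ct Q ** A ** Q = (ct Q ** Q) ** B ** (ct Q ** Q)"
    unfolding assms(2) by (simp only: matrix_mul_assoc)
  then show ?thesis using assms(1) by simp
qed

lemma hermitian_iff: "A \<in> hermitian \<longleftrightarrow> ct A = A"
  by (simp add: hermitian_def)

lemma hermitian_conj: "A \<in> hermitian \<Longrightarrow> Q ** A ** ct Q \<in> hermitian"
  by (simp add: hermitian_iff ct_mult matrix_mul_assoc)

lemma hermitian_dg_real: "dg (\<lambda>i. of_real (x i)) \<in> hermitian"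
  by (simp add: hermitian_iff ct_dg)

lemma hermitian_diagonalization:
  fixes A :: "complex^'n^'n"
  assumes "A \<in> hermitian"
  obtains Q x where "Q \<in> unitary" "A = Q ** dg (\<lambda>i. of_real (x i)) ** ct Q"
proof -
  have A: "ct A = A" using assms by (simp add: hermitian_iff)
  then obtain Q d where Q: "Q \<in> unitary" "A = Q ** dg d ** ct Q"
    using normal_diagonalization [of A] by auto
  have "ct (dg d) = dg d"
    using unitary_conj_inverse [OF Q] A by (metis ct_ct ct_mult matrix_mul_assoc)
  then have "cnj (d i) = d i" for i
    by (metis ct_nth dg_nth)
  then have "of_real (Re (d i)) = d i" for i
    by (simp add: complex_eq_iff)
  then have "dg (\<lambda>i. of_real (Re (d i))) = dg d" by simp
  then show thesis using that [of Q "\<lambda>i. Re (d i)"] Q by simp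
qed

lemma unitary_diagonalization:
  fixes G :: "complex^'n^'n"
  assumes "G \<in> unitary"
  obtains Q x where "Q \<in> unitary" "G = Q ** dg (\<lambda>i. cis (x i)) ** ct Q" "\<And>i. \<bar>x i\<bar> \<le> pi"
proof -
  obtain Q d where Q: "Q \<in> unitary" "G = Q ** dg d ** ct Q"
    using normal_diagonalization [of G] assms by auto
  have "dg d \<in> unitary"
    using unitary_conj_inverse [OF Q] assms Q(1) by (metis unitary_ct unitary_mult)
  then have d: "cmod (d i) = 1" for i by (simp add: unitary_dg)
  have "cis (Arg (d i)) = d i" for i
    using d [of i] cis_Arg [of "d i"] by (cases "d i = 0") (auto simp: sgn_eq)
  then have "dg (\<lambda>i. cis (Arg (d i))) = dg d" by simp
  moreover have "\<bar>Arg (d i)\<bar> \<le> pi" for i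
    using Arg_bounded [of "d i"] by auto
  ultimately show thesis using that [of Q "\<lambda>i. Arg (d i)"] Q by simp
qed

lemma conj_dg_nth:
  "(Q ** dg d ** ct Q) $ r $ s = (\<Sum>j\<in>UNIV. Q $ r $ j * d j * cnj (Q $ s $ j))"
  by (simp add: matrix_mult_nth [of "Q ** dg d"])

lemma conj_dg_mult:
  assumes "Q \<in> unitary"
  shows "(Q ** dg c ** ct Q) ** (Q ** dg d ** ct Q) = Q ** dg (\<lambda>i. c i * d i) ** ct Q"
proof -
  have "(Q ** dg c ** ct Q) ** (Q ** dg d ** ct Q) = Q ** (dg c ** ((ct Q ** Q) ** dg d)) ** ct Q"
    by (simp only: matrix_mul_assoc)
  then show ?thesis using assms by (simp add: dg_mult)
qed

lemma conj_mat1: "Q \<in> unitary \<Longrightarrow> Q ** dg (\<lambda>i. 1) ** ct Q = mat 1"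
  by (simp flip: mat1_dg)

lemma vec_sumsI:
  fixes f :: "nat \<Rightarrow> ('a::real_normed_vector)^'n"
  assumes "\<And>i. (\<lambda>k. f k $ i) sums (s $ i)"
  shows "f sums s"
  using assms unfolding sums_def by (intro vec_tendstoI) (simp add: sum_component)

text \<open>Conjugation by \<open>Q\<close> is multiplicative and can be pulled out of every power;
  each entry of the series is then a finite combination of scalar exponential series.\<close>

lemma mat_exp_conj_dg:
  assumes Q: "Q \<in> unitary"
  shows "mat_exp (Q ** dg d ** ct Q) = Q ** dg (\<lambda>i. exp (d i)) ** ct Q"
proof -
  have pow: "((**) (Q ** dg d ** ct Q) ^^ k) (mat 1) = Q ** dg (\<lambda>i. d i ^ k) ** ct Q" for k
  proof (induction k)
    case 0
    then show ?case using Q by (simp add: conj_mat1)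
  next
    case (Suc k)
    then show ?case using Q by (simp add: conj_dg_mult)
  qed
  have "(\<lambda>k. (1 / fact k) *\<^sub>R (Q ** dg (\<lambda>i. d i ^ k) ** ct Q)) sums
      (Q ** dg (\<lambda>i. exp (d i)) ** ct Q)"
  proof (intro vec_sumsI)
    fix r s
    have "(\<lambda>k. \<Sum>j\<in>UNIV. Q $ r $ j * (d j ^ k /\<^sub>R fact k) * cnj (Q $ s $ j)) sums
        (\<Sum>j\<in>UNIV. Q $ r $ j * exp (d j) * cnj (Q $ s $ j))"
      by (intro sums_sum sums_mult sums_mult2 exp_converges)
    then show "(\<lambda>k. ((1 / fact k) *\<^sub>R (Q ** dg (\<lambda>i. d i ^ k) ** ct Q)) $ r $ s) sums
        ((Q ** dg (\<lambda>i. exp (d i)) ** ct Q) $ r $ s)"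
      by (simp add: conj_dg_nth scaleR_sum_right inverse_eq_divide)
  qed
  then show ?thesis unfolding mat_exp_def pow by (simp add: sums_iff)
qed

text \<open>The operator norm is tested on column \<open>j\<close> of \<open>Q\<close>, a unit
  eigenvector.\<close>

lemma spectral_norm_ge_eigenvalue:
  assumes Q: "Q \<in> unitary" and A: "A = Q ** dg d ** ct Q"
  shows "cmod (d j) \<le> spectral_norm A"
proof -
  have AQ: "A ** Q = Q ** dg d"
    unfolding A using Q by (simp flip: matrix_mul_assoc)
  let ?q = "column j Q"
  have "A *v ?q = d j *s ?q"
  proof (rule vec_eq_iff [THEN iffD2], rule allI)
    fix i
    have "(A *v ?q) $ i = (A ** Q) $ i $ j"
      by (simp add: matrix_mult_nth matrix_vector_mult_def column_def)
    then show "(A *v ?q) $ i = (d j *s ?q) $ i"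
      by (simp add: AQ column_def mult.commute)
  qed
  then have "norm (A *v ?q) = cmod (d j) * norm ?q"
    by (simp add: norm_vec_def L2_set_def norm_mult power_mult_distrib real_sqrt_mult
        flip: sum_distrib_left)
  moreover have "norm ?q = 1"
    using unitary_col_sum [OF Q, of j] by (simp add: norm_vec_def L2_set_def column_def)
  moreover have "norm (A *v ?q) \<le> spectral_norm A * norm ?q"
    unfolding spectral_norm_def
    by (intro onorm linear_conv_bounded_linear [THEN iffD1] linear_matrix_vector)
  ultimately show ?thesis by simp
qed

section \<open>Unitarily invariant seminorms\<close>

lemma cmod_cis_diff_sq: "(cmod (cis x - cis y))\<^sup>2 = 2 - 2 * cos (x - y)"
proof -
  have "(cmod (cis x - cis y))\<^sup>2 = (cos x - cos y)\<^sup>2 + (sin x - sin y)\<^sup>2"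
    by (simp add: cmod_power2)
  then show ?thesis
    using sin_cos_squared_add [of x] sin_cos_squared_add [of y]
    unfolding power2_diff cos_diff distrib_left mult.assoc by linarith
qed

text \<open>The slope 1/2 is \<open>cos (pi/3)\<close>: up to \<open>pi/3\<close> the sine grows at
  least that fast, and from there on it stays above \<open>sqrt 3 / 2\<close>, which exceeds
  \<open>pi/4\<close>.\<close>

lemma sin_ge_half:
  assumes "0 \<le> y" "y \<le> pi / 2" shows "y / 2 \<le> sin y"
proof (cases "y \<le> pi / 3")
  case True
  have "sin 0 - 0 / 2 \<le> sin y - y / 2"
  proof (rule DERIV_nonneg_imp_nondecreasing [OF assms(1)])
    fix x assume x: "0 \<le> x" "x \<le> y"
    have "cos (pi / 3) \<le> cos x" using x True by (intro cos_monotone_0_pi_le) auto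
    then have "0 \<le> cos x - 1 / 2" by (simp add: cos_60)
    moreover have "((\<lambda>y. sin y - y / 2) has_real_derivative cos x - 1 / 2) (at x)"
      by (auto intro!: derivative_eq_intros)
    ultimately show "\<exists>d. ((\<lambda>y. sin y - y / 2) has_real_derivative d) (at x) \<and> 0 \<le> d" by blast
  qed
  then show ?thesis by simp
next
  case False
  have "y / 2 \<le> pi / 4" using assms by simp
  also have "\<dots> \<le> sqrt 3 / 2"
  proof -
    have "pi / 2 \<le> 8 / 5" using pi_less_4 pi_approx(2) by simp
    also have "\<dots> \<le> sqrt 3" by (rule real_le_rsqrt) (simp add: power2_eq_square)
    finally show ?thesis by simp
  qed
  also have "\<dots> = sin (pi / 3)" by (simp add: sin_60)
  also have "\<dots> \<le> sin y" using False assms by (intro sin_monotone_2pi_le) auto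
  finally show ?thesis .
qed

text \<open>The distance \<open>d\<close> is one of the two arcs between the points. If it is the
  longer one, \<open>2 pi - d\<close> still bounds the difference of the moduli, since neither
  exceeds \<open>pi\<close>; so the modulus of the angle, unlike the signed angle, is Lipschitz
  across -1. The factor 4 is the square of 2, a bound for the ratio of the shorter arc to the
  chord.\<close>

lemma abs_angle_lipschitz:
  assumes "\<bar>x\<bar> \<le> pi" "\<bar>y\<bar> \<le> pi"
  shows "(\<bar>x\<bar> - \<bar>y\<bar>)\<^sup>2 \<le> 4 * (cmod (cis x - cis y))\<^sup>2"
proof -
  define d where "d = \<bar>x - y\<bar>"
  have d: "0 \<le> d" "d \<le> 2 * pi" unfolding d_def using assms by linarith+
  have "\<bar>\<bar>x\<bar> - \<bar>y\<bar>\<bar> \<le> 4 * \<bar>sin (d / 2)\<bar>"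
  proof (cases "d \<le> pi")
    case True
    have "\<bar>\<bar>x\<bar> - \<bar>y\<bar>\<bar> \<le> d" unfolding d_def by linarith
    then show ?thesis using sin_ge_half [of "d / 2"] d True by linarith
  next
    case False
    then have "\<bar>\<bar>x\<bar> - \<bar>y\<bar>\<bar> \<le> 2 * pi - d" unfolding d_def using assms by linarith
    moreover have "sin (pi - d / 2) = sin (d / 2)" by (rule sin_pi_minus)
    ultimately show ?thesis using sin_ge_half [of "pi - d / 2"] d False by simp
  qed
  then have "(\<bar>x\<bar> - \<bar>y\<bar>)\<^sup>2 \<le> (4 * \<bar>sin (d / 2)\<bar>)\<^sup>2"
    by (metis abs_ge_zero abs_le_square_iff abs_mult abs_numeral abs_abs)
  also have "\<dots> = 8 * (1 - cos d)"
    using cos_double_sin [of "d / 2"] by (simp add: power_mult_distrib)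
  also have "cos d = cos (x - y)" by (simp add: d_def abs_if) (metis cos_minus minus_diff_eq)
  finally show ?thesis by (simp add: cmod_cis_diff_sq)
qed

text \<open>The difference of the two sides has derivative \<open>sin + cos - 1\<close>, and on the
  first quadrant sine and cosine dominate their squares.\<close>

lemma diff_sin_le_one_minus_cos:
  assumes "0 \<le> x" "x \<le> pi / 2" shows "x - sin x \<le> 1 - cos x"
proof -
  have "(1 - cos 0) - (0 - sin 0) \<le> (1 - cos x) - (x - sin x)"
  proof (rule DERIV_nonneg_imp_nondecreasing [OF assms(1)])
    fix t assume t: "0 \<le> t" "t \<le> x"
    then have "0 \<le> sin t" "0 \<le> cos t" using assms by (auto intro: sin_ge_zero cos_ge_zero)
    then have "(sin t)\<^sup>2 \<le> sin t" "(cos t)\<^sup>2 \<le> cos t"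
      by (simp_all add: power2_eq_square mult_left_le)
    then have "0 \<le> sin t - (1 - cos t)" using sin_cos_squared_add [of t] by linarith
    moreover have "((\<lambda>x. (1 - cos x) - (x - sin x)) has_real_derivative sin t - (1 - cos t)) (at t)"
      by (auto intro!: derivative_eq_intros)
    ultimately show "\<exists>d. ((\<lambda>x. (1 - cos x) - (x - sin x)) has_real_derivative d) (at t) \<and> 0 \<le> d"
      by blast
  qed
  then show ?thesis by simp
qed

text \<open>Near 0 the left side is cubic and \<open>1 - cos x\<close> quadratic; elsewhere
  \<open>1 - cos x\<close> is bounded below as long as \<open>x\<close> stays away from its next
  zero \<open>2 pi\<close>.\<close>

lemma diff_sin_bound:
  assumes "c < 2 * pi"
  shows "\<exists>C\<ge>0. \<forall>x. 0 \<le> x \<and> x \<le> c \<longrightarrow> x - sin x \<le> C * (1 - cos x)"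
proof -
  \<comment> \<open>A distance to \<open>2 pi\<close>, kept at most \<open>pi\<close> so that cosine
    is monotone on \<open>[0, e]\<close>; \<open>k\<close> will bound \<open>1 - cos\<close> below
    on \<open>[pi/2, c]\<close>.\<close>
  define e where "e = 2 * pi - max c pi"
  have e: "0 < e" "e \<le> pi" unfolding e_def using assms by auto
  define k where "k = min 1 (1 - cos e)"
  have "cos e < cos 0" using e by (intro cos_monotone_0_pi) auto
  then have k: "0 < k" by (simp add: k_def)
  define C where "C = 1 + (2 * pi + 1) / k"
  have "x - sin x \<le> C * (1 - cos x)" if x: "0 \<le> x" "x \<le> c" for x
  proof (cases "x \<le> pi / 2")
    case True
    then have "x - sin x \<le> 1 * (1 - cos x)" using diff_sin_le_one_minus_cos x by simp
    also have "\<dots> \<le> C * (1 - cos x)" unfolding C_def using k pi_gt_zero by (intro mult_right_mono) auto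
    finally show ?thesis .
  next
    case False
    have "k \<le> 1 - cos x"
    proof (cases "x \<le> pi")
      case True
      have "cos x \<le> cos (pi / 2)" using True False by (intro cos_monotone_0_pi_le) auto
      then show ?thesis by (simp add: k_def)
    next
      case False
      have "cos x = cos (2 * pi - x)" by simp
      also have "\<dots> \<le> cos e" using False x assms e unfolding e_def by (intro cos_monotone_0_pi_le) auto
      finally show ?thesis by (simp add: k_def)
    qed
    then have "1 \<le> (1 - cos x) / k" using k by simp
    then have "(2 * pi + 1) * 1 \<le> (2 * pi + 1) * ((1 - cos x) / k)"
      using pi_gt_zero by (intro mult_left_mono) auto
    also have "\<dots> \<le> C * (1 - cos x)" by (simp add: C_def distrib_right)
    finally have "2 * pi + 1 \<le> C * (1 - cos x)" by simp
    moreover have "x - sin x \<le> 2 * pi + 1" using x assms sin_ge_minus_one [of x] by linarith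
    ultimately show ?thesis by linarith
  qed
  moreover have "0 \<le> C" using k pi_gt_zero by (simp add: C_def)
  ultimately show ?thesis by blast
qed

text \<open>\<open>\<bar>x\<bar> = pi\<close> is treated separately because \<open>\<bar>x\<bar>\<close>, as a function on the circle, has a kink
  there.\<close>


lemma abs_angle_first_order:
  assumes "\<bar>x\<bar> \<le> pi"
  shows "\<exists>C\<ge>0. \<forall>y. \<bar>y\<bar> \<le> pi \<longrightarrow>
    \<bar>y\<bar> \<le> \<bar>x\<bar> - (if 0 \<le> y then 1 else -1) * sin (x - y) + C * (1 - cos (x - y))"
proof -
  \<comment> \<open>Nonnegative \<open>y\<close> only; negative \<open>y\<close> are reached by
    reflecting both angles.\<close>
  have *: "\<exists>C\<ge>0. \<forall>y. 0 \<le> y \<and> y \<le> pi \<longrightarrow> y \<le> \<bar>x\<bar> - sin (x - y) + C * (1 - cos (x - y))"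
    if "\<bar>x\<bar> \<le> pi" for x
  proof (cases "\<bar>x\<bar> = pi")
    case True
    then have "x = pi \<or> x = - pi" by linarith
    then have "sin (x - y) = sin y" for y by (auto simp: sin_diff)
    then have "y \<le> \<bar>x\<bar> - sin (x - y) + 0 * (1 - cos (x - y))" if "0 \<le> y" "y \<le> pi" for y
      using sin_x_le_x [of "pi - y"] that True by simp
    then show ?thesis by blast
  next
    case False
    \<comment> \<open>\<open>pi + \<bar>x\<bar>\<close> bounds \<open>y - x\<close> for
      \<open>y\<close> in \<open>[0, pi]\<close>.\<close>
    then have "pi + \<bar>x\<bar> < 2 * pi" using that by simp
    then obtain C where C: "0 \<le> C"
      "\<And>t. 0 \<le> t \<Longrightarrow> t \<le> pi + \<bar>x\<bar> \<Longrightarrow> t - sin t \<le> C * (1 - cos t)"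
      using diff_sin_bound by blast
    have "y \<le> \<bar>x\<bar> - sin (x - y) + C * (1 - cos (x - y))" if "0 \<le> y" "y \<le> pi" for y
    proof (cases "x \<le> y")
      case True
      have "(y - x) - sin (y - x) \<le> C * (1 - cos (y - x))" using True that by (intro C) auto
      moreover have "sin (y - x) = - sin (x - y)" "cos (y - x) = cos (x - y)"
        by (metis minus_diff_eq sin_minus cos_minus)+
      ultimately have "(y - x) + sin (x - y) \<le> C * (1 - cos (x - y))" by simp
      then show ?thesis by linarith
    next
      case False
      then have "sin (x - y) \<le> x - y" by (intro sin_x_le_x) auto
      moreover have "0 \<le> C * (1 - cos (x - y))" using C(1) by simp
      ultimately show ?thesis by linarith
    qed
    then show ?thesis using C(1) by blast
  qed
  obtain C where C: "C \<ge> 0" "\<And>y. 0 \<le> y \<Longrightarrow> y \<le> pi \<Longrightarrow> y \<le> \<bar>x\<bar> - sin (x - y) + C * (1 - cos (x - y))"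
    using * [OF assms] by blast
  obtain D where D: "D \<ge> 0" "\<And>y. 0 \<le> y \<Longrightarrow> y \<le> pi \<Longrightarrow> y \<le> \<bar>x\<bar> - sin (- x - y) + D * (1 - cos (- x - y))"
    using * [of "- x"] assms by auto
  show ?thesis
  proof (intro exI [of _ "C + D"] conjI allI impI)
    fix y assume y: "\<bar>y\<bar> \<le> pi"
    have nn: "0 \<le> C * (1 - cos (x - y))" "0 \<le> D * (1 - cos (x - y))"
      using C(1) D(1) by simp_all
    show "\<bar>y\<bar> \<le> \<bar>x\<bar> - (if 0 \<le> y then 1 else -1) * sin (x - y) + (C + D) * (1 - cos (x - y))"
    proof (cases "0 \<le> y")
      case True
      then show ?thesis using C(2) [of y] y nn by (simp add: distrib_right)
    next
      case False
      have "- x - - y = - (x - y)" by simp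
      then have "sin (- x - - y) = - sin (x - y)" "cos (- x - - y) = cos (x - y)"
        by (metis sin_minus cos_minus)+
      then show ?thesis using D(2) [of "- y"] False y nn by (simp add: distrib_right)
    qed
  qed (use C(1) D(1) in simp)
qed

text \<open>Definiteness cannot be demanded: the seminorm attached to a subgradient \<open>W\<close>
  vanishes identically when \<open>W = 0\<close>.\<close>

locale ui_seminorm =
  fixes N :: "complex^'n^'n \<Rightarrow> real"
  assumes triangle: "N (A + B) \<le> N A + N B"
    and scale: "N (r *\<^sub>R A) = \<bar>r\<bar> * N A"
    and invariant: "P \<in> unitary \<Longrightarrow> Q \<in> unitary \<Longrightarrow> N (P ** A ** Q) = N A"
begin

lemma zero [simp]: "N 0 = 0"
  using scale [of 0 0] by simp

lemma minus [simp]: "N (- A) = N A"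
  using scale [of "-1" A] by simp

lemma nonneg [simp]: "0 \<le> N A"
  using triangle [of A "- A"] by simp

lemma left [simp]: "P \<in> unitary \<Longrightarrow> N (P ** A) = N A"
  using invariant [of P "mat 1" A] by simp

lemma right [simp]: "Q \<in> unitary \<Longrightarrow> N (A ** Q) = N A"
  using invariant [of "mat 1" Q A] by simp

lemma diff_commute: "N (A - B) = N (B - A)"
  using minus [of "A - B"] by simp

lemma abs_diff_le: "\<bar>N A - N B\<bar> \<le> N (A - B)"
  using triangle [of "A - B" B] triangle [of "B - A" A] diff_commute [of A B] by simp

lemma dg_phase: "N (dg (\<lambda>i. of_real (cmod (d i)))) = N (dg d)"
proof -
  \<comment> \<open>\<open>sgn 0 = 0\<close>, so zero entries get the phase 1 to keep the matrix
    unitary.\<close>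
  let ?u = "\<lambda>i. if d i = 0 then 1 else sgn (d i)"
  have "dg ?u \<in> unitary" by (simp add: unitary_dg norm_sgn)
  moreover have "dg ?u ** dg (\<lambda>i. of_real (cmod (d i))) = dg d"
    unfolding dg_mult by (rule arg_cong [where f = dg]) (auto simp: sgn_eq)
  ultimately show ?thesis by (metis left)
qed

text \<open>One entry is shrunk at a time. Replacing \<open>b j\<close> by \<open>s * b j\<close>
  with \<open>s\<close> in \<open>[-1, 1]\<close> gives a convex combination of the matrix and its
  image under the unitary sign change of row \<open>j\<close>.\<close>

lemma dg_mono:
  assumes "\<And>i. \<bar>a i\<bar> \<le> b i"
  shows "N (dg (\<lambda>i. of_real (a i))) \<le> N (dg (\<lambda>i. of_real (b i)))"
proof -
  have "N (dg (\<lambda>i. of_real (if i \<in> J then a i else b i))) \<le> N (dg (\<lambda>i. of_real (b i)))"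
    if "finite J" for J
    using that
  proof (induction J rule: finite_induct)
    case (insert j J)
    define e where "e i = (if i \<in> J then a i else b i)" for i
    \<comment> \<open>For \<open>b j = 0\<close> the quotient is 0, in agreement with
      \<open>a j = 0\<close>.\<close>
    define s where "s = a j / b j"
    have s: "\<bar>s\<bar> \<le> 1" "a j = s * b j"
      using assms [of j] by (atomize (full), cases "b j = 0") (auto simp: s_def abs_divide divide_le_eq_1)
    let ?R = "dg (\<lambda>i. if i = j then -1 else 1) :: complex^'n^'n"
    have R: "?R \<in> unitary" by (simp add: unitary_dg)
    have "dg (\<lambda>i. of_real (if i \<in> insert j J then a i else b i)) =
        ((1 + s) / 2) *\<^sub>R dg (\<lambda>i. of_real (e i)) + ((1 - s) / 2) *\<^sub>R (?R ** dg (\<lambda>i. of_real (e i)))"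
      using insert.hyps s(2)
      by (intro matrix_eqI) (auto simp: dg_nth e_def scaleR_conv_of_real [where 'a = complex] field_simps)
    also have "N \<dots> \<le> ((1 + s) / 2) * N (dg (\<lambda>i. of_real (e i))) + ((1 - s) / 2) * N (dg (\<lambda>i. of_real (e i)))"
      using s(1) R by (intro order_trans [OF triangle]) (simp add: scale)
    also have "\<dots> = N (dg (\<lambda>i. of_real (e i)))" by (simp add: field_simps)
    also have "\<dots> \<le> N (dg (\<lambda>i. of_real (b i)))" unfolding e_def by (rule insert.IH)
    finally show ?case .
  qed simp
  from this [of UNIV] show ?thesis by simp
qed

text \<open>The mean of a matrix and its conjugate by the reflection that negates coordinate
  \<open>j\<close> has no off-diagonal entries in row and column \<open>j\<close>, and averaging
  over unitary conjugates does not increase \<open>N\<close>.\<close>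

lemma pinching: "N (dg (\<lambda>j. A $ j $ j)) \<le> N A"
proof -
  define p where "p J = (\<chi> i k. if i \<noteq> k \<and> (i \<in> J \<or> k \<in> J) then 0 else A $ i $ k)" for J
  have "N (p J) \<le> N A" if "finite J" for J
    using that
  proof (induction J rule: finite_induct)
    case empty
    have "p {} = A" by (rule matrix_eqI) (simp add: p_def)
    then show ?case by simp
  next
    case (insert j J)
    let ?R = "dg (\<lambda>i. if i = j then -1 else 1) :: complex^'n^'n"
    have R: "?R \<in> unitary" by (simp add: unitary_dg)
    have "p (insert j J) = (1 / 2) *\<^sub>R p J + (1 / 2) *\<^sub>R (?R ** p J ** ?R)"
      by (intro matrix_eqI) (auto simp: p_def scaleR_conv_of_real [where 'a = complex])
    also have "N \<dots> \<le> (1 / 2) * N (p J) + (1 / 2) * N (p J)"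
      using R by (intro order_trans [OF triangle]) (simp add: scale)
    finally show ?case using insert.IH by simp
  qed
  moreover have "p UNIV = dg (\<lambda>j. A $ j $ j)"
    by (rule matrix_eqI) (auto simp: p_def dg_nth)
  ultimately show ?thesis by (metis finite)
qed

lemma norm_bound: "\<exists>c\<ge>0. \<forall>A. N A \<le> c * norm A"
proof (intro exI conjI allI)
  fix A
  have sum: "N (sum f T) \<le> (\<Sum>x\<in>T. N (f x))" if "finite T" for f and T :: "(complex^'n^'n) set"
    using that by (induction T rule: finite_induct) (auto intro: order_trans [OF triangle])
  have "N A = N (\<Sum>x\<in>Basis. (A \<bullet> x) *\<^sub>R x)" by (simp add: euclidean_representation)
  also have "\<dots> \<le> (\<Sum>x\<in>Basis. \<bar>A \<bullet> x\<bar> * N x)" using sum [OF finite_Basis, of "\<lambda>x. (A \<bullet> x) *\<^sub>R x"] by (simp add: scale)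
  also have "\<dots> \<le> (\<Sum>x\<in>Basis. norm A * N x)"
    by (intro sum_mono mult_right_mono Basis_le_norm) auto
  finally show "N A \<le> (\<Sum>x\<in>Basis. N x) * norm A" by (simp add: sum_distrib_left mult.commute)
qed (simp add: sum_nonneg)

lemma continuous_on: "continuous_on S N"
proof -
  obtain c where c: "0 \<le> c" "\<And>A. N A \<le> c * norm A" using norm_bound by blast
  have "c-lipschitz_on S N"
    using c abs_diff_le by (intro lipschitz_onI) (auto simp: dist_norm intro: order_trans)
  then show ?thesis by (rule lipschitz_on_continuous_on)
qed

end

section \<open>The absolute value of the logarithm of a unitary matrix\<close>

text \<open>\<open>A\<close> is the absolute value of a logarithm of \<open>G\<close> with spectrum in \<open>[-i pi, i pi]\<close>. Unlike the
  logarithm itself it is unique, also when \<open>-1\<close> is an eigenvalue of \<open>G\<close>, and depends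
  continuously on \<open>G\<close>.\<close>

definition is_abs_log :: "complex^'n^'n \<Rightarrow> complex^'n^'n \<Rightarrow> bool" where
  "is_abs_log G A \<longleftrightarrow> (\<exists>Q x. Q \<in> unitary \<and> (\<forall>i. \<bar>x i\<bar> \<le> pi) \<and>
     G = Q ** dg (\<lambda>i. cis (x i)) ** ct Q \<and> A = Q ** dg (\<lambda>i. of_real \<bar>x i\<bar>) ** ct Q)"

definition abs_log :: "complex^'n^'n \<Rightarrow> complex^'n^'n" where
  "abs_log G = (SOME A. is_abs_log G A)"

text \<open>Multiplied by \<open>ct V\<close> and \<open>Y\<close>, the difference has the entries
  \<open>(c j - d k) * u j k\<close> with \<open>u = ct V ** Y\<close>. The weights depend on the
  eigenvectors only, so scalar inequalities between functions of the eigenvalues pass to Frobenius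
  norms, as in the Hoffman-Wielandt inequality.\<close>

lemma norm_conj_dg_diff_sq:
  assumes V: "V \<in> unitary" and Y: "Y \<in> unitary"
  shows "(norm (V ** dg c ** ct V - Y ** dg d ** ct Y))\<^sup>2 =
    (\<Sum>j\<in>UNIV. \<Sum>k\<in>UNIV. (cmod ((ct V ** Y) $ j $ k))\<^sup>2 * (cmod (c j - d k))\<^sup>2)"
proof -
  have "ct V ** (V ** dg c ** ct V - Y ** dg d ** ct Y) ** Y
      = (ct V ** V) ** dg c ** (ct V ** Y) - (ct V ** Y) ** dg d ** (ct Y ** Y)"
    by (simp only: matrix_mult_diff_left matrix_mult_diff_right matrix_mul_assoc)
  also have "\<dots> = dg c ** (ct V ** Y) - (ct V ** Y) ** dg d"
    using V Y by simp
  finally have eq: "ct V ** (V ** dg c ** ct V - Y ** dg d ** ct Y) ** Y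
      = dg c ** (ct V ** Y) - (ct V ** Y) ** dg d" .
  have "norm (V ** dg c ** ct V - Y ** dg d ** ct Y)
      = norm (ct V ** (V ** dg c ** ct V - Y ** dg d ** ct Y) ** Y)"
    using V Y unitary_ct [OF V] by simp
  then have "norm (V ** dg c ** ct V - Y ** dg d ** ct Y)
      = norm (dg c ** (ct V ** Y) - (ct V ** Y) ** dg d)"
    unfolding eq .
  moreover have "(cmod (c j * u - u * d k))\<^sup>2 = (cmod u)\<^sup>2 * (cmod (c j - d k))\<^sup>2" for j k u
  proof -
    have "c j * u - u * d k = u * (c j - d k)" by (simp add: algebra_simps)
    then show ?thesis by (simp add: norm_mult power_mult_distrib)
  qed
  ultimately show ?thesis by (simp add: norm_matrix_sq)
qed

text \<open>The scalar bound \<open>abs_angle_lipschitz\<close> is summed with the weights of the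
  previous identity. The case \<open>G' = G\<close> shows that the absolute logarithm is well
  defined.\<close>

lemma is_abs_log_lipschitz:
  assumes "is_abs_log G A" "is_abs_log G' A'"
  shows "norm (A' - A) \<le> 2 * norm (G' - G)"
proof -
  obtain Y x where Y: "Y \<in> unitary" "\<And>i. \<bar>x i\<bar> \<le> pi"
    "G = Y ** dg (\<lambda>i. cis (x i)) ** ct Y" "A = Y ** dg (\<lambda>i. of_real \<bar>x i\<bar>) ** ct Y"
    using assms(1) unfolding is_abs_log_def by blast
  obtain V y where V: "V \<in> unitary" "\<And>i. \<bar>y i\<bar> \<le> pi"
    "G' = V ** dg (\<lambda>i. cis (y i)) ** ct V" "A' = V ** dg (\<lambda>i. of_real \<bar>y i\<bar>) ** ct V"
    using assms(2) unfolding is_abs_log_def by blast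
  let ?p = "\<lambda>j k. (cmod ((ct V ** Y) $ j $ k))\<^sup>2"
  have "cmod (of_real (\<bar>y j\<bar>) - of_real (\<bar>x k\<bar>)) = \<bar>\<bar>y j\<bar> - \<bar>x k\<bar>\<bar>" for j k
    by (metis norm_of_real of_real_diff)
  then have "(norm (A' - A))\<^sup>2 = (\<Sum>j\<in>UNIV. \<Sum>k\<in>UNIV. ?p j k * (\<bar>y j\<bar> - \<bar>x k\<bar>)\<^sup>2)"
    unfolding V(4) Y(4) norm_conj_dg_diff_sq [OF V(1) Y(1)] by simp
  also have "\<dots> \<le> (\<Sum>j\<in>UNIV. \<Sum>k\<in>UNIV. ?p j k * (4 * (cmod (cis (y j) - cis (x k)))\<^sup>2))"
    using V(2) Y(2) by (intro sum_mono mult_left_mono abs_angle_lipschitz) auto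
  also have "\<dots> = (2 * norm (G' - G))\<^sup>2"
    unfolding V(3) Y(3) power_mult_distrib norm_conj_dg_diff_sq [OF V(1) Y(1)]
    by (simp add: sum_distrib_left mult_ac)
  finally show ?thesis by (rule power2_le_imp_le) simp
qed

lemma abs_log_eqI: "is_abs_log G A \<Longrightarrow> abs_log G = A"
  unfolding abs_log_def using is_abs_log_lipschitz [of G _ G A] by (intro some_equality) fastforce+

lemma is_abs_log_abs_log:
  assumes "G \<in> unitary" shows "is_abs_log G (abs_log G)"
proof -
  obtain Q x where Q: "Q \<in> unitary" "G = Q ** dg (\<lambda>i. cis (x i)) ** ct Q" "\<And>i. \<bar>x i\<bar> \<le> pi"
    using unitary_diagonalization [OF assms] by metis
  then have "is_abs_log G (Q ** dg (\<lambda>i. of_real \<bar>x i\<bar>) ** ct Q)"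
    unfolding is_abs_log_def by (intro exI conjI) auto
  then show ?thesis using abs_log_eqI by metis
qed

lemma abs_log_lipschitz:
  "G \<in> unitary \<Longrightarrow> G' \<in> unitary \<Longrightarrow> norm (abs_log G' - abs_log G) \<le> 2 * norm (G' - G)"
  by (intro is_abs_log_lipschitz is_abs_log_abs_log)

lemma abs_log_mat1: "abs_log (mat 1) = 0"
proof (rule abs_log_eqI)
  have "dg (\<lambda>i. of_real \<bar>0\<bar>) = 0" by (rule matrix_eqI) (simp add: dg_nth)
  then show "is_abs_log (mat 1) 0"
    unfolding is_abs_log_def
    by (intro exI [of _ "mat 1"] exI [of _ "\<lambda>_. 0"]) (auto simp flip: mat1_dg)
qed

context ui_seminorm
begin

lemma abs_log_conj_cis:
  assumes "Q \<in> unitary" "\<And>i. \<bar>x i\<bar> \<le> pi"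
  shows "N (abs_log (Q ** dg (\<lambda>i. cis (x i)) ** ct Q)) = N (Q ** dg (\<lambda>i. of_real (x i)) ** ct Q)"
proof -
  have "abs_log (Q ** dg (\<lambda>i. cis (x i)) ** ct Q) = Q ** dg (\<lambda>i. of_real \<bar>x i\<bar>) ** ct Q"
    using assms by (intro abs_log_eqI) (auto simp: is_abs_log_def)
  then show ?thesis
    using assms(1) dg_phase [of "\<lambda>i. of_real (x i)"] by (simp add: invariant unitary_ct)
qed

text \<open>In an eigenbasis of \<open>G'\<close>, the eigenvalues of \<open>abs_log G'\<close> are bounded, up to second order, by
  the diagonal entries of \<open>abs_log G\<close> plus the moduli of those of \<open>G' - G\<close>; pinching then gives
  the claim.\<close>

lemma abs_log_first_order:
  assumes G: "G \<in> unitary"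
  shows "\<exists>C\<ge>0. \<forall>G'\<in>unitary. N (abs_log G') \<le> N (abs_log G) + N (G' - G) + C * (norm (G' - G))\<^sup>2"
proof -
  obtain Y x where Y: "Y \<in> unitary" "\<And>i. \<bar>x i\<bar> \<le> pi"
    "G = Y ** dg (\<lambda>i. cis (x i)) ** ct Y" "abs_log G = Y ** dg (\<lambda>i. of_real \<bar>x i\<bar>) ** ct Y"
    using is_abs_log_abs_log [OF G] unfolding is_abs_log_def by blast
  \<comment> \<open>Expanding at the angles \<open>x k\<close> of \<open>G\<close> makes the
    constants independent of \<open>G'\<close>.\<close>
  have "\<forall>k. \<exists>C\<ge>0. \<forall>y. \<bar>y\<bar> \<le> pi \<longrightarrow>
      \<bar>y\<bar> \<le> \<bar>x k\<bar> - (if 0 \<le> y then 1 else -1) * sin (x k - y) + C * (1 - cos (x k - y))"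
    using abs_angle_first_order [OF Y(2)] by blast
  then obtain c where c: "\<And>k. 0 \<le> c k" "\<And>k y. \<bar>y\<bar> \<le> pi \<Longrightarrow>
      \<bar>y\<bar> \<le> \<bar>x k\<bar> - (if 0 \<le> y then 1 else -1) * sin (x k - y) + c k * (1 - cos (x k - y))"
    by metis
  define C where "C = sum c UNIV"
  have C: "0 \<le> C" "\<And>k. c k \<le> C"
    unfolding C_def using c(1) by (auto intro: sum_nonneg member_le_sum)
  have "N (abs_log G') \<le> N (abs_log G) + N (G' - G) + (C * N (mat 1)) * (norm (G' - G))\<^sup>2"
    if G': "G' \<in> unitary" for G'
  proof -
    obtain V y where V: "V \<in> unitary" "\<And>i. \<bar>y i\<bar> \<le> pi"
      "G' = V ** dg (\<lambda>i. cis (y i)) ** ct V" "abs_log G' = V ** dg (\<lambda>i. of_real \<bar>y i\<bar>) ** ct V"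
      using is_abs_log_abs_log [OF G'] unfolding is_abs_log_def by blast
    define M where "M = ct V ** Y"
    have M: "M \<in> unitary" unfolding M_def using V Y by (intro unitary_mult unitary_ct)
    define p where "p j k = (cmod (M $ j $ k))\<^sup>2" for j k
    have p: "0 \<le> p j k" "(\<Sum>k\<in>UNIV. p j k) = 1" for j k
      by (simp_all add: p_def unitary_row_sum [OF M])
    \<comment> \<open>In the eigenbasis of \<open>G'\<close>, \<open>a j\<close> is a diagonal entry
      of \<open>abs_log G\<close> and \<open>e j\<close> one of \<open>G - G'\<close>.\<close>
    define a where "a j = (\<Sum>k\<in>UNIV. p j k * \<bar>x k\<bar>)" for j
    define e where "e j = (\<Sum>k\<in>UNIV. of_real (p j k) * cis (x k)) - cis (y j)" for j
    define r where "r = C * (norm (G' - G))\<^sup>2"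
    have diag: "(ct V ** (Y ** dg d ** ct Y) ** V) $ j $ j = (\<Sum>k\<in>UNIV. of_real (p j k) * d k)" for d j
    proof -
      have eq: "ct V ** (Y ** dg d ** ct Y) ** V = M ** dg d ** ct M"
        by (simp only: M_def ct_mult ct_ct matrix_mul_assoc)
      show ?thesis
        unfolding eq conj_dg_nth p_def complex_norm_square by (simp add: mult_ac)
    qed
    have a: "(ct V ** abs_log G ** V) $ j $ j = of_real (a j)" for j
      unfolding Y(4) diag by (simp add: a_def)
    have e: "(ct V ** (G - G') ** V) $ j $ j = e j" for j
    proof -
      have "ct V ** (G - G') ** V = ct V ** G ** V - ct V ** G' ** V"
        by (simp add: matrix_mult_diff_left matrix_mult_diff_right)
      moreover have "ct V ** G' ** V = dg (\<lambda>i. cis (y i))"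
        by (rule unitary_conj_inverse [OF V(1) V(3)])
      ultimately show ?thesis by (simp add: Y(3) diag e_def dg_nth)
    qed
    have le: "\<bar>y j\<bar> \<le> a j + cmod (e j) + r" for j
    proof -
      let ?s = "if 0 \<le> y j then 1 else -1 :: real"
      have "\<bar>y j\<bar> = (\<Sum>k\<in>UNIV. p j k * \<bar>y j\<bar>)"
        by (simp add: p(2) flip: sum_distrib_right)
      also have "\<dots> \<le> (\<Sum>k\<in>UNIV. p j k * (\<bar>x k\<bar> - ?s * sin (x k - y j) + c k * (1 - cos (x k - y j))))"
        using c(2) [OF V(2)] p(1) by (intro sum_mono mult_left_mono) auto
      also have "\<dots> \<le> (\<Sum>k\<in>UNIV. p j k * (\<bar>x k\<bar> - ?s * sin (x k - y j) + C * (1 - cos (x k - y j))))"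
        using C(2) p(1) by (intro sum_mono mult_left_mono add_left_mono mult_right_mono) auto
      also have "\<dots> = a j - ?s * (\<Sum>k\<in>UNIV. p j k * sin (x k - y j))
          + C * (\<Sum>k\<in>UNIV. p j k * (1 - cos (x k - y j)))"
        by (simp add: a_def sum.distrib sum_subtractf sum_distrib_left algebra_simps)
      finally have main: "\<bar>y j\<bar> \<le> a j - ?s * (\<Sum>k\<in>UNIV. p j k * sin (x k - y j))
          + C * (\<Sum>k\<in>UNIV. p j k * (1 - cos (x k - y j)))" .
      \<comment> \<open>Rotating \<open>e j\<close> by the angle \<open>- y j\<close> turns the mean
        of the sines into an imaginary part.\<close>
      have sin_le: "- (?s * (\<Sum>k\<in>UNIV. p j k * sin (x k - y j))) \<le> cmod (e j)"
      proof -
        have "cnj (cis (y j)) * e j = (\<Sum>k\<in>UNIV. of_real (p j k) * cis (x k - y j)) - 1"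
        proof -
          have "cnj (cis (y j)) * (z * cis v) = z * cis (v - y j)" for z v
          proof -
            have "cnj (cis (y j)) * (z * cis v) = z * (cis (- y j) * cis v)" by (simp add: cis_cnj)
            then show ?thesis by (simp add: cis_mult)
          qed
          moreover have "cnj (cis (y j)) * cis (y j) = 1" by (simp add: cis_cnj cis_mult)
          ultimately show ?thesis
            unfolding e_def right_diff_distrib sum_distrib_left by (simp only:)
        qed
        then have "(\<Sum>k\<in>UNIV. p j k * sin (x k - y j)) = Im (cnj (cis (y j)) * e j)"
          by simp
        also have "\<bar>\<dots>\<bar> \<le> cmod (e j)"
          using abs_Im_le_cmod [of "cnj (cis (y j)) * e j"] by (simp add: norm_mult)
        finally show ?thesis by (simp add: abs_le_iff)
      qed
      \<comment> \<open>\<open>1 - cos\<close> is half a squared chord, and the weighted squared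
        chords of all rows add up to the square of \<open>norm (G' - G)\<close>.\<close>
      have cos_le: "(\<Sum>k\<in>UNIV. p j k * (1 - cos (x k - y j))) \<le> (norm (G' - G))\<^sup>2"
      proof -
        have "(\<Sum>k\<in>UNIV. p j k * (1 - cos (x k - y j))) \<le> (\<Sum>k\<in>UNIV. p j k * (cmod (cis (y j) - cis (x k)))\<^sup>2)"
        proof (intro sum_mono mult_left_mono p)
          fix k
          have "cos (y j - x k) = cos (x k - y j)" by (metis cos_minus minus_diff_eq)
          then show "1 - cos (x k - y j) \<le> (cmod (cis (y j) - cis (x k)))\<^sup>2"
            using cos_le_one [of "x k - y j"] by (simp add: cmod_cis_diff_sq)
        qed
        also have "\<dots> \<le> (\<Sum>j\<in>UNIV. \<Sum>k\<in>UNIV. p j k * (cmod (cis (y j) - cis (x k)))\<^sup>2)"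
          by (rule member_le_sum) (auto intro!: sum_nonneg mult_nonneg_nonneg p)
        also have "\<dots> = (norm (G' - G))\<^sup>2"
          unfolding V(3) Y(3) norm_conj_dg_diff_sq [OF V(1) Y(1)] p_def M_def ..
        finally show ?thesis .
      qed
      show ?thesis
        using main sin_le mult_left_mono [OF cos_le C(1)] unfolding r_def by linarith
    qed
    have r: "0 \<le> r" using C(1) by (simp add: r_def)
    have "N (abs_log G') = N (dg (\<lambda>j. of_real \<bar>y j\<bar>))"
      unfolding V(4) using V(1) by (simp add: invariant unitary_ct)
    also have "\<dots> \<le> N (dg (\<lambda>j. of_real (a j + cmod (e j) + r)))"
      using le by (intro dg_mono) simp
    also have "dg (\<lambda>j. of_real (a j + cmod (e j) + r))
        = dg (\<lambda>j. of_real (a j)) + dg (\<lambda>j. of_real (cmod (e j))) + r *\<^sub>R (mat 1 :: complex^'n^'n)"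
      by (rule matrix_eqI) (simp add: dg_nth mat_def scaleR_conv_of_real [where 'a = complex])
    also have "N \<dots> \<le> N (dg (\<lambda>j. of_real (a j))) + N (dg (\<lambda>j. of_real (cmod (e j)))) + r * N (mat 1)"
      using triangle [of "dg (\<lambda>j. of_real (a j)) + dg (\<lambda>j. of_real (cmod (e j)))" "r *\<^sub>R mat 1"]
        triangle [of "dg (\<lambda>j. of_real (a j))" "dg (\<lambda>j. of_real (cmod (e j)))"] r
      by (simp add: scale)
    also have "N (dg (\<lambda>j. of_real (a j))) \<le> N (abs_log G)"
      using pinching [of "ct V ** abs_log G ** V"] V(1) by (simp add: a invariant unitary_ct)
    also have "N (dg (\<lambda>j. of_real (cmod (e j)))) \<le> N (G' - G)"
      using pinching [of "ct V ** (G - G') ** V"] V(1)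
      by (simp add: e invariant unitary_ct dg_phase diff_commute [of G'])
    finally show ?thesis by (simp add: r_def mult_ac)
  qed
  moreover have "0 \<le> C * N (mat 1)" using C(1) by simp
  ultimately show ?thesis by blast
qed

end

section \<open>Length of piecewise \<open>C1\<close> curves\<close>

text \<open>The hypothesis \<open>dini\<close> says that the lower right Dini derivative is
  nonnegative. If \<open>f\<close> dropped, its graph would end below a line of small negative slope
  through \<open>(a, f a)\<close>; but from the last point on or above that line the Dini condition
  leads to a later one.\<close>

lemma dini_nondecreasing_closed:
  fixes f :: "real \<Rightarrow> real"
  assumes "a \<le> c" and cont: "continuous_on {a..c} f"
    and dini: "\<And>t e. a \<le> t \<Longrightarrow> t < c \<Longrightarrow> 0 < e \<Longrightarrow> \<forall>\<^sub>F s in at_right t. f t - e * (s - t) \<le> f s"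
  shows "f a \<le> f c"
proof (rule ccontr)
  assume "\<not> f a \<le> f c"
  then have less: "f c < f a" by simp
  with assms(1) have "a < c" by (cases "a = c") auto
  \<comment> \<open>Half the mean rate of descent, so that at \<open>c\<close> the line is still
    above \<open>f c\<close>.\<close>
  define e where "e = (f a - f c) / (2 * (c - a))"
  have e: "0 < e" using less \<open>a < c\<close> by (simp add: e_def)
  have ec: "e * (c - a) = (f a - f c) / 2" using \<open>a < c\<close> by (simp add: e_def field_simps)
  define g where "g t = f t - f a + e * (t - a)" for t
  have "continuous_on {a..c} g" unfolding g_def by (intro continuous_intros cont)
  then have "closed ({a..c} \<inter> g -` {0..})"
    by (intro continuous_closed_preimage) auto
  then have "compact ({a..c} \<inter> g -` {0..})"
    by (simp add: compact_eq_bounded_closed bounded_Int)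
  moreover have "a \<in> {a..c} \<inter> g -` {0..}" using assms(1) by (simp add: g_def)
  ultimately obtain s where s: "s \<in> {a..c} \<inter> g -` {0..}"
    and max: "\<And>t. t \<in> {a..c} \<inter> g -` {0..} \<Longrightarrow> t \<le> s"
    using compact_attains_sup [of "{a..c} \<inter> g -` {0..}"] by blast
  have "s \<noteq> c"
    using s less ec by (auto simp: g_def)
  then have sc: "a \<le> s" "s < c" "0 \<le> g s" using s by auto
  have "\<forall>\<^sub>F t in at_right s. f s - e * (t - s) \<le> f t \<and> s < t \<and> t < c"
    using sc(2) by (intro eventually_conj dini [OF sc(1,2) e] eventually_at_right_less)
      (auto simp: eventually_at_right_field)
  then obtain t where t: "f s - e * (t - s) \<le> f t" "s < t" "t < c"
    using eventually_happens' [OF trivial_limit_at_right_real] by blast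
  have "g s \<le> g t" using t(1) by (simp add: g_def algebra_simps)
  then show False using max [of t] t sc by auto
qed

text \<open>The left end point is reached by continuity from the right. In this form intervals can
  be glued at exceptional points, where nothing is known about the increments.\<close>

lemma dini_nondecreasing_open:
  fixes f :: "real \<Rightarrow> real"
  assumes "a \<le> c" and cont: "continuous_on {a..c} f"
    and dini: "\<And>t e. a < t \<Longrightarrow> t < c \<Longrightarrow> 0 < e \<Longrightarrow> \<forall>\<^sub>F s in at_right t. f t - e * (s - t) \<le> f s"
  shows "f a \<le> f c"
proof (cases "a = c")
  case False
  then have ac: "a < c" using assms(1) by simp
  have "f t \<le> f c" if "a < t" "t < c" for t
  proof (rule dini_nondecreasing_closed [where f = f and a = t and c = c])
    show "t \<le> c" using that by simp
    show "continuous_on {t..c} f" by (rule continuous_on_subset [OF cont]) (use that in auto)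
  qed (use that in \<open>auto intro: dini\<close>)
  then have le: "\<forall>\<^sub>F t in at_right a. f t \<le> f c"
    using ac by (auto simp: eventually_at_right_field)
  have "(f \<longlongrightarrow> f a) (at_right a)"
  proof -
    have "(f \<longlongrightarrow> f a) (at a within {a..c})" using cont ac by (simp add: continuous_on_def)
    then show ?thesis unfolding at_within_Icc_at_right [OF ac] .
  qed
  then show ?thesis
    by (rule tendsto_upperbound [OF _ le]) simp
qed simp

lemma dini_nondecreasing:
  fixes f :: "real \<Rightarrow> real"
  assumes "finite K" "a \<le> c" "continuous_on {a..c} f"
    and "\<And>t e. a < t \<Longrightarrow> t < c \<Longrightarrow> t \<notin> K \<Longrightarrow> 0 < e \<Longrightarrow> \<forall>\<^sub>F s in at_right t. f t - e * (s - t) \<le> f s"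
  shows "f a \<le> f c"
  using assms
proof (induction K arbitrary: a c rule: finite_induct)
  case empty
  then show ?case by (intro dini_nondecreasing_open [of a c f]) simp_all
next
  case (insert k K)
  show ?case
  proof (cases "a < k \<and> k < c")
    case True
    have "f a \<le> f k"
    proof (rule insert.IH)
      show "continuous_on {a..k} f"
        by (rule continuous_on_subset [OF insert.prems(2)]) (use True in auto)
    qed (use True insert.prems(3) in auto)
    also have "f k \<le> f c"
    proof (rule insert.IH)
      show "continuous_on {k..c} f"
        by (rule continuous_on_subset [OF insert.prems(2)]) (use True in auto)
    qed (use True insert.prems(3) in auto)
    finally show ?thesis .
  next
    case False
    show ?thesis
    proof (rule insert.IH [OF insert.prems(1,2)])
      fix t e :: real
      assume "a < t" "t < c" "t \<notin> K" "0 < e"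
      with False show "\<forall>\<^sub>F s in at_right t. f t - e * (s - t) \<le> f s"
        by (intro insert.prems(3)) auto
    qed
  qed
qed

text \<open>Taken within \<open>{0..b}\<close> to agree literally with the velocity in
  \<open>action\<close>.\<close>

definition curve_deriv :: "real \<Rightarrow> (real \<Rightarrow> 'a::real_normed_vector) \<Rightarrow> real \<Rightarrow> 'a" where
  "curve_deriv b f t = vector_derivative f (at t within {0..b})"

text \<open>\<open>K\<close> is the set of break points, where \<open>curve_deriv\<close> may be
  arbitrary. Inside each piece it agrees with a function that is continuous up to the ends, which
  gives integrability after composition with any continuous \<open>g\<close>.\<close>

lemma piecewise_C1_derivative:
  fixes f :: "real \<Rightarrow> 'a::real_normed_vector"
  assumes "piecewise_C1 b f"
  obtains K where "finite K"
    "\<And>t. 0 < t \<Longrightarrow> t < b \<Longrightarrow> t \<notin> K \<Longrightarrow> (f has_vector_derivative curve_deriv b f t) (at t)"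
    "\<And>t. 0 < t \<Longrightarrow> t < b \<Longrightarrow> t \<notin> K \<Longrightarrow> isCont (curve_deriv b f) t"
    "\<And>g :: 'a \<Rightarrow> real. continuous_on UNIV g \<Longrightarrow> (\<lambda>t. g (curve_deriv b f t)) integrable_on {0..b}"
proof -
  from assms obtain m p where p: "p 0 = 0" "p m = b" "\<And>i. i < m \<Longrightarrow> p i < p (Suc i)"
    and C1: "\<And>i. i < m \<Longrightarrow> C1_on_interval (p i) (p (Suc i)) f"
    unfolding piecewise_C1_def by blast
  have mono: "p i \<le> p j" if "i \<le> j" "j \<le> m" for i j
    using that
  proof (induction j)
    case (Suc j)
    then show ?case using p(3) [of j] by (cases "i = Suc j") auto
  qed simp
  have "\<exists>f'. continuous_on {p i..p (Suc i)} f' \<and>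
      (\<forall>t\<in>{p i<..<p (Suc i)}. (f has_vector_derivative f' t) (at t) \<and> curve_deriv b f t = f' t)"
    if i: "i < m" for i
  proof -
    obtain f' where f': "continuous_on {p i..p (Suc i)} f'"
      "\<And>t. t \<in> {p i..p (Suc i)} \<Longrightarrow> (f has_vector_derivative f' t) (at t within {p i..p (Suc i)})"
      using C1 [OF i] unfolding C1_on_interval_def by blast
    have "(f has_vector_derivative f' t) (at t) \<and> curve_deriv b f t = f' t" if t: "t \<in> {p i<..<p (Suc i)}" for t
    proof
      show d: "(f has_vector_derivative f' t) (at t)"
        using f'(2) [of t] t by (simp add: at_within_Icc_at)
      have "0 < t" "t < b"
        using t mono [of 0 i] mono [of "Suc i" m] i p(1,2) by auto
      then show "curve_deriv b f t = f' t"
        using d by (simp add: curve_deriv_def at_within_Icc_at vector_derivative_at)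
    qed
    then show ?thesis using f'(1) by blast
  qed
  then obtain D where D: "\<And>i. i < m \<Longrightarrow> continuous_on {p i..p (Suc i)} (D i)"
    "\<And>i t. i < m \<Longrightarrow> t \<in> {p i<..<p (Suc i)} \<Longrightarrow> (f has_vector_derivative D i t) (at t)"
    "\<And>i t. i < m \<Longrightarrow> t \<in> {p i<..<p (Suc i)} \<Longrightarrow> curve_deriv b f t = D i t"
    by metis
  have piece: "\<exists>i<m. t \<in> {p i<..<p (Suc i)}" if t: "0 < t" "t < b" "t \<notin> p ` {..m}" for t
  proof -
    have "j \<le> m \<Longrightarrow> t < p j \<Longrightarrow> \<exists>i<j. t \<in> {p i<..<p (Suc i)}" for j
    proof (induction j)
      case (Suc j)
      show ?case
      proof (cases "t < p j")
        case True
        then show ?thesis using Suc by (meson Suc_leD less_Suc_eq)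
      next
        case False
        moreover have "t \<noteq> p j" using t(3) Suc.prems by auto
        ultimately show ?thesis using Suc.prems by (intro exI [of _ j]) auto
      qed
    qed (use t(1) p(1) in simp)
    from this [of m] show ?thesis using t p(2) by blast
  qed
  have isC: "isCont (curve_deriv b f) t" if i: "i < m" "t \<in> {p i<..<p (Suc i)}" for i t
  proof -
    have "continuous_on {p i<..<p (Suc i)} (D i)"
      using D(1) [OF i(1)] by (rule continuous_on_subset) auto
    then have "continuous_on {p i<..<p (Suc i)} (curve_deriv b f)"
      by (rule continuous_on_eq) (simp add: D(3) [OF i(1)])
    then show ?thesis using i(2) by (simp add: continuous_on_eq_continuous_at)
  qed
  have int: "(\<lambda>t. g (curve_deriv b f t)) integrable_on {0..b}" if g: "continuous_on UNIV g" for g :: "'a \<Rightarrow> real"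
  proof -
    have "j \<le> m \<Longrightarrow> (\<lambda>t. g (curve_deriv b f t)) integrable_on {0..p j}" for j
    proof (induction j)
      case (Suc j)
      have "(\<lambda>t. g (D j t)) integrable_on {p j..p (Suc j)}"
        using D(1) [of j] Suc.prems
        by (intro integrable_continuous_real continuous_on_compose2 [OF g]) auto
      then have "(\<lambda>t. g (curve_deriv b f t)) integrable_on {p j..p (Suc j)}"
        by (rule integrable_spike_finite [of "{p j, p (Suc j)}", rotated 2])
           (use D(3) [of j] Suc.prems in auto)
      then show ?case
        using Suc mono [of 0 j] p(3) [of j] p(1)
        by (intro Henstock_Kurzweil_Integration.integrable_combine [of 0 "p j" "p (Suc j)"]) auto
    qed (use integrable_on_refl [of _ "0::real"] p(1) in simp)
    from this [of m] show ?thesis by (simp add: p(2))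
  qed
  show thesis
  proof (rule that [of "p ` {..m}"])
    show "(f has_vector_derivative curve_deriv b f t) (at t)" "isCont (curve_deriv b f) t"
      if "0 < t" "t < b" "t \<notin> p ` {..m}" for t
      using piece [OF that] D isC by metis+
  qed (use int in auto)
qed

lemma integral_derivative_at:
  fixes h :: "real \<Rightarrow> real"
  assumes "h integrable_on {0..b}" "0 < t" "t < b" "isCont h t"
  shows "((\<lambda>u. integral {0..u} h) has_vector_derivative h t) (at t)"
  using integral_has_vector_derivative_continuous_at [of h 0 b t "{}"] assms
  by (simp add: at_within_Icc_at)

lemma difference_quotient_tendsto:
  fixes f :: "real \<Rightarrow> 'a::real_normed_vector"
  assumes "(f has_vector_derivative D) (at t)"
  shows "((\<lambda>s. (1 / (s - t)) *\<^sub>R (f s - f t)) \<longlongrightarrow> D) (at_right t)"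
proof -
  have "((\<lambda>y. (1 / norm (y - t)) *\<^sub>R (f y - (f t + (y - t) *\<^sub>R D))) \<longlongrightarrow> 0) (at_right t)"
    using has_vector_derivative_at_within [OF assms, of "{t<..}"]
    unfolding has_vector_derivative_def has_derivative_within by blast
  then have "((\<lambda>y. (1 / norm (y - t)) *\<^sub>R (f y - (f t + (y - t) *\<^sub>R D)) + D) \<longlongrightarrow> 0 + D) (at_right t)"
    by (intro tendsto_add tendsto_const)
  then show ?thesis
  proof (rule filterlim_cong [THEN iffD1, rotated -1])
    show "\<forall>\<^sub>F y in at_right t. (1 / norm (y - t)) *\<^sub>R (f y - (f t + (y - t) *\<^sub>R D)) + D
        = (1 / (y - t)) *\<^sub>R (f y - f t)"
      using eventually_at_right_less [of t]
      by eventually_elim (simp add: scaleR_diff_right scaleR_add_right)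
  qed auto
qed

text \<open>By the upper first-order bound, length minus \<open>F\<close> along the curve has
  nonnegative lower right Dini derivative away from the break points. This serves the
  \<open>N\<close>-length, with \<open>F\<close> built from \<open>abs_log\<close>, and the
  Frobenius length, with \<open>F\<close> built from spherical angles.\<close>

lemma increment_le_length:
  fixes f :: "real \<Rightarrow> 'a::real_normed_vector"
  assumes f: "piecewise_C1 b f" and S: "\<And>t. t \<in> {0..b} \<Longrightarrow> f t \<in> S"
    and F: "continuous_on S F"
    and N: "continuous_on UNIV N" "\<And>r A. N (r *\<^sub>R A) = \<bar>r\<bar> * N A"
    and first_order: "\<And>G. G \<in> S \<Longrightarrow> \<exists>C. \<forall>H\<in>S. F H \<le> F G + N (H - G) + C * (norm (H - G))\<^sup>2"
    and ac: "0 \<le> a" "a \<le> c" "c \<le> b"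
  shows "F (f c) - F (f a) \<le> integral {a..c} (\<lambda>t. N (curve_deriv b f t))"
proof -
  obtain K where K: "finite K"
    and der: "\<And>t. 0 < t \<Longrightarrow> t < b \<Longrightarrow> t \<notin> K \<Longrightarrow> (f has_vector_derivative curve_deriv b f t) (at t)"
    and isC: "\<And>t. 0 < t \<Longrightarrow> t < b \<Longrightarrow> t \<notin> K \<Longrightarrow> isCont (curve_deriv b f) t"
    and int: "\<And>g :: 'a \<Rightarrow> real. continuous_on UNIV g \<Longrightarrow> (\<lambda>t. g (curve_deriv b f t)) integrable_on {0..b}"
    using piecewise_C1_derivative [OF f] by blast
  let ?n = "\<lambda>t. N (curve_deriv b f t)"
  let ?I = "\<lambda>t. integral {0..t} ?n"
  have n: "?n integrable_on {0..b}" by (rule int [OF N(1)])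
  have "?I a - F (f a) \<le> ?I c - F (f c)"
  proof (rule dini_nondecreasing [OF K ac(2)])
    have "continuous_on {0..b} f" using f by (simp add: piecewise_C1_def)
    then have "continuous_on {0..b} (\<lambda>t. F (f t))"
      using S by (intro continuous_on_compose2 [OF F]) auto
    then have "continuous_on {0..b} (\<lambda>t. ?I t - F (f t))"
      by (intro continuous_intros indefinite_integral_continuous_1 n)
    then show "continuous_on {a..c} (\<lambda>t. ?I t - F (f t))"
      by (rule continuous_on_subset) (use ac in auto)
  next
    fix t e :: real
    assume t: "a < t" "t < c" "t \<notin> K" and e: "0 < e"
    then have tb: "0 < t" "t < b" using ac by auto
    obtain C where C: "\<And>H. H \<in> S \<Longrightarrow> F H \<le> F (f t) + N (H - f t) + C * (norm (H - f t))\<^sup>2"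
      using first_order [OF S, of t] tb by auto
    let ?q = "\<lambda>s. (1 / (s - t)) *\<^sub>R (f s - f t)"
    have Ncont: "isCont N x" for x using N(1) by (simp add: continuous_on_eq_continuous_at)
    have q: "(?q \<longlongrightarrow> curve_deriv b f t) (at_right t)"
      by (rule difference_quotient_tendsto [OF der [OF tb t(3)]])
    have "isCont ?n t"
      by (rule isCont_o2 [OF isC [OF tb t(3)] Ncont])
    then have I: "((\<lambda>s. (1 / (s - t)) *\<^sub>R (?I s - ?I t)) \<longlongrightarrow> ?n t) (at_right t)"
      by (intro difference_quotient_tendsto integral_derivative_at [OF n tb])
    \<comment> \<open>The limit is 0: the quotient of the length and \<open>N\<close> of the
      difference quotient have the same limit, and the error term carries a factor
      \<open>s - t\<close>.\<close>
    have "((\<lambda>s. (1 / (s - t)) *\<^sub>R (?I s - ?I t) - N (?q s) - C * ((s - t) * (norm (?q s))\<^sup>2))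
        \<longlongrightarrow> ?n t - ?n t - C * ((t - t) * (norm (curve_deriv b f t))\<^sup>2)) (at_right t)"
      by (intro tendsto_intros I isCont_tendsto_compose [OF Ncont] q)
    then have "\<forall>\<^sub>F s in at_right t. - e < (1 / (s - t)) *\<^sub>R (?I s - ?I t) - N (?q s) - C * ((s - t) * (norm (?q s))\<^sup>2)"
      by (rule order_tendstoD) (use e in simp)
    moreover have "\<forall>\<^sub>F s in at_right t. t < s \<and> s < b"
      using tb(2) by (auto simp: eventually_at_right_field)
    ultimately show "\<forall>\<^sub>F s in at_right t. ?I t - F (f t) - e * (s - t) \<le> ?I s - F (f s)"
    proof eventually_elim
      case (elim s)
      then have st: "0 < s - t" by simp
      have q1: "N (f s - f t) = (s - t) * N (?q s)" "norm (f s - f t) = (s - t) * norm (?q s)"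
        using st by (simp_all add: N(2))
      have "(s - t) * (- e) \<le> (s - t) * ((1 / (s - t)) *\<^sub>R (?I s - ?I t) - N (?q s) - C * ((s - t) * (norm (?q s))\<^sup>2))"
        using elim st by (intro mult_left_mono) auto
      also have "\<dots> = (?I s - ?I t) - N (f s - f t) - C * (norm (f s - f t))\<^sup>2"
        unfolding q1 using st by (simp add: field_simps power2_eq_square)
      finally have "(s - t) * (- e) \<le> (?I s - ?I t) - N (f s - f t) - C * (norm (f s - f t))\<^sup>2" .
      moreover have "F (f s) \<le> F (f t) + N (f s - f t) + C * (norm (f s - f t))\<^sup>2"
        using C [OF S, of s] elim tb by auto
      ultimately show ?case by (simp add: algebra_simps)
    qed
  qed
  moreover have "?I a + integral {a..c} ?n = ?I c"
    using ac n by (intro Henstock_Kurzweil_Integration.integral_combine)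
      (auto intro: integrable_on_subinterval)
  ultimately show ?thesis by simp
qed

text \<open>All initial integrals are squeezed to 0, and at a point of continuity \<open>h t\<close>
  is the derivative of the indefinite integral.\<close>

lemma nonneg_integrand_zero:
  fixes h :: "real \<Rightarrow> real"
  assumes h: "h integrable_on {0..b}" and K: "finite K"
    and nn: "\<And>t. 0 < t \<Longrightarrow> t < b \<Longrightarrow> t \<notin> K \<Longrightarrow> 0 \<le> h t"
    and le: "integral {0..b} h \<le> 0" and t: "0 < t" "t < b" "t \<notin> K" "isCont h t"
  shows "h t = 0"
proof -
  have sub: "h integrable_on {u..v}" if "0 \<le> u" "v \<le> b" for u v
    using that by (intro integrable_on_subinterval [OF h]) auto
  have nn_int: "0 \<le> integral {u..v} h" if "0 \<le> u" "v \<le> b" for u v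
  proof -
    let ?h = "\<lambda>t. if t \<in> K \<union> {0, b} then 0 else h t"
    have neg: "negligible (K \<union> {0, b})" using K by (intro negligible_finite) simp
    have "?h integrable_on {u..v}"
      by (rule integrable_spike [OF sub [OF that] neg]) auto
    then have "0 \<le> integral {u..v} ?h"
      using that nn by (intro integral_nonneg) (auto simp: less_le)
    also have "\<dots> = integral {u..v} h"
      by (rule integral_spike [OF neg]) auto
    finally show ?thesis .
  qed
  have zero: "integral {0..u} h = 0" if "0 < u" "u < b" for u
  proof -
    have "integral {0..u} h + integral {u..b} h = integral {0..b} h"
      using that h by (intro Henstock_Kurzweil_Integration.integral_combine) auto
    then show ?thesis using nn_int [of 0 u] nn_int [of u b] that le by simp
  qed
  have "((\<lambda>u. integral {0..u} h) has_vector_derivative h t) (at t)"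
    by (rule integral_derivative_at [OF h t(1,2,4)])
  moreover have "((\<lambda>u. integral {0..u} h) has_vector_derivative 0) (at t)"
    by (rule has_vector_derivative_transform_within_open [of "\<lambda>_. 0" _ _ "{0<..<b}"])
       (use zero t in auto)
  ultimately show ?thesis by (rule vector_derivative_unique_at)
qed

section \<open>Support functionals and trace inequalities\<close>

text \<open>Left translation by \<open>ct (f 0)\<close> moves the start to the identity, where
  \<open>abs_log\<close> vanishes, and preserves both \<open>N\<close> and the Frobenius norm of
  increments.\<close>

lemma (in ui_seminorm) length_ge:
  assumes f: "piecewise_C1 b f" "0 \<le> b" "\<And>t. t \<in> {0..b} \<Longrightarrow> f t \<in> unitary"
    and Q: "Q \<in> unitary" "\<And>i. \<bar>x i\<bar> \<le> pi"
    and ends: "f b = f 0 ** (Q ** dg (\<lambda>i. cis (x i)) ** ct Q)"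
  shows "N (Q ** dg (\<lambda>i. of_real (x i)) ** ct Q) \<le> integral {0..b} (\<lambda>t. N (curve_deriv b f t))"
proof -
  have U: "f 0 \<in> unitary" using f(2,3) by simp
  note U' = unitary_ct [OF U]
  define F where "F G = N (abs_log (ct (f 0) ** G))" for G :: "complex^'n^'n"
  have mult: "ct (f 0) ** H - ct (f 0) ** G = ct (f 0) ** (H - G)" for G H :: "complex^'n^'n"
    by (simp add: matrix_mult_diff_right)
  have "2-lipschitz_on unitary (\<lambda>G. abs_log (ct (f 0) ** G))"
  proof (rule lipschitz_onI)
    fix G H :: "complex^'n^'n" assume "G \<in> unitary" "H \<in> unitary"
    then have "norm (abs_log (ct (f 0) ** G) - abs_log (ct (f 0) ** H)) \<le> 2 * norm (ct (f 0) ** G - ct (f 0) ** H)"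
      using U' by (intro abs_log_lipschitz unitary_mult)
    then show "dist (abs_log (ct (f 0) ** G)) (abs_log (ct (f 0) ** H)) \<le> 2 * dist G H"
      using U' by (simp add: dist_norm mult)
  qed simp
  then have "continuous_on unitary F"
    unfolding F_def
    by (intro continuous_on_compose2 [OF continuous_on [of UNIV]] lipschitz_on_continuous_on) auto
  moreover have "\<exists>C. \<forall>H\<in>unitary. F H \<le> F G + N (H - G) + C * (norm (H - G))\<^sup>2"
    if G: "G \<in> unitary" for G
  proof -
    obtain C where C: "\<And>H. H \<in> unitary \<Longrightarrow>
        N (abs_log H) \<le> N (abs_log (ct (f 0) ** G)) + N (H - ct (f 0) ** G) + C * (norm (H - ct (f 0) ** G))\<^sup>2"
      using abs_log_first_order [OF unitary_mult [OF U' G]] by blast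
    have "F H \<le> F G + N (H - G) + C * (norm (H - G))\<^sup>2" if "H \<in> unitary" for H
      using C [OF unitary_mult [OF U' that]] U' by (simp add: F_def mult)
    then show ?thesis by blast
  qed
  ultimately have "F (f b) - F (f 0) \<le> integral {0..b} (\<lambda>t. N (curve_deriv b f t))"
    using f by (intro increment_le_length [where S = unitary]) (auto intro: continuous_on simp: scale)
  moreover have "F (f b) = N (Q ** dg (\<lambda>i. of_real (x i)) ** ct Q)"
    unfolding F_def ends using U abs_log_conj_cis [OF Q] by simp
  moreover have "F (f 0) = 0"
    using U by (simp add: F_def abs_log_mat1)
  ultimately show ?thesis by simp
qed

text \<open>Birkhoff's theorem for a bilinear objective. In the induction step the maximal entries of
  \<open>a\<close> and \<open>c\<close> are matched, and the mass of their row and column is redistributed over the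
  remaining entries.\<close>

lemma doubly_stochastic_assignment:
  fixes P :: "'a \<Rightarrow> 'b \<Rightarrow> real" and a :: "'a \<Rightarrow> real" and c :: "'b \<Rightarrow> real"
  assumes "finite J" "finite K" "card J = card K"
    and "\<And>j k. j \<in> J \<Longrightarrow> k \<in> K \<Longrightarrow> 0 \<le> P j k"
    and "\<And>j. j \<in> J \<Longrightarrow> (\<Sum>k\<in>K. P j k) = 1" "\<And>k. k \<in> K \<Longrightarrow> (\<Sum>j\<in>J. P j k) = 1"
  shows "\<exists>\<sigma>. bij_betw \<sigma> J K \<and> (\<Sum>j\<in>J. \<Sum>k\<in>K. a j * P j k * c k) \<le> (\<Sum>j\<in>J. a j * c (\<sigma> j))"
  using assms
proof (induction "card J" arbitrary: J K P)
  case 0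
  then have "J = {}" "K = {}" by auto
  then show ?case by (auto simp: bij_betw_def)
next
  case (Suc n)
  have ne: "J \<noteq> {}" "K \<noteq> {}" using Suc.hyps(2) Suc.prems(3) by auto
  obtain j0 where j0: "j0 \<in> J" "\<And>j. j \<in> J \<Longrightarrow> a j \<le> a j0"
    using obtains_MAX [of J a] Suc.prems(1) ne(1)
    by (metis Max_ge finite_imageI imageI)
  obtain k0 where k0: "k0 \<in> K" "\<And>k. k \<in> K \<Longrightarrow> c k \<le> c k0"
    using obtains_MAX [of K c] Suc.prems(2) ne(2)
    by (metis Max_ge finite_imageI imageI)
  define J' where "J' = J - {j0}"
  define K' where "K' = K - {k0}"
  have fin: "finite J'" "finite K'" using Suc.prems by (auto simp: J'_def K'_def)
  have sub: "j \<in> J' \<Longrightarrow> j \<in> J" "k \<in> K' \<Longrightarrow> k \<in> K" for j k by (auto simp: J'_def K'_def)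
  have sumJ: "(\<Sum>j\<in>J. g j) = g j0 + (\<Sum>j\<in>J'. g j)" for g :: "'a \<Rightarrow> real"
    using sum.remove [OF Suc.prems(1) j0(1)] by (simp add: J'_def)
  have sumK: "(\<Sum>k\<in>K. g k) = g k0 + (\<Sum>k\<in>K'. g k)" for g :: "'b \<Rightarrow> real"
    using sum.remove [OF Suc.prems(2) k0(1)] by (simp add: K'_def)
  define r where "r = 1 - P j0 k0"
  have row0: "(\<Sum>k\<in>K'. P j0 k) = r" and col0: "(\<Sum>j\<in>J'. P j k0) = r"
    using Suc.prems(5) [OF j0(1)] Suc.prems(6) [OF k0(1)] by (simp_all add: sumJ sumK r_def)
  have nn: "0 \<le> P j k" if "j \<in> J" "k \<in> K" for j k using that Suc.prems(4) by blast
  have r: "0 \<le> r" unfolding row0 [symmetric] using nn j0 sub by (intro sum_nonneg) auto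
  \<comment> \<open>The rank-one term makes up for the removed row and column: over
    \<open>K'\<close> it sums to \<open>P j k0\<close>, over \<open>J'\<close> to
    \<open>P j0 k\<close>. If \<open>r = 0\<close>, these masses vanish and so does the
    quotient.\<close>
  define P' where "P' j k = P j k + P j k0 * P j0 k / r" for j k
  have "\<exists>\<sigma>. bij_betw \<sigma> J' K' \<and> (\<Sum>j\<in>J'. \<Sum>k\<in>K'. a j * P' j k * c k) \<le> (\<Sum>j\<in>J'. a j * c (\<sigma> j))"
  proof (rule Suc.hyps(1))
    show "n = card J'" "card J' = card K'"
      using Suc.hyps(2) Suc.prems(1-3) j0(1) k0(1) by (auto simp: J'_def K'_def)
    show "0 \<le> P' j k" if "j \<in> J'" "k \<in> K'" for j k
      using that nn j0 k0 sub r by (auto simp: P'_def)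
    show "(\<Sum>k\<in>K'. P' j k) = 1" if "j \<in> J'" for j
    proof -
      have "(\<Sum>k\<in>K'. P' j k) = (\<Sum>k\<in>K'. P j k) + P j k0 * r / r"
        by (simp add: P'_def sum.distrib row0 flip: sum_divide_distrib sum_distrib_left)
      moreover have "P j k0 * r / r = P j k0"
      proof (cases "r = 0")
        case True
        then have "(\<Sum>j\<in>J'. P j k0) = 0" using col0 by simp
        then have "P j k0 = 0" using that fin nn k0(1) sub by (subst (asm) sum_nonneg_eq_0_iff) auto
        then show ?thesis by simp
      qed simp
      ultimately show ?thesis
        using Suc.prems(5) [of j] that sub by (simp add: sumK)
    qed
    show "(\<Sum>j\<in>J'. P' j k) = 1" if "k \<in> K'" for k
    proof -
      have "(\<Sum>j\<in>J'. P' j k) = (\<Sum>j\<in>J'. P j k) + r * P j0 k / r"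
        by (simp add: P'_def sum.distrib col0 flip: sum_divide_distrib sum_distrib_right)
      moreover have "r * P j0 k / r = P j0 k"
      proof (cases "r = 0")
        case True
        then have "(\<Sum>k\<in>K'. P j0 k) = 0" using row0 by simp
        then have "P j0 k = 0" using that fin nn j0(1) sub by (subst (asm) sum_nonneg_eq_0_iff) auto
        then show ?thesis by simp
      qed simp
      ultimately show ?thesis
        using Suc.prems(6) [of k] that sub by (simp add: sumJ)
    qed
  qed (use fin in auto)
  then obtain \<sigma> where \<sigma>: "bij_betw \<sigma> J' K'"
    "(\<Sum>j\<in>J'. \<Sum>k\<in>K'. a j * P' j k * c k) \<le> (\<Sum>j\<in>J'. a j * c (\<sigma> j))" by blast
  define \<tau> where "\<tau> = \<sigma>(j0 := k0)"
  have "bij_betw \<tau> J' K'"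
    by (rule bij_betw_cong [THEN iffD1, OF _ \<sigma>(1)]) (simp add: \<tau>_def J'_def)
  moreover have "bij_betw \<tau> {j0} {k0}" by (simp add: \<tau>_def)
  ultimately have "bij_betw \<tau> (J' \<union> {j0}) (K' \<union> {k0})"
    by (rule bij_betw_combine) (simp add: K'_def)
  then have bij: "bij_betw \<tau> J K"
    using j0(1) k0(1) by (simp add: J'_def K'_def insert_absorb)
  define A where "A = (\<Sum>j\<in>J'. a j * P j k0)"
  define B where "B = (\<Sum>k\<in>K'. P j0 k * c k)"
  have A: "A \<le> a j0 * r"
    unfolding A_def col0 [symmetric] sum_distrib_left
    using j0 nn k0(1) sub by (intro sum_mono mult_right_mono) auto
  have B: "B \<le> c k0 * r"
    unfolding B_def row0 [symmetric] sum_distrib_left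
    using k0 nn j0(1) sub by (subst mult.commute, intro sum_mono mult_right_mono) auto
  have AB0: "A = 0 \<and> B = 0" if "r = 0"
  proof -
    have "P j k0 = 0" if "j \<in> J'" for j
      using that \<open>r = 0\<close> col0 fin nn k0(1) sub by (simp add: sum_nonneg_eq_0_iff)
    moreover have "P j0 k = 0" if "k \<in> K'" for k
      using that \<open>r = 0\<close> row0 fin nn j0(1) sub by (simp add: sum_nonneg_eq_0_iff)
    ultimately show ?thesis by (simp add: A_def B_def)
  qed
  have "(\<Sum>j\<in>J'. \<Sum>k\<in>K'. a j * P' j k * c k) = (\<Sum>j\<in>J'. \<Sum>k\<in>K'. a j * P j k * c k) + A * B / r"
    unfolding P'_def A_def B_def sum_product sum_divide_distrib
    by (simp add: sum.distrib algebra_simps)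
  moreover have "(\<Sum>j\<in>J. \<Sum>k\<in>K. a j * P j k * c k)
      = a j0 * (1 - r) * c k0 + a j0 * B + A * c k0 + (\<Sum>j\<in>J'. \<Sum>k\<in>K'. a j * P j k * c k)"
    unfolding sumJ sumK sum.distrib A_def B_def r_def
    by (simp add: sum_distrib_left sum_distrib_right algebra_simps)
  moreover have "a j0 * (1 - r) * c k0 + a j0 * B + A * c k0 \<le> a j0 * c k0 + A * B / r"
  proof (cases "r = 0")
    case True
    then show ?thesis using AB0 by simp
  next
    case False
    \<comment> \<open>Both deficits are nonnegative because \<open>a j0\<close> and
      \<open>c k0\<close> are maximal; expanding their product compares the objective before and
      after the redistribution.\<close>
    have "0 \<le> (a j0 * r - A) * (c k0 * r - B) / r" using A B r by simp
    also have "\<dots> = a j0 * c k0 * r - a j0 * B - A * c k0 + A * B / r"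
      using False by (simp add: field_simps)
    finally show ?thesis by (simp add: algebra_simps)
  qed
  moreover have "(\<Sum>j\<in>J. a j * c (\<tau> j)) = a j0 * c k0 + (\<Sum>j\<in>J'. a j * c (\<sigma> j))"
    unfolding sumJ by (simp add: \<tau>_def J'_def)
  ultimately show ?case using bij \<sigma>(2) by (intro exI [of _ \<tau>]) linarith
qed

text \<open>This is von Neumann's trace inequality. Nondegeneracy only tests Hermitian matrices, hence the
  need for a Hermitian maximizer.\<close>

lemma hermitian_trace_maximizer:
  fixes W X :: "complex^'n^'n"
  assumes "W \<in> hermitian" "X \<in> hermitian"
  obtains P0 Q0 where "P0 \<in> unitary" "Q0 \<in> unitary" "P0 ** X ** Q0 \<in> hermitian"
    "\<And>P Q. P \<in> unitary \<Longrightarrow> Q \<in> unitary \<Longrightarrow> W \<bullet> (P ** X ** Q) \<le> W \<bullet> (P0 ** X ** Q0)"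
proof -
  obtain R w where R: "R \<in> unitary" "W = R ** dg (\<lambda>i. of_real (w i)) ** ct R"
    using hermitian_diagonalization [OF assms(1)] by blast
  obtain Y x where Y: "Y \<in> unitary" "X = Y ** dg (\<lambda>i. of_real (x i)) ** ct Y"
    using hermitian_diagonalization [OF assms(2)] by blast
  define val where "val \<sigma> = (\<Sum>j\<in>UNIV. \<bar>w j\<bar> * \<bar>x (\<sigma> j)\<bar>)" for \<sigma> :: "'n \<Rightarrow> 'n"
  have "finite {\<sigma> :: 'n \<Rightarrow> 'n. bij \<sigma>}" "id \<in> {\<sigma> :: 'n \<Rightarrow> 'n. bij \<sigma>}" by simp_all
  then obtain \<sigma> where \<sigma>: "bij \<sigma>" "\<And>\<tau>. bij \<tau> \<Longrightarrow> val \<tau> \<le> val \<sigma>"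
    using obtains_MAX [of "{\<sigma> :: 'n \<Rightarrow> 'n. bij \<sigma>}" val]
    by (metis (no_types, lifting) Max_ge empty_iff finite_imageI imageI mem_Collect_eq)
  have W_inner: "W \<bullet> (R ** B ** ct R) = (\<Sum>j\<in>UNIV. w j * Re (B $ j $ j))" for B
  proof -
    have "W \<bullet> (R ** B ** ct R) = (W ** R) \<bullet> (R ** B)"
      using inner_mult_right [of W "R ** B" "ct R"] by simp
    also have "\<dots> = (ct R ** W ** R) \<bullet> B"
      by (simp only: inner_mult_left matrix_mul_assoc)
    also have "ct R ** W ** R = dg (\<lambda>i. of_real (w i))" by (rule unitary_conj_inverse [OF R])
    also have "dg (\<lambda>i. of_real (w i)) \<bullet> B = (\<Sum>j\<in>UNIV. w j * Re (B $ j $ j))"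
      by (simp add: inner_vec_def dg_nth inner_complex_def if_distrib [where f = Re]
          if_distrib [where f = Im] if_distrib [where f = "\<lambda>u. u * _"] cong: if_cong)
    finally show ?thesis .
  qed
  have le: "W \<bullet> (P ** X ** Q) \<le> val \<sigma>" if P: "P \<in> unitary" and Q: "Q \<in> unitary" for P Q
  proof -
    define S where "S = ct R ** P ** Y"
    define T where "T = ct Y ** Q ** R"
    have ST: "S \<in> unitary" "T \<in> unitary"
      unfolding S_def T_def using P Q R(1) Y(1) by (auto intro: unitary_mult unitary_ct)
    have "R ** (S ** dg (\<lambda>i. of_real (x i)) ** T) ** ct R
        = (R ** ct R) ** P ** (Y ** dg (\<lambda>i. of_real (x i)) ** ct Y) ** Q ** (R ** ct R)"
      by (simp only: S_def T_def matrix_mul_assoc)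
    also have "\<dots> = P ** X ** Q" using R(1) by (simp add: Y(2))
    finally have "W \<bullet> (P ** X ** Q) = (\<Sum>j\<in>UNIV. w j * Re ((S ** dg (\<lambda>i. of_real (x i)) ** T) $ j $ j))"
      using W_inner by metis
    also have "\<dots> = (\<Sum>j\<in>UNIV. \<Sum>k\<in>UNIV. w j * (x k * Re (S $ j $ k * T $ k $ j)))"
      by (simp add: matrix_mult_nth [of "S ** _"] sum_distrib_left algebra_simps)
    \<comment> \<open>The weights are the mean of two doubly stochastic matrices: the squared moduli
      of the entries of \<open>S\<close> and of the transpose of \<open>T\<close>.\<close>
    also have "\<dots> \<le> (\<Sum>j\<in>UNIV. \<Sum>k\<in>UNIV. \<bar>w j\<bar> * (((cmod (S $ j $ k))\<^sup>2 + (cmod (T $ k $ j))\<^sup>2) / 2) * \<bar>x k\<bar>)"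
    proof (intro sum_mono)
      fix j k
      have "\<bar>Re (S $ j $ k * T $ k $ j)\<bar> \<le> cmod (S $ j $ k) * cmod (T $ k $ j)"
        using abs_Re_le_cmod [of "S $ j $ k * T $ k $ j"] by (simp add: norm_mult)
      also have "\<dots> \<le> ((cmod (S $ j $ k))\<^sup>2 + (cmod (T $ k $ j))\<^sup>2) / 2"
        using sum_squares_bound [of "cmod (S $ j $ k)" "cmod (T $ k $ j)"] by simp
      finally have "\<bar>w j * x k\<bar> * \<bar>Re (S $ j $ k * T $ k $ j)\<bar>
          \<le> \<bar>w j * x k\<bar> * (((cmod (S $ j $ k))\<^sup>2 + (cmod (T $ k $ j))\<^sup>2) / 2)"
        by (intro mult_left_mono) auto
      moreover have "w j * (x k * Re (S $ j $ k * T $ k $ j)) \<le> \<bar>w j * x k\<bar> * \<bar>Re (S $ j $ k * T $ k $ j)\<bar>"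
        by (metis abs_ge_self abs_mult mult.assoc)
      ultimately have "w j * (x k * Re (S $ j $ k * T $ k $ j))
          \<le> \<bar>w j * x k\<bar> * (((cmod (S $ j $ k))\<^sup>2 + (cmod (T $ k $ j))\<^sup>2) / 2)"
        by (rule order_trans [rotated])
      also have "\<dots> = \<bar>w j\<bar> * (((cmod (S $ j $ k))\<^sup>2 + (cmod (T $ k $ j))\<^sup>2) / 2) * \<bar>x k\<bar>"
        by (simp add: abs_mult)
      finally show "w j * (x k * Re (S $ j $ k * T $ k $ j))
          \<le> \<bar>w j\<bar> * (((cmod (S $ j $ k))\<^sup>2 + (cmod (T $ k $ j))\<^sup>2) / 2) * \<bar>x k\<bar>" .
    qed
    finally have "W \<bullet> (P ** X ** Q) \<le> (\<Sum>j\<in>UNIV. \<Sum>k\<in>UNIV. \<bar>w j\<bar> * (((cmod (S $ j $ k))\<^sup>2 + (cmod (T $ k $ j))\<^sup>2) / 2) * \<bar>x k\<bar>)" .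
    moreover have "\<exists>\<tau>. bij_betw \<tau> UNIV UNIV \<and> (\<Sum>j\<in>UNIV. \<Sum>k\<in>UNIV. \<bar>w j\<bar> * (((cmod (S $ j $ k))\<^sup>2 + (cmod (T $ k $ j))\<^sup>2) / 2) * \<bar>x k\<bar>)
        \<le> (\<Sum>j\<in>UNIV. \<bar>w j\<bar> * \<bar>x (\<tau> j)\<bar>)"
      by (rule doubly_stochastic_assignment)
         (simp_all add: sum.distrib unitary_row_sum unitary_col_sum ST flip: sum_divide_distrib)
    ultimately show ?thesis using \<sigma>(2) unfolding val_def by force
  qed
  \<comment> \<open>The signs \<open>e\<close> and the permutation matrix \<open>S0\<close> arrange
    the eigenvalues of \<open>X\<close> in the eigenbasis of \<open>W\<close> so that all products
    with \<open>w\<close> are nonnegative. Being real and diagonal in that basis, the result is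
    Hermitian.\<close>
  define e where "e j = (if w j * x (\<sigma> j) < 0 then -1 else 1 :: real)" for j
  define S0 :: "complex^'n^'n" where "S0 = (\<chi> j k. if k = \<sigma> j then 1 else 0)"
  have "S0 ** ct S0 = mat 1"
    using bij_is_inj [OF \<sigma>(1)]
    by (intro matrix_eqI) (auto simp: matrix_mult_nth S0_def mat_def inj_eq if_distrib [where f = cnj]
        if_distrib [where f = "\<lambda>u. u * _"] cong: if_cong)
  then have S0: "S0 \<in> unitary"
    unfolding unitary_iff using matrix_left_right_inverse by blast
  have E: "dg (\<lambda>j. of_real (e j)) \<in> unitary" by (simp add: unitary_dg e_def)
  have SXS: "S0 ** dg d ** ct S0 = dg (\<lambda>j. d (\<sigma> j))" for d
    using bij_is_inj [OF \<sigma>(1)]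
    by (intro matrix_eqI) (auto simp: conj_dg_nth S0_def dg_nth inj_eq if_distrib [where f = cnj]
        if_distrib [where f = "\<lambda>u. u * _"] cong: if_cong)
  define P0 where "P0 = R ** dg (\<lambda>j. of_real (e j)) ** S0 ** ct Y"
  define Q0 where "Q0 = Y ** ct S0 ** ct R"
  have PXQ: "P0 ** X ** Q0 = R ** dg (\<lambda>j. of_real (e j * x (\<sigma> j))) ** ct R"
  proof -
    have "P0 ** X ** Q0 = R ** dg (\<lambda>j. of_real (e j)) ** (S0 ** (ct Y ** Y) ** dg (\<lambda>i. of_real (x i)) ** (ct Y ** Y) ** ct S0) ** ct R"
      by (simp only: P0_def Q0_def Y(2) matrix_mul_assoc)
    also have "\<dots> = R ** (dg (\<lambda>j. of_real (e j)) ** dg (\<lambda>j. of_real (x (\<sigma> j)))) ** ct R"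
      using Y(1) by (simp add: SXS matrix_mul_assoc)
    finally show ?thesis by (simp add: dg_mult)
  qed
  show thesis
  proof (rule that)
    show "P0 \<in> unitary" "Q0 \<in> unitary"
      unfolding P0_def Q0_def using R(1) Y(1) S0 E by (auto intro: unitary_mult unitary_ct)
    show "P0 ** X ** Q0 \<in> hermitian"
      unfolding PXQ by (intro hermitian_conj hermitian_dg_real)
    have "w j * (e j * x (\<sigma> j)) = \<bar>w j\<bar> * \<bar>x (\<sigma> j)\<bar>" for j
      by (auto simp: e_def abs_if mult_less_0_iff not_less)
    then have "W \<bullet> (P0 ** X ** Q0) = val \<sigma>"
      unfolding PXQ W_inner val_def by (simp add: dg_nth)
    then show "W \<bullet> (P ** X ** Q) \<le> W \<bullet> (P0 ** X ** Q0)" if "P \<in> unitary" "Q \<in> unitary" for P Q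
      using le [OF that] by simp
  qed
qed

section \<open>The dual seminorm and subgradients of convex functions\<close>

lemma unitary_nonempty: "(unitary :: (complex^'n^'n) set) \<noteq> {}"
  by (metis empty_iff unitary_mat1)

text \<open>By von Neumann's inequality this is the sum of the products of the singular values of
  \<open>W\<close> and \<open>A\<close>, both in decreasing order. The supremum form makes the
  triangle inequality immediate.\<close>

definition dual_seminorm :: "complex^'n^'n \<Rightarrow> complex^'n^'n \<Rightarrow> real" where
  "dual_seminorm W A = (SUP (P, Q) \<in> unitary \<times> unitary. W \<bullet> (P ** A ** Q))"

lemma dual_seminorm_upper:
  fixes A :: "complex^'n^'n"
  assumes "P \<in> unitary" "Q \<in> unitary"
  shows "W \<bullet> (P ** A ** Q) \<le> dual_seminorm W A"
proof -
  have "bdd_above ((\<lambda>(P, Q). W \<bullet> (P ** A ** Q)) ` (unitary \<times> unitary))"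
  proof (rule bdd_aboveI2)
    fix z :: "(complex^'n^'n) \<times> (complex^'n^'n)" assume z: "z \<in> unitary \<times> unitary"
    then show "(case z of (P, Q) \<Rightarrow> W \<bullet> (P ** A ** Q)) \<le> norm W * norm A"
      using norm_cauchy_schwarz [of W "fst z ** A ** snd z"] by (auto simp: split_beta)
  qed
  then show ?thesis
    unfolding dual_seminorm_def using assms by (intro cSUP_upper2 [of _ _ "(P, Q)"]) auto
qed

lemma dual_seminorm_least:
  fixes A :: "complex^'n^'n"
  assumes "\<And>P Q. P \<in> unitary \<Longrightarrow> Q \<in> unitary \<Longrightarrow> W \<bullet> (P ** A ** Q) \<le> c"
  shows "dual_seminorm W A \<le> c"
  unfolding dual_seminorm_def
  by (rule cSUP_least) (use assms unitary_nonempty in auto)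

text \<open>Invariance holds because the supremum runs over a group, and evenness because minus the
  identity belongs to it.\<close>

lemma ui_seminorm_dual: "ui_seminorm (dual_seminorm (W :: complex^'n^'n))"
proof
  fix A B :: "complex^'n^'n" and r :: real
  show "dual_seminorm W (A + B) \<le> dual_seminorm W A + dual_seminorm W B"
    by (rule dual_seminorm_least)
       (auto simp: matrix_add_ldistrib matrix_mult_add_left inner_add_right
          intro!: add_mono dual_seminorm_upper)
  have invle: "dual_seminorm W (P ** A ** Q) \<le> dual_seminorm W A"
    if "P \<in> unitary" "Q \<in> unitary" for P Q A
  proof (rule dual_seminorm_least)
    fix P' Q' :: "complex^'n^'n" assume *: "P' \<in> unitary" "Q' \<in> unitary"
    have "P' ** (P ** A ** Q) ** Q' = (P' ** P) ** A ** (Q ** Q')" by (simp only: matrix_mul_assoc)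
    then show "W \<bullet> (P' ** (P ** A ** Q) ** Q') \<le> dual_seminorm W A"
      using * that by (simp only: dual_seminorm_upper unitary_mult)
  qed
  then show inv: "dual_seminorm W (P ** A ** Q) = dual_seminorm W A"
    if "P \<in> unitary" "Q \<in> unitary" for P Q :: "complex^'n^'n" and A
  proof (intro antisym invle that)
    have "A = ct P ** (P ** A ** Q) ** ct Q"
      using that by (simp add: matrix_mul_assoc [symmetric])
    then show "dual_seminorm W A \<le> dual_seminorm W (P ** A ** Q)"
      using invle [OF unitary_ct unitary_ct, OF that, of "P ** A ** Q"] by simp
  qed
  have pos: "dual_seminorm W (r *\<^sub>R A) \<le> r * dual_seminorm W A" if "0 \<le> r" for r A
    by (rule dual_seminorm_least)
       (use that in \<open>auto simp: matrix_mult_scaleR_left matrix_mult_scaleR_right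
          intro!: mult_left_mono dual_seminorm_upper\<close>)
  have pos_eq: "dual_seminorm W (r *\<^sub>R A) = r * dual_seminorm W A" if "0 < r" for r A
    using pos [of r A] pos [of "1 / r" "r *\<^sub>R A"] that by (simp add: field_simps)
  have neg: "dual_seminorm W (- A) = dual_seminorm W A" for A
  proof -
    have "dg (\<lambda>_. -1) \<in> unitary" by (simp add: unitary_dg)
    moreover have "- A = dg (\<lambda>_. -1) ** A ** mat 1" by (simp add: vec_eq_iff)
    ultimately show ?thesis using inv [of "dg (\<lambda>_. -1)" "mat 1" A] by simp
  qed
  have zero: "dual_seminorm W 0 = 0"
    unfolding dual_seminorm_def by (simp add: split_beta unitary_nonempty cSUP_const)
  show "dual_seminorm W (r *\<^sub>R A) = \<bar>r\<bar> * dual_seminorm W A"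
  proof (cases "r = 0")
    case False
    then show ?thesis
      using pos_eq [of "\<bar>r\<bar>" A] neg [of "r *\<^sub>R A"] by (cases "r > 0") auto
  qed (simp add: zero)
qed

text \<open>A hyperplane separates the point \<open>(A0, L A0)\<close> from the strict epigraph. It
  is not vertical because \<open>L\<close> is finite everywhere, and its slope is the
  subgradient.\<close>

lemma convex_on_subgradient:
  fixes L :: "'a::euclidean_space \<Rightarrow> real"
  assumes L: "convex_on UNIV L"
  obtains W where "\<And>A. L A0 + W \<bullet> (A - A0) \<le> L A"
proof -
  define T where "T = {z. L (fst z) < snd z}"
  have "convex T"
  proof (rule convexI)
    fix y z :: "'a \<times> real" and u v :: real
    assume *: "y \<in> T" "z \<in> T" "0 \<le> u" "0 \<le> v" "u + v = 1"
    have "L (u *\<^sub>R fst y + v *\<^sub>R fst z) \<le> u * L (fst y) + v * L (fst z)"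
      using L * by (auto simp: convex_on_def)
    also have "\<dots> < u * snd y + v * snd z"
    proof (cases "u = 0")
      case False
      then show ?thesis using * by (intro add_less_le_mono mult_left_mono mult_strict_left_mono) (auto simp: T_def)
    qed (use * in \<open>auto simp: T_def\<close>)
    finally show "u *\<^sub>R y + v *\<^sub>R z \<in> T" by (simp add: T_def)
  qed
  moreover have "(A0, L A0 + 1) \<in> T" "(A0, L A0) \<notin> T" by (auto simp: T_def)
  ultimately have "\<exists>a c. a \<noteq> 0 \<and> (\<forall>z\<in>{(A0, L A0)}. a \<bullet> z \<le> c) \<and> (\<forall>z\<in>T. c \<le> a \<bullet> z)"
    by (intro separating_hyperplane_sets) auto
  then obtain u v c where uv: "(u, v) \<noteq> 0"
    and c: "(u, v) \<bullet> (A0, L A0) \<le> c" "\<And>z. z \<in> T \<Longrightarrow> c \<le> (u, v) \<bullet> z"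
    by (metis insertI1 surj_pair)
  then have le: "u \<bullet> A0 + v * L A0 \<le> u \<bullet> A + v * (L A + e)" if "0 < e" for A e
    using that c(1) c(2) [of "(A, L A + e)"] by (auto simp: T_def inner_prod_def)
  have "0 \<le> v" using le [of 1 A0] by (simp add: algebra_simps)
  moreover have "v \<noteq> 0"
  proof
    assume "v = 0"
    then have "u \<bullet> A0 \<le> u \<bullet> (A0 - u)" using le [of 1 "A0 - u"] by simp
    then have "u \<bullet> u \<le> 0" by (simp add: inner_diff_right)
    then have "u = 0" by (metis inner_gt_zero_iff not_less)
    with \<open>v = 0\<close> uv show False by (simp add: zero_prod_def)
  qed
  ultimately have v: "0 < v" by simp
  have "L A0 + (- (1 / v) *\<^sub>R u) \<bullet> (A - A0) \<le> L A" for A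
  proof (rule field_le_epsilon)
    fix e :: real assume "0 < e"
    from le [OF this, of A] show "L A0 + (- (1 / v) *\<^sub>R u) \<bullet> (A - A0) \<le> L A + e"
      using v by (simp add: inner_diff_right field_simps)
  qed
  then show thesis by (rule that)
qed

section \<open>Rigidity of the Frobenius length\<close>

lemma unit_inner_bounds:
  fixes x y :: "'a::real_inner"
  assumes "norm x = 1" "norm y = 1" shows "- 1 \<le> x \<bullet> y" "x \<bullet> y \<le> 1"
  using Cauchy_Schwarz_ineq2 [of x y] assms by auto

text \<open>Cauchy-Schwarz for the components of \<open>x\<close> and \<open>z\<close> orthogonal to
  \<open>y\<close> says that the inner product of \<open>x\<close> and \<open>z\<close> is at least
  the cosine of the sum of the two angles.\<close>

lemma arccos_triangle:
  fixes x y z :: "'a::real_inner"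
  assumes "norm x = 1" "norm y = 1" "norm z = 1"
  shows "arccos (x \<bullet> z) \<le> arccos (x \<bullet> y) + arccos (y \<bullet> z)"
proof -
  note bounds = unit_inner_bounds [OF assms(1,2)] unit_inner_bounds [OF assms(2,3)]
    unit_inner_bounds [OF assms(1,3)]
  define a where "a = x \<bullet> y"
  define b where "b = y \<bullet> z"
  have 1: "x \<bullet> x = 1" "y \<bullet> y = 1" "z \<bullet> z = 1" using assms by (simp_all add: norm_eq_1)
  have "(norm (x - a *\<^sub>R y))\<^sup>2 = 1 - a\<^sup>2" "(norm (z - b *\<^sub>R y))\<^sup>2 = 1 - b\<^sup>2"
    unfolding power2_norm_eq_inner using 1
    by (simp_all add: inner_diff_left inner_diff_right a_def b_def inner_commute power2_eq_square)
  then have "norm (x - a *\<^sub>R y) = sqrt (1 - a\<^sup>2)" "norm (z - b *\<^sub>R y) = sqrt (1 - b\<^sup>2)"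
    by (metis norm_ge_zero real_sqrt_unique)+
  then have "\<bar>(x - a *\<^sub>R y) \<bullet> (z - b *\<^sub>R y)\<bar> \<le> sqrt (1 - a\<^sup>2) * sqrt (1 - b\<^sup>2)"
    using Cauchy_Schwarz_ineq2 by metis
  moreover have "(x - a *\<^sub>R y) \<bullet> (z - b *\<^sub>R y) = x \<bullet> z - a * b"
    using 1 by (simp add: inner_diff_left inner_diff_right a_def b_def inner_commute)
  ultimately have "a * b - sqrt (1 - a\<^sup>2) * sqrt (1 - b\<^sup>2) \<le> x \<bullet> z" by linarith
  then have le: "cos (arccos a + arccos b) \<le> x \<bullet> z"
    using bounds by (simp add: cos_add sin_arccos a_def b_def)
  show ?thesis
  proof (cases "arccos a + arccos b \<le> pi")
    case True
    have "0 \<le> arccos a + arccos b"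
      using bounds by (intro add_nonneg_nonneg arccos_lbound) (auto simp: a_def b_def)
    then have "arccos (cos (arccos a + arccos b)) = arccos a + arccos b"
      using True by (intro arccos_cos) auto
    moreover have "arccos (x \<bullet> z) \<le> arccos (cos (arccos a + arccos b))"
      using le bounds by (intro arccos_le_arccos) auto
    ultimately show ?thesis by (simp add: a_def b_def)
  next
    case False
    then show ?thesis using arccos_ubound [OF bounds(5,6)] by (simp add: a_def b_def)
  qed
qed

text \<open>With \<open>h\<close> half the angle the chord is \<open>2 sin h\<close>, so the angle
  exceeds it by \<open>2 (h - sin h)\<close>, which is at most \<open>2 (1 - cos h)\<close> and
  hence at most \<open>h^2\<close>. The quadratic error is the form that
  \<open>increment_le_length\<close> asks for.\<close>

lemma arccos_inner_le_dist:
  fixes x y :: "'a::real_inner"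
  assumes "norm x = 1" "norm y = 1"
  shows "arccos (x \<bullet> y) \<le> norm (x - y) + (norm (x - y))\<^sup>2"
proof -
  note bounds = unit_inner_bounds [OF assms]
  define h where "h = arccos (x \<bullet> y) / 2"
  define d where "d = norm (x - y)"
  have h: "0 \<le> h" "h \<le> pi / 2"
    using arccos_lbound [OF bounds] arccos_ubound [OF bounds] by (simp_all add: h_def)
  have "d\<^sup>2 = 2 - 2 * cos (2 * h)"
    using assms bounds by (simp add: d_def h_def power2_norm_eq_inner inner_diff_left inner_diff_right
        inner_commute norm_eq_1)
  also have "\<dots> = (2 * sin h)\<^sup>2" by (simp add: cos_double_sin power_mult_distrib)
  finally have sq: "d\<^sup>2 = (2 * sin h)\<^sup>2" .
  have "0 \<le> sin h" using h pi_ge_zero by (intro sin_ge_zero) linarith+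
  then have d: "d = 2 * sin h"
    by (intro power2_eq_imp_eq [OF sq]) (simp_all add: d_def)
  have "h / 2 \<le> sin h" by (rule sin_ge_half [OF h])
  then have "h \<le> d" using d by simp
  have "1 - cos h \<le> h\<^sup>2 / 2"
  proof -
    have "sin (h / 2) \<le> h / 2" "0 \<le> sin (h / 2)"
      using h sin_x_le_x [of "h / 2"] pi_ge_zero by (auto intro!: sin_ge_zero)
    then have "(sin (h / 2))\<^sup>2 \<le> (h / 2)\<^sup>2" by (intro power_mono)
    then show ?thesis using cos_double_sin [of "h / 2"] by (simp add: power_divide)
  qed
  then have "2 * h - d \<le> h\<^sup>2" using diff_sin_le_one_minus_cos [OF h] d by simp
  also have "\<dots> \<le> d\<^sup>2" using h \<open>h \<le> d\<close> by (intro power_mono) auto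
  finally show ?thesis by (simp add: h_def d_def)
qed

text \<open>Distances on the real unit sphere between corresponding columns. They form a vector
  because its Euclidean norm matches the Frobenius norm, and because equality in the triangle
  inequality of \<open>real^'n\<close> yields a parameter common to all columns.\<close>

definition column_angles :: "complex^'n^'n \<Rightarrow> complex^'n^'n \<Rightarrow> real^'n" where
  "column_angles G H = (\<chi> j. arccos (column j G \<bullet> column j H))"

lemma norm_column_unitary: "G \<in> unitary \<Longrightarrow> norm (column j G) = 1"
  using unitary_col_sum [of G j] by (simp add: norm_vec_def L2_set_def column_def)

lemma norm_columns: "norm (\<chi> j. norm (column j A) :: real^'n) = norm (A :: complex^'n^'n)"
proof -
  have "(norm (\<chi> j. norm (column j A) :: real^'n))\<^sup>2 = (norm A)\<^sup>2"
    unfolding norm_matrix_sq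
    by (subst sum.swap) (simp add: norm_vec_def L2_set_def column_def sum_nonneg)
  then show ?thesis by (simp add: power2_eq_iff_nonneg)
qed

lemma column_diff: "column j (A - B) = column j A - column j B"
  by (simp add: column_def vec_eq_iff)

lemma column_angles_nonneg:
  assumes "G \<in> unitary" "H \<in> unitary" shows "0 \<le> column_angles G H $ j"
  using assms unfolding column_angles_def
  by (auto intro!: arccos_lbound unit_inner_bounds norm_column_unitary)

lemma column_angles_triangle:
  assumes "G \<in> unitary" "H \<in> unitary" "K \<in> unitary"
  shows "column_angles G K $ j \<le> column_angles G H $ j + column_angles H K $ j"
  using assms by (simp add: column_angles_def arccos_triangle norm_column_unitary)

lemma norm_column_angles_triangle:
  assumes "G \<in> unitary" "H \<in> unitary" "K \<in> unitary"
  shows "norm (column_angles G K) \<le> norm (column_angles G H) + norm (column_angles H K)"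
proof -
  have "norm (column_angles G K) \<le> norm (column_angles G H + column_angles H K)"
  proof (rule norm_le_componentwise_cart)
    show "norm (column_angles G K $ j) \<le> norm ((column_angles G H + column_angles H K) $ j)" for j
      using column_angles_nonneg [OF assms(1,3), of j] column_angles_triangle [OF assms, of j] by simp
  qed
  then show ?thesis using norm_triangle_ineq order_trans by blast
qed

lemma norm_column_angles_le:
  fixes G H :: "complex^'n^'n"
  assumes "G \<in> unitary" "H \<in> unitary"
  shows "norm (column_angles G H) \<le> norm (H - G) + (norm (H - G))\<^sup>2"
proof -
  define d where "d j = norm (column j (H - G))" for j
  have "norm (column_angles G H) \<le> norm ((\<chi> j. d j) + (\<chi> j. (d j)\<^sup>2) :: real^'n)"
  proof (rule norm_le_componentwise_cart)
    fix j
    have "column_angles G H $ j \<le> d j + (d j)\<^sup>2"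
      using arccos_inner_le_dist [of "column j G" "column j H"] assms
      by (simp add: column_angles_def d_def column_diff norm_column_unitary norm_minus_commute)
    then show "norm (column_angles G H $ j) \<le> norm (((\<chi> j. d j) + (\<chi> j. (d j)\<^sup>2) :: real^'n) $ j)"
      using column_angles_nonneg [OF assms] by simp
  qed
  also have "\<dots> \<le> norm (\<chi> j. d j :: real^'n) + norm (\<chi> j. (d j)\<^sup>2 :: real^'n)"
    by (rule norm_triangle_ineq)
  also have "norm (\<chi> j. (d j)\<^sup>2 :: real^'n) \<le> (\<Sum>j\<in>UNIV. (d j)\<^sup>2)"
    using norm_le_l1_cart [of "\<chi> j. (d j)\<^sup>2"] by simp
  also have "(\<Sum>j\<in>UNIV. (d j)\<^sup>2) = (norm (\<chi> j. d j :: real^'n))\<^sup>2"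
    by (simp add: norm_vec_def L2_set_def sum_nonneg)
  also have "norm (\<chi> j. d j :: real^'n) = norm (H - G)"
    unfolding d_def by (rule norm_columns)
  finally show ?thesis by simp
qed

lemma column_angles_self: "G \<in> unitary \<Longrightarrow> column_angles G G = 0"
  using norm_column_unitary [of G] by (simp add: column_angles_def vec_eq_iff norm_eq_1)

lemma column_angles_le_length:
  fixes f :: "real \<Rightarrow> complex^'n^'n"
  assumes f: "piecewise_C1 b f" "\<And>t. t \<in> {0..b} \<Longrightarrow> f t \<in> unitary"
    and Q: "Q \<in> unitary" and ac: "0 \<le> a" "a \<le> c" "c \<le> b"
  shows "norm (column_angles (f a ** Q) (f c ** Q)) \<le> integral {a..c} (\<lambda>t. norm (curve_deriv b f t))"
proof -
  have fa: "f a ** Q \<in> unitary" using f(2) Q ac by (intro unitary_mult) auto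
  define F where "F G = norm (column_angles (f a ** Q) (G ** Q))" for G :: "complex^'n^'n"
  have step: "F H \<le> F G + norm (H - G) + 1 * (norm (H - G))\<^sup>2" if "G \<in> unitary" "H \<in> unitary" for G H
  proof -
    have u: "G ** Q \<in> unitary" "H ** Q \<in> unitary" using that Q by (auto intro: unitary_mult)
    have "norm (H ** Q - G ** Q) = norm (H - G)"
      using Q by (simp flip: matrix_mult_diff_left)
    then show ?thesis
      using norm_column_angles_triangle [OF fa u] norm_column_angles_le [OF u] by (simp add: F_def)
  qed
  have "continuous_on unitary F"
    unfolding continuous_on_iff
  proof (intro ballI allI impI)
    fix G :: "complex^'n^'n" and e :: real
    assume G: "G \<in> unitary" and e: "0 < e"
    have "dist (F H) (F G) < e" if "H \<in> unitary" "dist H G < min 1 (e / 2)" for H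
    proof -
      have d: "norm (H - G) < 1" "norm (H - G) < e / 2" using that(2) by (simp_all add: dist_norm)
      have "(norm (H - G))\<^sup>2 \<le> norm (H - G)"
        using d(1) by (simp add: power2_eq_square mult_left_le)
      then show ?thesis
        using step [OF G that(1)] step [OF that(1) G] d(2)
        by (simp add: dist_real_def norm_minus_commute [of G H])
    qed
    then show "\<exists>d>0. \<forall>H\<in>unitary. dist H G < d \<longrightarrow> dist (F H) (F G) < e"
      using e by (intro exI [of _ "min 1 (e / 2)"]) auto
  qed
  then have "F (f c) - F (f a) \<le> integral {a..c} (\<lambda>t. norm (curve_deriv b f t))"
  proof (intro increment_le_length [OF f(1), where S = unitary])
    show "\<exists>C. \<forall>H\<in>unitary. F H \<le> F G + norm (H - G) + C * (norm (H - G))\<^sup>2" if "G \<in> unitary" for G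
      using step [OF that] by blast
  qed (use f ac in \<open>auto intro: continuous_on_norm_id\<close>)
  then show ?thesis using fa by (simp add: F_def column_angles_self)
qed

lemma Re_inner_cis: "u \<bullet> (cis x *s u) = cos x * (u \<bullet> (u :: complex^'n))"
  by (simp add: inner_vec_def inner_complex_def sum_distrib_left algebra_simps sum.distrib
      sum_subtractf power2_eq_square)

lemma norm_cis_smult: "norm (cis x *s u) = norm (u :: complex^'n)"
  by (simp add: norm_vec_def L2_set_def norm_mult)

text \<open>For \<open>x\<close> not 0, the point \<open>m\<close> at parameter \<open>s\<close> of
  the arc is a combination of the end points with coefficients
  \<open>sin ((1 - s) x) / sin x\<close> and \<open>sin (s x) / sin x\<close>. The two given inner
  products therefore determine that of \<open>m\<close> with \<open>c\<close>, and it is 1. Dividing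
  by \<open>sin x\<close> is what excludes antipodal end points.\<close>

lemma sphere_point_between:
  fixes u c :: "complex^'n"
  assumes u: "norm u = 1" and c: "norm c = 1" and x: "\<bar>x\<bar> < pi"
    and uc: "u \<bullet> c = cos (s * x)" and cv: "c \<bullet> (cis x *s u) = cos ((1 - s) * x)"
  shows "c = cis (s * x) *s u"
proof -
  define m where "m = cis (s * x) *s u"
  have m: "norm m = 1" using u by (simp add: m_def norm_cis_smult)
  have "m \<bullet> c = 1"
  proof (cases "x = 0")
    case True
    then show ?thesis using uc by (simp add: m_def)
  next
    case False
    then have sin: "sin x \<noteq> 0" using x by (metis abs_less_iff neg_less_iff_less sin_zero_pi_iff)
    have "sin x * cos (s * x) = sin (x - s * x) + sin (s * x) * cos x"
      by (simp add: sin_diff)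
    then have "of_real (sin x) * cis (s * x) = of_real (sin ((1 - s) * x)) + of_real (sin (s * x)) * cis x"
      by (simp add: complex_eq_iff algebra_simps)
    then have comb: "sin x *\<^sub>R m = sin ((1 - s) * x) *\<^sub>R u + sin (s * x) *\<^sub>R (cis x *s u)"
      by (simp add: m_def vec_eq_iff scaleR_conv_of_real [where 'a = complex] mult.assoc [symmetric]
          distrib_right [symmetric])
    have "sin x * (m \<bullet> c) = sin ((1 - s) * x) * (u \<bullet> c) + sin (s * x) * (c \<bullet> (cis x *s u))"
      using arg_cong [OF comb, of "\<lambda>v. v \<bullet> c"] by (simp add: inner_add_left inner_commute [of c])
    also have "\<dots> = sin ((1 - s) * x + s * x)"
      by (simp add: uc cv sin_add)
    finally show ?thesis using sin by (simp add: algebra_simps)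
  qed
  then have "(norm (c - m))\<^sup>2 = 0"
    using m c by (simp add: power2_norm_eq_inner inner_diff_left inner_diff_right inner_commute norm_eq_1)
  then show ?thesis by (simp add: m_def)
qed

lemma abs_le_norm_eq_imp_eq:
  fixes v w :: "real^'n"
  assumes "\<And>j. 0 \<le> v $ j" "\<And>j. v $ j \<le> w $ j" "norm w \<le> norm v"
  shows "v = w"
proof -
  have "(norm w)\<^sup>2 \<le> (norm v)\<^sup>2" using assms(3) by (intro power_mono) auto
  then have "(\<Sum>j\<in>UNIV. (w $ j)\<^sup>2 - (v $ j)\<^sup>2) \<le> 0"
    by (simp add: norm_vec_def L2_set_def sum_nonneg sum_subtractf)
  moreover have nn: "0 \<le> (w $ j)\<^sup>2 - (v $ j)\<^sup>2" for j
    using assms(1,2) [of j] by (simp add: power_mono)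
  ultimately have "(\<Sum>j\<in>UNIV. (w $ j)\<^sup>2 - (v $ j)\<^sup>2) = 0"
    by (intro antisym sum_nonneg) auto
  then have "(w $ j)\<^sup>2 = (v $ j)\<^sup>2" for j
    using nn by (simp add: sum_nonneg_eq_0_iff)
  then have "w $ j = v $ j" for j
    using order_trans [OF assms(1,2), of j] assms(1) [of j] by (rule power2_eq_imp_eq)
  then show ?thesis by (simp add: vec_eq_iff)
qed

lemma mono_continuous_onto_interval:
  fixes \<tau> :: "real \<Rightarrow> real"
  assumes "0 \<le> b" "continuous_on {0..b} \<tau>" "mono_on {0..b} \<tau>" "\<tau> 0 = 0" "\<tau> b = b"
  shows "\<tau> ` {0..b} = {0..b}"
proof
  show "\<tau> ` {0..b} \<subseteq> {0..b}"
  proof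
    fix s assume "s \<in> \<tau> ` {0..b}"
    then obtain t where t: "0 \<le> t" "t \<le> b" "s = \<tau> t" by auto
    then show "s \<in> {0..b}"
      using mono_onD [OF assms(3), of 0 t] mono_onD [OF assms(3), of t b] assms by simp
  qed
  show "{0..b} \<subseteq> \<tau> ` {0..b}"
    using IVT' [of \<tau> 0 _ b] assms by force
qed

text \<open>The columns of \<open>f t ** Q\<close> run on spheres from \<open>u j\<close> to
  \<open>cis (x j) *s u j\<close>. The angle vectors travelled before and after time
  \<open>t\<close> add up to at least \<open>z\<close> in every component, while their norms add up
  to at most \<open>norm z\<close>; this forces equality everywhere.\<close>

theorem frobenius_minimizer_reparametrizes:
  fixes f :: "real \<Rightarrow> complex^'n^'n"
  assumes b: "0 < b" and f: "piecewise_C1 b f" "\<And>t. t \<in> {0..b} \<Longrightarrow> f t \<in> unitary"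
    and Q: "Q \<in> unitary" and x: "\<And>j. \<bar>x j\<bar> < pi"
    and ends: "f b = f 0 ** (Q ** dg (\<lambda>j. cis (x j)) ** ct Q)"
    and short: "integral {0..b} (\<lambda>t. norm (curve_deriv b f t)) \<le> norm (\<chi> j. x j :: real^'n)"
  shows "reparametrization b (\<lambda>t. f 0 ** (Q ** dg (\<lambda>j. cis (t / b * x j)) ** ct Q)) f"
proof -
  define z :: "real^'n" where "z = (\<chi> j. \<bar>x j\<bar>)"
  have normz: "norm (\<chi> j. x j :: real^'n) = norm z"
    by (simp add: z_def norm_vec_def L2_set_def)
  have int: "(\<lambda>t. norm (curve_deriv b f t)) integrable_on {0..b}"
    using piecewise_C1_derivative [OF f(1)] continuous_on_norm_id by metis
  define \<rho> where "\<rho> t = integral {0..t} (\<lambda>t. norm (curve_deriv b f t))" for t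
  have sub: "(\<lambda>t. norm (curve_deriv b f t)) integrable_on {u..v}" if "0 \<le> u" "v \<le> b" for u v
    using that by (intro integrable_on_subinterval [OF int]) auto
  have \<rho>: "integral {u..v} (\<lambda>t. norm (curve_deriv b f t)) = \<rho> v - \<rho> u" if "0 \<le> u" "u \<le> v" "v \<le> b" for u v
    using Henstock_Kurzweil_Integration.integral_combine [of 0 u v "\<lambda>t. norm (curve_deriv b f t)"] that sub
    by (simp add: \<rho>_def)
  have \<rho>_mono: "\<rho> u \<le> \<rho> v" if "0 \<le> u" "u \<le> v" "v \<le> b" for u v
    using integral_nonneg [OF sub, of u v] that \<rho> [OF that] by simp
  have \<rho>0: "\<rho> 0 = 0" by (simp add: \<rho>_def)
  have \<rho>b: "\<rho> b \<le> norm z" using short by (simp add: \<rho>_def normz)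
  have fQ: "f t ** Q \<in> unitary" if "t \<in> {0..b}" for t
    using f(2) [OF that] Q by (rule unitary_mult)
  define u where "u j = column j (f 0 ** Q)" for j
  have u: "norm (u j) = 1" for j unfolding u_def using fQ b by (intro norm_column_unitary) auto
  have "f b ** Q = f 0 ** Q ** dg (\<lambda>j. cis (x j))"
  proof -
    have "f b ** Q = f 0 ** Q ** dg (\<lambda>j. cis (x j)) ** (ct Q ** Q)"
      unfolding ends by (simp only: matrix_mul_assoc)
    then show ?thesis using Q by simp
  qed
  then have v: "column j (f b ** Q) = cis (x j) *s u j" for j
    by (simp add: column_def u_def vec_eq_iff mult.commute)
  have full: "column_angles (f 0 ** Q) (f b ** Q) = z"
  proof -
    have "arccos (cos (x j)) = \<bar>x j\<bar>" for j
      using x [of j] by (cases "0 \<le> x j") (auto simp: arccos_cos arccos_cos2)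
    then show ?thesis
      using u by (simp add: column_angles_def z_def vec_eq_iff v Re_inner_cis norm_eq_1 flip: u_def)
  qed
  \<comment> \<open>Equality in the Euclidean triangle inequality makes \<open>?d\<close> and
    \<open>?e\<close> parallel, so that \<open>?d\<close> is the fraction
    \<open>\<rho> t / norm z\<close> of \<open>z\<close>; the division is avoided to include
    \<open>z = 0\<close>.\<close>
  have key: "\<rho> t *\<^sub>R z = norm z *\<^sub>R column_angles (f 0 ** Q) (f t ** Q) \<and>
      column_angles (f 0 ** Q) (f t ** Q) + column_angles (f t ** Q) (f b ** Q) = z \<and>
      \<rho> b = norm z"
    if t: "t \<in> {0..b}" for t
  proof -
    let ?d = "column_angles (f 0 ** Q) (f t ** Q)" and ?e = "column_angles (f t ** Q) (f b ** Q)"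
    have un: "f 0 ** Q \<in> unitary" "f t ** Q \<in> unitary" "f b ** Q \<in> unitary"
      using fQ t b by auto
    have d: "norm ?d \<le> \<rho> t"
      using column_angles_le_length [OF f Q, of 0 t] t by (simp add: \<rho>_def)
    have e: "norm ?e \<le> \<rho> b - \<rho> t"
      using column_angles_le_length [OF f Q, of t b] t \<rho> [of t b] by simp
    have "z = ?d + ?e"
    proof (rule abs_le_norm_eq_imp_eq)
      show "0 \<le> z $ j" for j by (simp add: z_def)
      show "z $ j \<le> (?d + ?e) $ j" for j
        using column_angles_triangle [OF un, of j] by (simp add: full)
      show "norm (?d + ?e) \<le> norm z"
        using norm_triangle_ineq [of ?d ?e] d e \<rho>b by linarith
    qed
    moreover from this have eqs: "norm ?d = \<rho> t" "norm ?e = \<rho> b - \<rho> t" "\<rho> b = norm z"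
      using norm_triangle_ineq [of ?d ?e] d e \<rho>b by simp_all
    moreover from calculation have "norm ?d *\<^sub>R ?e = norm ?e *\<^sub>R ?d"
      using norm_triangle_eq [of ?d ?e] by simp
    then have "\<rho> t *\<^sub>R ?e = (norm z - \<rho> t) *\<^sub>R ?d" using eqs by simp
    then have "\<rho> t *\<^sub>R (?d + ?e) = norm z *\<^sub>R ?d" by (simp add: algebra_simps)
    ultimately show ?thesis by simp
  qed
  have point: "f t = f 0 ** (Q ** dg (\<lambda>j. cis (s * x j)) ** ct Q)"
    if t: "t \<in> {0..b}" and s: "column_angles (f 0 ** Q) (f t ** Q) = s *\<^sub>R z" for t s
  proof -
    have e: "column_angles (f t ** Q) (f b ** Q) = (1 - s) *\<^sub>R z"
      using key [OF t] s by (simp add: algebra_simps eq_diff_eq)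
    have un: "norm (column j (f t ** Q)) = 1" for j using fQ t by (intro norm_column_unitary)
    have cabs: "cos (r * \<bar>y\<bar>) = cos (r * y)" for r y :: real by (cases "0 \<le> y") auto
    have "column j (f t ** Q) = cis (s * x j) *s u j" for j
    proof (rule sphere_point_between [OF u un x])
      have "arccos (u j \<bullet> column j (f t ** Q)) = s * \<bar>x j\<bar>"
        using arg_cong [OF s, of "\<lambda>v. v $ j"] by (simp add: column_angles_def z_def u_def)
      then show "u j \<bullet> column j (f t ** Q) = cos (s * x j)"
        using unit_inner_bounds [OF u un] cabs by (metis cos_arccos)
      have "arccos (column j (f t ** Q) \<bullet> (cis (x j) *s u j)) = (1 - s) * \<bar>x j\<bar>"
        using arg_cong [OF e, of "\<lambda>v. v $ j"] by (simp add: column_angles_def z_def v)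
      moreover have "norm (cis (x j) *s u j) = 1" using u by (simp add: norm_cis_smult)
      ultimately show "column j (f t ** Q) \<bullet> (cis (x j) *s u j) = cos ((1 - s) * x j)"
        using unit_inner_bounds [OF un] cabs by (metis cos_arccos)
    qed
    then have "(f t ** Q) $ i $ j = (f 0 ** Q ** dg (\<lambda>j. cis (s * x j))) $ i $ j" for i j
      by (simp add: column_def u_def vec_eq_iff mult.commute)
    then have "f t ** Q = f 0 ** Q ** dg (\<lambda>j. cis (s * x j))" by (rule matrix_eqI)
    then have "f t ** (Q ** ct Q) = f 0 ** (Q ** dg (\<lambda>j. cis (s * x j)) ** ct Q)"
      by (simp only: matrix_mul_assoc)
    then show ?thesis using Q by simp
  qed
  show ?thesis
  proof (cases "norm z = 0")
    \<comment> \<open>The curve is constant here, so the identity serves as the parameter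
      change.\<close>
    case True
    then have "column_angles (f 0 ** Q) (f t ** Q) = (t / b) *\<^sub>R z" if t: "t \<in> {0..b}" for t
    proof -
      have "norm (column_angles (f 0 ** Q) (f t ** Q)) \<le> \<rho> t"
        using column_angles_le_length [OF f Q, of 0 t] t by (simp add: \<rho>_def)
      also have "\<rho> t \<le> \<rho> b" using \<rho>_mono t by simp
      finally have "norm (column_angles (f 0 ** Q) (f t ** Q)) \<le> 0"
        using \<rho>b True by linarith
      then show ?thesis using True by simp
    qed
    then have *: "\<forall>t\<in>{0..b}. f t = f 0 ** (Q ** dg (\<lambda>j. cis (t / b * x j)) ** ct Q)"
      using point by blast
    show ?thesis
      unfolding reparametrization_def
      by (rule exI [of _ "\<lambda>t. t"], intro conjI *) (auto intro: mono_onI)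
  next
    case False
    \<comment> \<open>Frobenius arc length, rescaled to send \<open>b\<close> to
      \<open>b\<close>.\<close>
    define \<tau> where "\<tau> t = b * \<rho> t / norm z" for t
    have "continuous_on {0..b} \<rho>"
      unfolding \<rho>_def by (rule indefinite_integral_continuous_1 [OF int])
    then have cont: "continuous_on {0..b} \<tau>"
      unfolding \<tau>_def using False by (intro continuous_intros) auto
    have mono: "mono_on {0..b} \<tau>"
      unfolding \<tau>_def using \<rho>_mono b
      by (intro mono_onI divide_right_mono mult_left_mono) auto
    have "\<tau> 0 = 0" "\<tau> b = b"
      using \<rho>0 key [of b] b False by (simp_all add: \<tau>_def)
    then have "\<tau> ` {0..b} = {0..b}"
      using b cont mono by (intro mono_continuous_onto_interval) auto
    moreover have "f t = f 0 ** (Q ** dg (\<lambda>j. cis (\<tau> t / b * x j)) ** ct Q)" if t: "t \<in> {0..b}" for t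
    proof (rule point [OF t])
      have "norm z *\<^sub>R column_angles (f 0 ** Q) (f t ** Q) = norm z *\<^sub>R ((\<tau> t / b) *\<^sub>R z)"
        using key [OF t] b False by (simp add: \<tau>_def)
      then show "column_angles (f 0 ** Q) (f t ** Q) = (\<tau> t / b) *\<^sub>R z"
        unfolding scaleR_cancel_left using False by simp
    qed
    ultimately show ?thesis
      using cont mono unfolding reparametrization_def by blast
  qed
qed

section \<open>Minimizers of the action\<close>

lemma has_vector_derivative_vecI:
  fixes f :: "real \<Rightarrow> ('a::real_normed_vector)^'n"
  assumes "\<And>i. ((\<lambda>t. f t $ i) has_vector_derivative f' $ i) (at x within S)"
  shows "(f has_vector_derivative f') (at x within S)"
  using assms unfolding has_vector_derivative_def has_derivative_within
  by (intro conjI bounded_linear_scaleR_left vec_tendstoI) simp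

lemma cis_has_vector_derivative:
  "((\<lambda>t. cis (t * r)) has_vector_derivative (\<i> * of_real r * cis (x * r))) (at x within S)"
proof -
  have "((\<lambda>t. cos (t * r) *\<^sub>R 1 + sin (t * r) *\<^sub>R \<i>) has_vector_derivative
      (- sin (x * r) * r) *\<^sub>R 1 + (cos (x * r) * r) *\<^sub>R \<i>) (at x within S)"
    by (auto intro!: derivative_eq_intros)
  moreover have "cos (t * r) *\<^sub>R 1 + sin (t * r) *\<^sub>R \<i> = cis (t * r)" for t
    by (simp add: complex_eq_iff)
  moreover have "(- sin (x * r) * r) *\<^sub>R 1 + (cos (x * r) * r) *\<^sub>R \<i> = \<i> * of_real r * cis (x * r)"
    by (simp add: complex_eq_iff)
  ultimately show ?thesis by simp
qed

lemma conj_cis_has_vector_derivative: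
  fixes P Q :: "complex^'n^'n"
  shows "((\<lambda>t. P ** dg (\<lambda>j. cis (t * x j)) ** Q) has_vector_derivative
     P ** dg (\<lambda>j. \<i> * of_real (x j) * cis (t * x j)) ** Q) (at t within S)"
proof (intro has_vector_derivative_vecI)
  fix r s
  have "((\<lambda>t. \<Sum>j\<in>UNIV. P $ r $ j * cis (t * x j) * Q $ j $ s) has_vector_derivative
      (\<Sum>j\<in>UNIV. P $ r $ j * (\<i> * of_real (x j) * cis (t * x j)) * Q $ j $ s)) (at t within S)"
    by (intro has_vector_derivative_sum has_vector_derivative_mult_left
        has_vector_derivative_mult_right cis_has_vector_derivative)
  then show "((\<lambda>t. (P ** dg (\<lambda>j. cis (t * x j)) ** Q) $ r $ s) has_vector_derivative
      (P ** dg (\<lambda>j. \<i> * of_real (x j) * cis (t * x j)) ** Q) $ r $ s) (at t within S)"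
    by (simp add: matrix_mult_nth [of "P ** _"])
qed

text \<open>Differentiating \<open>ct (f s) ** f s = mat 1\<close> shows that
  \<open>ct (f t) ** D\<close> is skew-Hermitian. The factor i that relates it to a Hermitian matrix
  is absorbed into \<open>P\<close>, since unitary factors are invisible to \<open>L\<close>,
  \<open>N\<close> and the Frobenius norm.\<close>

lemma unitary_curve_tangent:
  fixes f :: "real \<Rightarrow> complex^'n^'n"
  assumes f: "\<And>s. 0 < s \<Longrightarrow> s < b \<Longrightarrow> f s \<in> unitary" and t: "0 < t" "t < b"
    and D: "(f has_vector_derivative D) (at t)"
  obtains P X where "P \<in> unitary" "X \<in> hermitian" "D = P ** X"
proof -
  have ft: "f t \<in> unitary" using f t by blast
  have "((\<lambda>s. ct (f s)) has_vector_derivative ct D) (at t)"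
    using bounded_linear.has_vector_derivative [OF bounded_linear_ct D] .
  then have "((\<lambda>s. ct (f s) ** f s) has_vector_derivative (ct (f t) ** D + ct D ** f t)) (at t)"
    using bounded_bilinear.has_vector_derivative [OF bounded_bilinear_matrix_mult _ D] by blast
  moreover have "((\<lambda>s. ct (f s) ** f s) has_vector_derivative 0) (at t)"
    by (rule has_vector_derivative_transform_within_open [of "\<lambda>_. mat 1" _ _ "{0<..<b}"])
       (use f t in auto)
  ultimately have skew: "ct (f t) ** D + ct D ** f t = 0"
    by (rule vector_derivative_unique_at)
  define X where "X = dg (\<lambda>_. -\<i>) ** (ct (f t) ** D)"
  have "ct (ct (f t) ** D) = - (ct (f t) ** D)"
    using skew by (simp add: ct_mult eq_neg_iff_add_eq_0 add.commute)
  then have "cnj ((ct (f t) ** D) $ j $ i) = - (ct (f t) ** D) $ i $ j" for i j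
    by (metis ct_nth vector_uminus_component)
  then have "X \<in> hermitian"
    unfolding hermitian_iff X_def by (intro matrix_eqI) simp
  moreover have "f t ** dg (\<lambda>_. \<i>) \<in> unitary"
    by (intro unitary_mult ft) (simp add: unitary_dg)
  moreover have "D = f t ** dg (\<lambda>_. \<i>) ** X"
  proof -
    have "f t ** dg (\<lambda>_. \<i>) ** X = f t ** (dg (\<lambda>_. \<i>) ** dg (\<lambda>_. -\<i>)) ** (ct (f t) ** D)"
      by (simp only: X_def matrix_mul_assoc)
    also have "\<dots> = D" using ft by (simp add: dg_mult flip: mat1_dg)
    finally show ?thesis ..
  qed
  ultimately show thesis using that by blast
qed

lemma geodesic_joining_curve:
  fixes U Q :: "complex^'n^'n" and x :: "'n \<Rightarrow> real"
  assumes b: "0 < b" and U: "U \<in> unitary" and Q: "Q \<in> unitary"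
  defines "g \<equiv> \<lambda>t. U ** (Q ** dg (\<lambda>j. cis (t / b * x j)) ** ct Q)"
  shows "joining_curve b U (U ** (Q ** dg (\<lambda>j. cis (x j)) ** ct Q)) g"
    and "\<And>t. t \<in> {0..b} \<Longrightarrow> \<exists>P\<in>unitary. vector_derivative g (at t within {0..b}) =
      P ** ((1 / b) *\<^sub>R (Q ** dg (\<lambda>j. of_real (x j)) ** ct Q))"
proof -
  have g: "g = (\<lambda>t. (U ** Q) ** dg (\<lambda>j. cis (t * (x j / b))) ** ct Q)"
    unfolding g_def by (simp add: matrix_mul_assoc)
  define g' where "g' t = (U ** Q) ** dg (\<lambda>j. \<i> * of_real (x j / b) * cis (t * (x j / b))) ** ct Q" for t
  have der: "(g has_vector_derivative g' t) (at t within S)" for t S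
    unfolding g g'_def by (rule conj_cis_has_vector_derivative)
  have "continuous_on S (\<lambda>t. dg (\<lambda>j. \<i> * of_real (x j / b) * cis (t * (x j / b))) :: complex^'n^'n)" for S
    unfolding dg_def
  proof (intro continuous_on_vec_lambda)
    show "continuous_on S (\<lambda>t. if i = j then \<i> * of_real (x i / b) * cis (t * (x i / b)) else 0)" for i j
    proof (cases "i = j")
      case True
      then show ?thesis
        by (simp only: if_True simp_thms)
           (intro continuous_on_const continuous_on_mult continuous_on_cis continuous_on_id)
    qed simp
  qed
  then have "continuous_on S g'" for S
    unfolding g'_def
    by (intro bounded_bilinear.continuous_on [OF bounded_bilinear_matrix_mult] continuous_on_const)
  then have "C1_on_interval 0 b g"
    unfolding C1_on_interval_def using der by blast
  then have "piecewise_C1 b g"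
    unfolding piecewise_C1_def using b der
    by (intro conjI exI [of _ 1] exI [of _ "\<lambda>i. if i = 0 then 0 else b"])
       (auto intro: has_vector_derivative_continuous simp: continuous_on_eq_continuous_within)
  moreover have "g t \<in> unitary" for t
    unfolding g_def using U Q by (intro unitary_mult unitary_ct) (auto simp: unitary_dg)
  moreover have "g 0 = U" using Q by (simp add: g_def conj_mat1)
  moreover have "g b = U ** (Q ** dg (\<lambda>j. cis (x j)) ** ct Q)" using b by (simp add: g_def)
  ultimately show "joining_curve b U (U ** (Q ** dg (\<lambda>j. cis (x j)) ** ct Q)) g"
    unfolding joining_curve_def by blast
  fix t assume t: "t \<in> {0..b}"
  define P where "P = U ** Q ** dg (\<lambda>j. \<i> * cis (t * (x j / b))) ** ct Q"
  have "P \<in> unitary"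
    unfolding P_def using U Q
    by (intro unitary_mult unitary_ct) (auto simp: unitary_dg norm_mult)
  moreover have "g' t = P ** ((1 / b) *\<^sub>R (Q ** dg (\<lambda>j. of_real (x j)) ** ct Q))"
  proof -
    have "P ** ((1 / b) *\<^sub>R (Q ** dg (\<lambda>j. of_real (x j)) ** ct Q))
        = (1 / b) *\<^sub>R ((U ** Q) ** (dg (\<lambda>j. \<i> * cis (t * (x j / b))) ** (ct Q ** Q) ** dg (\<lambda>j. of_real (x j))) ** ct Q)"
      by (simp only: P_def matrix_mult_scaleR_right matrix_mul_assoc)
    also have "\<dots> = (U ** Q) ** ((1 / b) *\<^sub>R dg (\<lambda>j. \<i> * cis (t * (x j / b)) * of_real (x j))) ** ct Q"
      using Q by (simp add: dg_mult matrix_mult_scaleR_right matrix_mult_scaleR_left)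
    also have "(1 / b) *\<^sub>R dg (\<lambda>j. \<i> * cis (t * (x j / b)) * of_real (x j))
        = dg (\<lambda>j. \<i> * of_real (x j / b) * cis (t * (x j / b)))"
      by (rule matrix_eqI) (simp add: dg_nth scaleR_conv_of_real [where 'a = complex])
    finally show ?thesis by (simp add: g'_def)
  qed
  moreover have "vector_derivative g (at t within {0..b}) = g' t"
    using b t by (intro vector_derivative_within_cbox [of 0 b, simplified] der) auto
  ultimately show "\<exists>P\<in>unitary. vector_derivative g (at t within {0..b}) =
      P ** ((1 / b) *\<^sub>R (Q ** dg (\<lambda>j. of_real (x j)) ** ct Q))" by metis
qed

text \<open>The Hermitian part of a subgradient has the same pairing with Hermitian matrices. A
  maximizer of this pairing on the two-sided orbit of \<open>A\<close> can be chosen Hermitian;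
  \<open>L\<close> has the same value there as at \<open>A\<close>, so the subgradient inequality
  makes \<open>A\<close> itself a maximizer.\<close>

lemma lagrangian_support:
  fixes L :: "complex^'n^'n \<Rightarrow> real"
  assumes L: "symmetric_lagrangian L" and A: "A \<in> hermitian"
  obtains W where "W \<in> hermitian" "W \<bullet> A = dual_seminorm W A"
    "\<And>B. B \<in> hermitian \<Longrightarrow> L A + (W \<bullet> B - W \<bullet> A) \<le> L B"
proof -
  have conv: "convex_on UNIV L" and inv: "\<And>A U V. U \<in> unitary \<Longrightarrow> V \<in> unitary \<Longrightarrow> L (U ** A ** V) = L A"
    using L by (auto simp: symmetric_lagrangian_def)
  obtain S where S: "\<And>B. L A + S \<bullet> (B - A) \<le> L B"
    using convex_on_subgradient [OF conv] by blast
  define W where "W = (1 / 2) *\<^sub>R (S + ct S)"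
  have "W \<in> hermitian"
    unfolding hermitian_iff W_def by (rule matrix_eqI) simp
  moreover have WS: "W \<bullet> B = S \<bullet> B" if "B \<in> hermitian" for B
    using that inner_ct [of S B] by (simp add: W_def inner_add_left hermitian_iff)
  ultimately have le: "L A + (W \<bullet> B - W \<bullet> A) \<le> L B" if "B \<in> hermitian" for B
    using S [of B] that A by (simp add: inner_diff_right)
  obtain P Q where PQ: "P \<in> unitary" "Q \<in> unitary" "P ** A ** Q \<in> hermitian"
    "\<And>P' Q'. P' \<in> unitary \<Longrightarrow> Q' \<in> unitary \<Longrightarrow> W \<bullet> (P' ** A ** Q') \<le> W \<bullet> (P ** A ** Q)"
    using hermitian_trace_maximizer [OF \<open>W \<in> hermitian\<close> A] by metis
  have "dual_seminorm W A \<le> W \<bullet> (P ** A ** Q)" by (rule dual_seminorm_least) (rule PQ(4))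
  also have "\<dots> \<le> W \<bullet> A" using le [OF PQ(3)] inv [OF PQ(1,2)] by simp
  finally have "W \<bullet> A = dual_seminorm W A"
    using dual_seminorm_upper [of "mat 1" "mat 1" W A] by simp
  then show thesis using that \<open>W \<in> hermitian\<close> le by blast
qed

text \<open>In the case of equality \<open>L\<close> is affine on a segment from \<open>A\<close> to a Hermitian matrix in the
  two-sided unitary orbit of \<open>X\<close>, so nondegeneracy puts the two on one ray.\<close>

lemma lagrangian_contact:
  fixes L :: "complex^'n^'n \<Rightarrow> real"
  assumes L: "symmetric_lagrangian L" "nondegenerate_lagrangian L"
    and A: "A \<in> hermitian" and W: "W \<in> hermitian" "W \<bullet> A = dual_seminorm W A"
    and supp: "\<And>B. B \<in> hermitian \<Longrightarrow> L A + (W \<bullet> B - W \<bullet> A) \<le> L B"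
    and X: "X \<in> hermitian"
  shows "L A + (dual_seminorm W X - dual_seminorm W A) \<le> L X"
    and "L X = L A + (dual_seminorm W X - dual_seminorm W A) \<Longrightarrow>
      norm X * dual_seminorm W A = norm A * dual_seminorm W X"
proof -
  have conv: "convex_on UNIV L" and inv: "\<And>A U V. U \<in> unitary \<Longrightarrow> V \<in> unitary \<Longrightarrow> L (U ** A ** V) = L A"
    using L(1) by (auto simp: symmetric_lagrangian_def)
  obtain P Q where PQ: "P \<in> unitary" "Q \<in> unitary" "P ** X ** Q \<in> hermitian"
    "\<And>P' Q'. P' \<in> unitary \<Longrightarrow> Q' \<in> unitary \<Longrightarrow> W \<bullet> (P' ** X ** Q') \<le> W \<bullet> (P ** X ** Q)"
    using hermitian_trace_maximizer [OF W(1) X] by metis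
  define Y where "Y = P ** X ** Q"
  have Y: "Y \<in> hermitian" "L Y = L X" "norm Y = norm X" "dual_seminorm W X = W \<bullet> Y"
    using PQ inv by (auto simp: Y_def intro!: antisym dual_seminorm_least dual_seminorm_upper)
  show "L A + (dual_seminorm W X - dual_seminorm W A) \<le> L X"
    using supp [OF Y(1)] Y W(2) by simp
  assume eq: "L X = L A + (dual_seminorm W X - dual_seminorm W A)"
  \<comment> \<open>At the midpoint the support inequality and convexity bound \<open>L\<close> from
    below and above by the same number.\<close>
  define M where "M = (1 / 2) *\<^sub>R Y + (1 - 1 / 2) *\<^sub>R A"
  have "M \<in> hermitian"
    using Y(1) A by (simp add: M_def hermitian_iff ct_add ct_scaleR)
  then have "L A + (W \<bullet> M - W \<bullet> A) \<le> L M" by (rule supp)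
  moreover have "W \<bullet> M = (W \<bullet> Y + W \<bullet> A) / 2" by (simp add: M_def inner_add_right)
  moreover have "L M \<le> (L Y + L A) / 2"
    using convex_onD [OF conv, of "1 / 2" A Y] by (simp add: M_def add.commute add_divide_distrib)
  ultimately have "L M = (L Y + L A) / 2"
    using eq Y(2,4) W(2) by (simp add: field_simps)
  then have "\<exists>l. 0 < l \<and> l < 1 \<and> L (l *\<^sub>R Y + (1 - l) *\<^sub>R A) = l * L Y + (1 - l) * L A"
    unfolding M_def by (intro exI [of _ "1 / 2"]) (simp add: add_divide_distrib)
  then obtain s where s: "0 \<le> s" "Y = s *\<^sub>R A \<or> A = s *\<^sub>R Y"
    using L(2) Y(1) A unfolding nondegenerate_lagrangian_def by blast
  \<comment> \<open>Along the ray the norm and the pairing with \<open>W\<close> are both multiplied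
    by \<open>s\<close>; nonnegativity of \<open>s\<close> lets it leave the norm unchanged.\<close>
  from s(2) show "norm X * dual_seminorm W A = norm A * dual_seminorm W X"
    unfolding Y(3,4) [symmetric] W(2) [symmetric] using s(1) Y(3,4) by (auto simp: mult_ac)
qed

text \<open>\<open>L\<close> vanishes at \<open>A\<close>, at \<open>- A\<close> and at their
  midpoint 0, and nondegeneracy then puts two opposite matrices on one ray.\<close>

lemma nondegenerate_lagrangian_pos:
  fixes L :: "complex^'n^'n \<Rightarrow> real"
  assumes L: "symmetric_lagrangian L" "nondegenerate_lagrangian L"
    and A: "A \<in> hermitian" "L A = 0"
  shows "A = 0"
proof -
  have "dg (\<lambda>_. -1) \<in> unitary" by (simp add: unitary_dg)
  moreover have "- A = dg (\<lambda>_. -1) ** A ** mat 1" by (simp add: vec_eq_iff)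
  ultimately have "L (- A) = 0"
    using L(1) A(2) unitary_mat1 unfolding symmetric_lagrangian_def by metis
  moreover have "- A \<in> hermitian" using A(1) ct_scaleR [of "-1" A] by (simp add: hermitian_iff)
  moreover have "L ((1 / 2) *\<^sub>R A + (1 - 1 / 2) *\<^sub>R (- A)) = 0"
    using L(1) by (simp add: symmetric_lagrangian_def)
  ultimately have "\<exists>l. 0 < l \<and> l < 1 \<and> L (l *\<^sub>R A + (1 - l) *\<^sub>R (- A)) = l * L A + (1 - l) * L (- A)"
    using A(2) by (intro exI [of _ "1 / 2"]) simp
  then obtain s where s: "0 \<le> s" "A = s *\<^sub>R (- A) \<or> - A = s *\<^sub>R A"
    using L(2) A(1) \<open>- A \<in> hermitian\<close> unfolding nondegenerate_lagrangian_def by blast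
  have "(1 + s) *\<^sub>R A = A + s *\<^sub>R A" by (simp add: scaleR_add_left)
  also have "\<dots> = 0" using s(2) by (metis add.inverse_inverse add_eq_0_iff scaleR_minus_right)
  finally show ?thesis using s(1) by simp
qed


theorem theorem3p10:
  fixes L :: "complex^'n^'n \<Rightarrow> real"
    and U V Z :: "complex^'n^'n"
    and b :: real
    and \<alpha> :: "real \<Rightarrow> complex^'n^'n"
  assumes "symmetric_lagrangian L"
    and "nondegenerate_lagrangian L"
    and "0 < b"
    and "Z \<in> hermitian"
    and "spectral_norm Z < pi"
    and "U \<in> unitary"
    and "V = U ** mat_exp (map_matrix ((*) \<i>) Z)"
    and "joining_curve b U V \<alpha>"
    and "\<And>\<beta>. joining_curve b U V \<beta> \<Longrightarrow> action L b \<alpha> \<le> action L b \<beta>"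
  shows "reparametrization b (\<lambda>t. U ** mat_exp ((t / b) *\<^sub>R map_matrix ((*) \<i>) Z)) \<alpha>"
proof -
  note L = assms(1,2) and b = assms(3) and U = assms(6) and minimal = assms(9)
  have conv: "convex_on UNIV L" and L0: "L 0 = 0" and Lnn: "\<And>A. 0 \<le> L A"
    and inv: "\<And>A U V. U \<in> unitary \<Longrightarrow> V \<in> unitary \<Longrightarrow> L (U ** A ** V) = L A"
    using L(1) by (auto simp: symmetric_lagrangian_def)
  have Lleft: "L (P ** A) = L A" if "P \<in> unitary" for P A
    using inv [OF that unitary_mat1, of A] by simp
  have Lcont: "continuous_on UNIV L" by (rule convex_on_continuous [OF open_UNIV conv])
  obtain Q z where Q: "Q \<in> unitary" and Z: "Z = Q ** dg (\<lambda>j. of_real (z j)) ** ct Q"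
    using hermitian_diagonalization [OF assms(4)] by blast
  have z: "\<bar>z j\<bar> < pi" for j
    using spectral_norm_ge_eigenvalue [OF Q Z, of j] assms(5) by simp
  have exp: "mat_exp (r *\<^sub>R map_matrix ((*) \<i>) Z) = Q ** dg (\<lambda>j. cis (r * z j)) ** ct Q" for r
  proof -
    have "r *\<^sub>R map_matrix ((*) \<i>) Z = Q ** dg (\<lambda>j. \<i> * of_real (r * z j)) ** ct Q"
      unfolding Z
      by (intro matrix_eqI)
         (simp add: map_matrix_def conj_dg_nth sum_distrib_left scaleR_sum_right
           scaleR_conv_of_real [where 'a = complex] mult_ac)
    then show ?thesis by (simp add: mat_exp_conj_dg [OF Q] cis_conv_exp)
  qed
  have V: "V = U ** (Q ** dg (\<lambda>j. cis (z j)) ** ct Q)"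
    using exp [of 1] assms(7) by simp
  have norm_z: "norm (\<chi> j. z j :: real^'n) = norm Z"
  proof -
    have "norm Z = norm (dg (\<lambda>j. of_real (z j)) :: complex^'n^'n)"
      unfolding Z using Q by (simp add: unitary_ct)
    also have "(norm (dg (\<lambda>j. of_real (z j)) :: complex^'n^'n))\<^sup>2 = (norm (\<chi> j. z j :: real^'n))\<^sup>2"
      unfolding norm_matrix_sq
      by (simp add: dg_nth norm_vec_def L2_set_def sum_nonneg if_distrib [where f = cmod]
          if_distrib [where f = "\<lambda>u. u ^ 2"] cong: if_cong)
    ultimately show ?thesis by (simp add: power2_eq_iff_nonneg)
  qed
  have \<alpha>: "piecewise_C1 b \<alpha>" "\<And>t. t \<in> {0..b} \<Longrightarrow> \<alpha> t \<in> unitary" "\<alpha> 0 = U" "\<alpha> b = V"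
    using assms(8) by (auto simp: joining_curve_def)
  let ?D = "curve_deriv b \<alpha>"
  obtain K where K: "finite K"
    and der: "\<And>t. 0 < t \<Longrightarrow> t < b \<Longrightarrow> t \<notin> K \<Longrightarrow> (\<alpha> has_vector_derivative ?D t) (at t)"
    and isC: "\<And>t. 0 < t \<Longrightarrow> t < b \<Longrightarrow> t \<notin> K \<Longrightarrow> isCont ?D t"
    and int: "\<And>g :: complex^'n^'n \<Rightarrow> real. continuous_on UNIV g \<Longrightarrow> (\<lambda>t. g (?D t)) integrable_on {0..b}"
    using piecewise_C1_derivative [OF \<alpha>(1)] by blast
  have tangent: "\<exists>P\<in>unitary. \<exists>X\<in>hermitian. ?D t = P ** X" if "0 < t" "t < b" "t \<notin> K" for t
    using unitary_curve_tangent [of b \<alpha>, OF _ that(1,2) der [OF that]] \<alpha>(2)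
    by (metis atLeastAtMost_iff less_imp_le)
  have neg: "negligible (K \<union> {0, b})" using K by (intro negligible_finite) simp

  define A where "A = (1 / b) *\<^sub>R Z"
  have A: "A \<in> hermitian" using assms(4) by (simp add: A_def hermitian_iff ct_scaleR)
  \<comment> \<open>Minimality enters here, with the geodesic as the competitor.\<close>
  have action_\<alpha>: "integral {0..b} (\<lambda>t. L (?D t)) \<le> b * L A"
  proof -
    let ?g = "\<lambda>t. U ** (Q ** dg (\<lambda>j. cis (t / b * z j)) ** ct Q)"
    have "L (vector_derivative ?g (at t within {0..b})) = L A" if "t \<in> {0..b}" for t
      using geodesic_joining_curve(2) [OF b U Q that, of z] Lleft by (auto simp: A_def Z)
    then have "action L b ?g = integral {0..b} (\<lambda>t. L A)"
      unfolding action_def by (intro Henstock_Kurzweil_Integration.integral_cong)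
    also have "\<dots> = b * L A" using b by simp
    finally show ?thesis
      using minimal [of ?g] geodesic_joining_curve(1) [OF b U Q, of z] V
      by (simp add: action_def curve_deriv_def)
  qed

  obtain W where W: "W \<in> hermitian" "W \<bullet> A = dual_seminorm W A"
    and supp: "\<And>B. B \<in> hermitian \<Longrightarrow> L A + (W \<bullet> B - W \<bullet> A) \<le> L B"
    using lagrangian_support [OF L(1) A] by blast
  interpret N: ui_seminorm "dual_seminorm W" by (rule ui_seminorm_dual)
  let ?N = "dual_seminorm W"
  have contact: "L A + (?N X - ?N A) \<le> L X"
    "L X = L A + (?N X - ?N A) \<Longrightarrow> norm X * ?N A = norm A * ?N X" if "X \<in> hermitian" for X
    using lagrangian_contact [OF L A W _ that] supp by blast+
  have NA: "b * ?N A = ?N Z" using b by (simp add: A_def N.scale)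
  have ND: "continuous_on UNIV ?N" by (rule N.continuous_on)

  \<comment> \<open>The defect in the support inequality. Its integral is the excess of the action
    over \<open>b * L A\<close> minus the excess of the \<open>N\<close>-length over
    \<open>?N Z\<close>.\<close>
  define h where "h t = L (?D t) - (L A + (?N (?D t) - ?N A))" for t
  have h_cont: "continuous_on UNIV (\<lambda>D. L D - (L A + (?N D - ?N A)))"
    by (intro continuous_intros Lcont ND)
  have h_nonneg: "0 \<le> h t" if "0 < t" "t < b" "t \<notin> K" for t
    using tangent [OF that] contact(1) Lleft by (auto simp: h_def)
  have int_h: "integral {0..b} h = integral {0..b} (\<lambda>t. L (?D t)) - (b * L A - ?N Z) - integral {0..b} (\<lambda>t. ?N (?D t))"
  proof -
    have "integral {0..b} h = integral {0..b} (\<lambda>t. (L (?D t) - ?N (?D t)) - (L A - ?N A))"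
      unfolding h_def by (simp add: algebra_simps)
    also have "\<dots> = integral {0..b} (\<lambda>t. L (?D t) - ?N (?D t)) - integral {0..b} (\<lambda>t. L A - ?N A)"
      by (intro Henstock_Kurzweil_Integration.integral_diff integrable_diff int Lcont ND) auto
    also have "integral {0..b} (\<lambda>t. L (?D t) - ?N (?D t))
        = integral {0..b} (\<lambda>t. L (?D t)) - integral {0..b} (\<lambda>t. ?N (?D t))"
      by (intro Henstock_Kurzweil_Integration.integral_diff int Lcont ND)
    finally show ?thesis using b NA by (simp add: algebra_simps)
  qed
  have length: "?N Z \<le> integral {0..b} (\<lambda>t. ?N (?D t))"
    unfolding Z using \<alpha> b Q z V by (intro N.length_ge) (auto intro: less_imp_le)
  have h_zero: "h t = 0" if t: "0 < t" "t < b" "t \<notin> K" for t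
  proof (rule nonneg_integrand_zero [OF _ K h_nonneg _ t])
    show "h integrable_on {0..b}" unfolding h_def by (rule int [OF h_cont])
    show "integral {0..b} h \<le> 0" using int_h action_\<alpha> length by linarith
    show "isCont h t"
      unfolding h_def
      by (rule isCont_o2 [OF isC [OF t]]) (use h_cont in \<open>simp add: continuous_on_eq_continuous_at\<close>)
  qed
  have "integral {0..b} h = integral {0..b} (\<lambda>t. 0)"
    by (rule integral_spike [OF neg]) (use h_zero in \<open>auto simp: less_le\<close>)
  \<comment> \<open>With no defect left, the bound on the action turns into an upper bound for the
    \<open>N\<close>-length.\<close>
  then have length_le: "integral {0..b} (\<lambda>t. ?N (?D t)) \<le> ?N Z"
    using int_h action_\<alpha> by simp

  have proportional: "norm (?D t) * ?N Z = norm Z * ?N (?D t)" if t: "0 < t" "t < b" "t \<notin> K" for t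
  proof -
    obtain P X where PX: "P \<in> unitary" "X \<in> hermitian" "?D t = P ** X" using tangent [OF t] by blast
    have "norm X * ?N A = norm A * ?N X"
      using contact(2) [OF PX(2)] h_zero [OF t] Lleft [OF PX(1), of X] PX by (simp add: h_def)
    then show ?thesis using PX b by (simp add: A_def N.scale)
  qed
  have short: "integral {0..b} (\<lambda>t. norm (?D t)) \<le> norm Z"
  proof (cases "Z = 0")
    \<comment> \<open>Here \<open>?N\<close> may vanish identically, so constancy of the curve is
      read off from \<open>L\<close> directly.\<close>
    case True
    have "?D t = 0" if t: "0 < t" "t < b" "t \<notin> K" for t
    proof -
      obtain P X where PX: "P \<in> unitary" "X \<in> hermitian" "?D t = P ** X" using tangent [OF t] by blast
      have "L (?D t) = 0"
      proof (rule nonneg_integrand_zero [OF _ K Lnn _ t])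
        show "(\<lambda>t. L (?D t)) integrable_on {0..b}" by (rule int [OF Lcont])
        show "integral {0..b} (\<lambda>t. L (?D t)) \<le> 0" using action_\<alpha> True by (simp add: A_def L0)
        show "isCont (\<lambda>t. L (?D t)) t"
          by (rule isCont_o2 [OF isC [OF t]]) (use Lcont in \<open>simp add: continuous_on_eq_continuous_at\<close>)
      qed
      then have "X = 0" using nondegenerate_lagrangian_pos [OF L PX(2)] Lleft [OF PX(1), of X] PX(3) by simp
      then show ?thesis using PX(1,3) norm_unitary_left by (metis norm_eq_zero)
    qed
    then have "integral {0..b} (\<lambda>t. norm (?D t)) = integral {0..b} (\<lambda>t. 0)"
      by (intro integral_spike [OF neg]) (auto simp: less_le)
    then show ?thesis by simp
  next
    case False
    have "L A \<noteq> 0"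
      using nondegenerate_lagrangian_pos [OF L A] False b by (auto simp: A_def)
    then have "0 < L A" using Lnn [of A] by simp
    moreover have "0 \<in> hermitian" by (simp add: hermitian_iff vec_eq_iff)
    \<comment> \<open>Testing the support inequality at 0 gives the positivity of \<open>?N\<close>
      by which the proportionality is divided below.\<close>
    then have "L A \<le> ?N A" using supp [of 0] L0 W(2) by simp
    ultimately have NZ: "0 < ?N Z" using b NA by (metis mult_pos_pos order_less_le_trans)
    have "integral {0..b} (\<lambda>t. norm (?D t)) * ?N Z = integral {0..b} (\<lambda>t. norm (?D t) * ?N Z)"
      by simp
    also have "\<dots> = integral {0..b} (\<lambda>t. norm Z * ?N (?D t))"
      by (rule integral_spike [OF neg]) (use proportional in \<open>auto simp: less_le\<close>)
    also have "\<dots> = norm Z * integral {0..b} (\<lambda>t. ?N (?D t))"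
      by simp
    also have "\<dots> \<le> norm Z * ?N Z" by (intro mult_left_mono length_le) simp
    finally show ?thesis using NZ by simp
  qed
  have "reparametrization b (\<lambda>t. \<alpha> 0 ** (Q ** dg (\<lambda>j. cis (t / b * z j)) ** ct Q)) \<alpha>"
    using \<alpha> V short
    by (intro frobenius_minimizer_reparametrizes [OF b \<alpha>(1,2) Q z]) (auto simp: norm_z)
  then show ?thesis by (simp only: exp \<alpha>(3))
qed

end
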